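(* Let $k\ge 2$ be an integer. For any integer $q\ge 2$, $$\tau(\mathrm{T}(K_k))\le \log_q\Bigl(\frac{q+2}{2^{\mathrm{q}_{\mathrm{M}}(D_{(2,k-2)})}}\Bigr),$$ where $K_k$ is the complete graph on $k$ vertices, $\tau(\mathrm{T}(K_k))$ is the exponent per edge of its graph tensor, and $\mathrm{q}_{\mathrm{M}}(D_{(2,k-2)})$ is the monomial subexponent of the weight-$(2,k-2)$ Dicke tensor in the standard basis.
   Context: All vector spaces are finite-dimensional over $\mathbb{C}$; graphs are finite, simple and undirected; $[n]=\{1,\dots,n\}$; $b_1,\dots,b_n$ is the standard basis of $\mathbb{C}^n$. A $k$-tensor is an element of $V_1\otimes\cdots\otimes V_k$. For $k$-tensors $\phi\in U_1\otimes\cdots\otimes U_k$, $\psi\in V_1\otimes\cdots\otimes V_k$, the product $\phi\otimes\psi$ is regarded as a $k$-tensor in $(U_1\otimes V_1)\otimes\cdots\otimes(U_k\otimes V_k)$, and $\phi^{\otimes N}$ is the $N$-fold product (again a $k$-tensor). If bases are fixed, powers carry the product bases. Unit tensor: $\mathrm{T}_r(k)=\sum_{i=1}^r b_i^{\otimes k}\in(\mathbb{C}^r)^{\otimes k}$; write $\mathrm{T}=\mathrm{T}_2(k)$. Restriction: $\phi\ge\psi$ if there are linear maps $A_i:U_i\to V_i$ with $\psi=(A_1\otimes\cdots\otimes A_k)\phi$. Exponent: $\omega(\psi)=\lim_{n\to\infty}\frac1n\min\{m\in\mathbb{N}\mid \mathrm{T}^{\otimes m}\ge\psi^{\otimes n}\}$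 (the limit exists). Monomial degeneration: with bases fixed, $\phi\unrhd_{\mathrm M}\psi$ if, after regarding $\phi$ and $\psi$ as elements of a common larger tensor product space by zero-padding (extending the bases), $\psi$ lies in the Zariski closure of the orbit of $\phi$ under the group of $k$-tuples of invertible monomial matrices (a monomial matrix has at most one nonzero entry in each row and each column). Monomial subexponent: $\mathrm{q}_{\mathrm M}(\phi)=\bigl(\lim_{n\to\infty}\frac1n\min\{m\in\mathbb{N}\mid\phi^{\otimes m}\unrhd_{\mathrm M}\mathrm{T}^{\otimes n}\}\bigr)^{-1}$, with $\min\emptyset=\infty$ and $\infty^{-1}=0$. Graph tensor: for a graph $G=(V,E)$, $\mathrm{T}_n(G)=\sum_{i\in[n]^E}\bigotimes_{v\in V}\bigl(\bigotimes_{e\in E:\,v\in e}b_{i_e}\bigr)$, a $|V|$-tensor (one tensor leg for each vertex); $\mathrm{T}(G)=\mathrm{T}_2(G)$; exponent per edge $\tau(\mathrm{T}(G))=\omega(\mathrm{T}(G))/|E|$. Dicke tensor: $D_{(2,k-2)}=\sum_i b_{i_1}\otimes\cdots\otimes b_{i_k}\in(\mathbb{C}^2)^{\otimes k}$, summed over all $i\in\{1,2\}^k$ having exactly two entries equal to $1$ and $k-2$ entries equal to $2$. *)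

theory Defs
  imports Complex_Main "HOL-Library.FuncSet" "HOL-Library.Extended_Real"
begin

text \<open>
  A tensor over the complex numbers in coordinates: the tensor leg \<open>v \<in> legs \<phi>\<close> is the space
  with basis labelled by the finite set \<open>idx \<phi> v\<close>, and \<open>coord \<phi> x\<close> is the coefficient of
  the basis tensor \<open>\<Otimes>\<^sub>v b\<^sub>(x v)\<close>. Only the values of \<open>coord \<phi>\<close> on
  \<open>PiE (legs \<phi>) (idx \<phi>)\<close> are meaningful. Since the two exponents below compare tensors with the
  unit tensor on the same legs, the legs form an arbitrary finite set rather than \<open>{1..k}\<close>.
\<close>

record ('v, 'j) tensor =
  legs :: "'v set"
  idx :: "'v \<Rightarrow> 'j set"
  coord :: "('v \<Rightarrow> 'j) \<Rightarrow> complex"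

definition multi_idx :: "('v, 'j) tensor \<Rightarrow> ('v \<Rightarrow> 'j) set" where
  "multi_idx \<phi> = PiE (legs \<phi>) (idx \<phi>)"

text \<open>
  The product bases of the \<open>N\<close>-fold product are labelled by the lists of length \<open>N\<close>.
\<close>

definition tensor_power :: "('v, 'j) tensor \<Rightarrow> nat \<Rightarrow> ('v, 'j list) tensor" where
  "tensor_power \<phi> N =
     \<lparr>legs = legs \<phi>,
      idx = (\<lambda>v. {xs. length xs = N \<and> set xs \<subseteq> idx \<phi> v}),
      coord = (\<lambda>x. \<Prod>j<N. coord \<phi> (\<lambda>v\<in>legs \<phi>. x v ! j))\<rparr>"

definition unit_tensor :: "'v set \<Rightarrow> nat \<Rightarrow> ('v, nat) tensor" where
  "unit_tensor V r =
     \<lparr>legs = V,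
      idx = (\<lambda>v. {1..r}),
      coord = (\<lambda>x. \<Sum>i = 1..r. \<Prod>v\<in>V. of_bool (x v = i))\<rparr>"

text \<open>
  The image of \<open>\<phi>\<close> under \<open>\<Otimes>\<^sub>v A v\<close>, where \<open>A v\<close> is the matrix, with rows labelled by \<open>L v\<close>
  and columns by \<open>idx \<phi> v\<close>, of a linear map on the leg \<open>v\<close>.
\<close>

definition tensor_map ::
    "('v \<Rightarrow> 'l \<Rightarrow> 'j \<Rightarrow> complex) \<Rightarrow> ('v \<Rightarrow> 'l set) \<Rightarrow> ('v, 'j) tensor \<Rightarrow> ('v, 'l) tensor" where
  "tensor_map A L \<phi> =
     \<lparr>legs = legs \<phi>,
      idx = L,
      coord = (\<lambda>y. \<Sum>x\<in>multi_idx \<phi>. (\<Prod>v\<in>legs \<phi>. A v (y v) (x v)) * coord \<phi> x)\<rparr>"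

definition restricts_to :: "('v, 'j) tensor \<Rightarrow> ('v, 'l) tensor \<Rightarrow> bool" where
  "restricts_to \<phi> \<psi> \<longleftrightarrow>
     legs \<psi> = legs \<phi> \<and>
     (\<exists>A. \<forall>y\<in>multi_idx \<psi>. coord \<psi> y = coord (tensor_map A (idx \<psi>) \<phi>) y)"

text \<open>
  The set under \<open>LEAST\<close> is never empty for a tensor with at least one leg: every such tensor is a
  finite sum of simple tensors, hence a restriction of a large enough unit tensor.
\<close>

definition exponent :: "('v, 'j) tensor \<Rightarrow> real" where
  "exponent \<psi> =
     lim (\<lambda>n. real (LEAST m. restricts_to (tensor_power (unit_tensor (legs \<psi>) 2) m)
                                         (tensor_power \<psi> n)) / real n)"

text \<open>
  Polynomial functions in the variables labelled by \<open>I\<close>, and the Zariski closure in the affine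
  space with coordinates labelled by \<open>I\<close>. Points are functions whose values outside \<open>I\<close> are
  ignored.
\<close>

inductive_set polynomial_functions :: "'i set \<Rightarrow> (('i \<Rightarrow> complex) \<Rightarrow> complex) set"
  for I :: "'i set" where
  const: "(\<lambda>_. c) \<in> polynomial_functions I"
| var: "i \<in> I \<Longrightarrow> (\<lambda>x. x i) \<in> polynomial_functions I"
| add: "p \<in> polynomial_functions I \<Longrightarrow> q \<in> polynomial_functions I \<Longrightarrow>
    (\<lambda>x. p x + q x) \<in> polynomial_functions I"
| mult: "p \<in> polynomial_functions I \<Longrightarrow> q \<in> polynomial_functions I \<Longrightarrow>
    (\<lambda>x. p x * q x) \<in> polynomial_functions I"

definition zariski_closure :: "'i set \<Rightarrow> ('i \<Rightarrow> complex) set \<Rightarrow> ('i \<Rightarrow> complex) set" where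
  "zariski_closure I S =
     {y. \<forall>p\<in>polynomial_functions I. (\<forall>x\<in>S. p x = 0) \<longrightarrow> p y = 0}"

definition monomial_matrix :: "'j set \<Rightarrow> ('j \<Rightarrow> 'j \<Rightarrow> complex) \<Rightarrow> bool" where
  "monomial_matrix J M \<longleftrightarrow>
     (\<forall>a\<in>J. \<forall>b\<in>J. \<forall>c\<in>J. M a b \<noteq> 0 \<and> M a c \<noteq> 0 \<longrightarrow> b = c) \<and>
     (\<forall>a\<in>J. \<forall>b\<in>J. \<forall>c\<in>J. M b a \<noteq> 0 \<and> M c a \<noteq> 0 \<longrightarrow> b = c)"

definition invertible_matrix :: "'j set \<Rightarrow> ('j \<Rightarrow> 'j \<Rightarrow> complex) \<Rightarrow> bool" where
  "invertible_matrix J M \<longleftrightarrow>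
     (\<exists>N. \<forall>a\<in>J. \<forall>c\<in>J. (\<Sum>b\<in>J. M a b * N b c) = of_bool (a = c) \<and>
                     (\<Sum>b\<in>J. N a b * M b c) = of_bool (a = c))"

definition monomial_orbit :: "('v, 'j) tensor \<Rightarrow> ('v, 'j) tensor set" where
  "monomial_orbit \<phi> =
     {tensor_map A (idx \<phi>) \<phi> | A.
        \<forall>v\<in>legs \<phi>. monomial_matrix (idx \<phi> v) (A v) \<and> invertible_matrix (idx \<phi> v) (A v)}"

text \<open>
  Zero-padding along injections \<open>e v\<close> from \<open>idx \<phi> v\<close> into the larger basis \<open>K v\<close>.
\<close>

definition zero_pad ::
    "('v \<Rightarrow> 'j \<Rightarrow> 'l) \<Rightarrow> ('v \<Rightarrow> 'l set) \<Rightarrow> ('v, 'j) tensor \<Rightarrow> ('v, 'l) tensor" where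
  "zero_pad e K \<phi> = tensor_map (\<lambda>v b a. of_bool (b = e v a)) K \<phi>"

definition extends_bases ::
    "('v \<Rightarrow> 'j \<Rightarrow> 'l) \<Rightarrow> ('v \<Rightarrow> 'l set) \<Rightarrow> ('v, 'j) tensor \<Rightarrow> bool" where
  "extends_bases e K \<phi> \<longleftrightarrow>
     (\<forall>v\<in>legs \<phi>. finite (K v) \<and> inj_on (e v) (idx \<phi> v) \<and> e v ` idx \<phi> v \<subseteq> K v)"

definition monomially_degenerates_to :: "('v, 'j) tensor \<Rightarrow> ('v, 'l) tensor \<Rightarrow> bool" where
  "monomially_degenerates_to \<phi> \<psi> \<longleftrightarrow>
     legs \<psi> = legs \<phi> \<and>
     (\<exists>(K :: 'v \<Rightarrow> nat set) e f.
        extends_bases e K \<phi> \<and> extends_bases f K \<psi> \<and>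
        coord (zero_pad f K \<psi>) \<in>
          zariski_closure (PiE (legs \<phi>) K) (coord ` monomial_orbit (zero_pad e K \<phi>)))"

text \<open>
  In \<open>ereal\<close> the infimum of the empty set is \<open>\<infinity>\<close> and \<open>inverse \<infinity> = 0\<close>. The value \<open>\<infinity>\<close> does not
  occur for tensors with at least one leg: monomial degeneration does not increase the number of
  nonzero coordinates, so the limit is positive.
\<close>

definition monomial_subexponent :: "('v, 'j) tensor \<Rightarrow> ereal" where
  "monomial_subexponent \<phi> =
     inverse (lim (\<lambda>n. (INF m\<in>{m. monomially_degenerates_to (tensor_power \<phi> m)
                                      (tensor_power (unit_tensor (legs \<phi>) 2) n)}. ereal (real m))
                      / ereal (real n)))"

text \<open>
  A graph is given by its vertex set \<open>V\<close> and its set \<open>E\<close> of two-element edges. The leg at \<open>v\<close> of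
  its graph tensor has the product basis labelled by the maps from the edges at \<open>v\<close> to \<open>{1..n}\<close>.
\<close>

definition incident :: "'v set set \<Rightarrow> 'v \<Rightarrow> 'v set set" where
  "incident E v = {e \<in> E. v \<in> e}"

definition graph_tensor :: "nat \<Rightarrow> 'v set \<Rightarrow> 'v set set \<Rightarrow> ('v, 'v set \<Rightarrow> nat) tensor" where
  "graph_tensor n V E =
     \<lparr>legs = V,
      idx = (\<lambda>v. PiE (incident E v) (\<lambda>_. {1..n})),
      coord = (\<lambda>x. \<Sum>i\<in>PiE E (\<lambda>_. {1..n}). \<Prod>v\<in>V. of_bool (x v = restrict i (incident E v)))\<rparr>"

definition exponent_per_edge :: "'v set \<Rightarrow> 'v set set \<Rightarrow> real" where
  "exponent_per_edge V E = exponent (graph_tensor 2 V E) / real (card E)"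

definition complete_edges :: "'v set \<Rightarrow> 'v set set" where
  "complete_edges V = {e. e \<subseteq> V \<and> card e = 2}"

definition dicke_tensor :: "nat \<Rightarrow> nat \<Rightarrow> (nat, nat) tensor" where
  "dicke_tensor a b =
     \<lparr>legs = {1..a + b},
      idx = (\<lambda>v. {1, 2}),
      coord = (\<lambda>x. of_bool (card {v \<in> {1..a + b}. x v = 1} = a \<and>
                            card {v \<in> {1..a + b}. x v = 2} = b))\<rparr>"

end

theory Submission
  imports Defs "HOL-Computational_Algebra.Polynomial" "HOL-Combinatorics.Permutations"
begin

text \<open>
  The proof is the Coppersmith-Winograd method for the complete graph on \<open>k\<close> vertices. The tensor
  \<open>cw\<close>, the sum over all edges and all \<open>i \<in> {1..q}\<close> of the basis tensor with \<open>i\<close> at the ends of the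
  edge and \<open>0\<close> elsewhere, is a limit of tensors of rank \<open>q + 2\<close> (\<open>rank_cw_poly\<close>). Replacing all
  nonzero indices by one symbol turns it into the Dicke tensor \<open>D\<close> of weight \<open>(2, k - 2)\<close>. In the \<open>m\<close>-th
  power, an element of the support of \<open>D\<^sup>\<otimes>\<^sup>m\<close> is a sequence of \<open>m\<close> edges, and the block over
  it is the graph tensor of the multigraph with these edges, with bonds of dimension \<open>q\<close>.

  A monomial degeneration of \<open>D\<^sup>\<otimes>\<^sup>m\<close> to the unit tensor with \<open>2 ^ n\<close> terms is the same as a choice
  of integer weights that vanish on \<open>2 ^ n\<close> edge sequences, pairwise different on every leg, and are
  positive on all other ones (\<open>diagonal_of_monomial_degeneration\<close>,
  \<open>monomial_degeneration_of_diagonal\<close>). One direction lets a one-parameter group act. For the other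
  one, Fourier-Motzkin elimination either finds the weights or yields an integer relation, hence a
  binomial that separates the unit tensor from the orbit (\<open>weights_or_binomial\<close>). The same weights
  degenerate \<open>cw\<^sup>\<otimes>\<^sup>m\<close> to the direct sum of the corresponding blocks. Both limits are replaced by
  averages over roots of unity (\<open>rank_le_of_border\<close>), whose number grows linearly with the power that
  is taken and therefore disappears in the exponent.

  Since there are only polynomially many multisets of \<open>m\<close> edges, about \<open>2 ^ n\<close> of the blocks are
  copies of one multigraph tensor \<open>f\<close>. Schonhage's argument (\<open>rank_le_power_of_labelled\<close>)
  turns the bound \<open>(q + 2) ^ m\<close> for \<open>2 ^ n\<close> copies of \<open>f\<close> into the asymptotic bound
  \<open>(q + 2) ^ m / 2 ^ n\<close> for \<open>f\<close> itself. Multiplying the images of \<open>f\<close> under all permutations of the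
  vertices distributes its edges evenly over the complete graph (\<open>rank_complete_graph_power\<close>), so every edge
  of the complete graph costs the logarithm to base \<open>q\<close> of \<open>(q + 2) / 2 powr (n / m)\<close>. Finally \<open>n / m\<close> tends
  to the subexponent: by \<open>diagonal_at_add\<close> and Fekete's lemma the limit in its definition exists.
\<close>

section \<open>Tensor rank of coordinate functions\<close>

text \<open>
  Tensors are handled through their coordinate functions, and only the points of \<open>Pi V J\<close> matter.
  The index sets \<open>J v\<close> may be infinite, so that bases can be labelled by arbitrary functions.
\<close>

definition rank_le ::
    "'v set \<Rightarrow> ('v \<Rightarrow> 'j set) \<Rightarrow> nat \<Rightarrow> (('v \<Rightarrow> 'j) \<Rightarrow> complex) \<Rightarrow> bool" where
  "rank_le V J r f \<longleftrightarrow> (\<exists>a. \<forall>x\<in>Pi V J. f x = (\<Sum>i<r. \<Prod>v\<in>V. a i v (x v)))"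

lemma rank_leI:
  fixes a :: "'i \<Rightarrow> 'v \<Rightarrow> 'j \<Rightarrow> complex"
  assumes V: "finite V" "V \<noteq> {}" and I: "finite I" "card I \<le> r"
    and f: "\<And>x. x \<in> Pi V J \<Longrightarrow> f x = (\<Sum>i\<in>I. \<Prod>v\<in>V. a i v (x v))"
  shows "rank_le V J r f"
proof -
  obtain h where h: "bij_betw h {..<card I} I"
    using ex_bij_betw_nat_finite[OF I(1)] by (auto simp: atLeast0LessThan)
  define b where "b i v y = (if i < card I then a (h i) v y else 0)" for i v y
  have "f x = (\<Sum>i<r. \<Prod>v\<in>V. b i v (x v))" if x: "x \<in> Pi V J" for x
  proof -
    have "(\<Sum>i<r. \<Prod>v\<in>V. b i v (x v)) = (\<Sum>i<card I. \<Prod>v\<in>V. b i v (x v))"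
      using I(2) V by (intro sum.mono_neutral_right) (auto simp: b_def)
    also have "\<dots> = (\<Sum>i<card I. \<Prod>v\<in>V. a (h i) v (x v))"
      by (intro sum.cong refl prod.cong) (auto simp: b_def)
    also have "\<dots> = (\<Sum>i\<in>I. \<Prod>v\<in>V. a i v (x v))"
      by (rule sum.reindex_bij_betw[OF h, of "\<lambda>i. \<Prod>v\<in>V. a i v (x v)"])
    finally show ?thesis using f[OF x] by simp
  qed
  thus ?thesis unfolding rank_le_def by blast
qed

lemma rank_le_index:
  assumes "rank_le V J r f" "finite I" "card I = r"
  obtains a where "\<And>x. x \<in> Pi V J \<Longrightarrow> f x = (\<Sum>i\<in>I. \<Prod>v\<in>V. a i v (x v))"
proof -
  obtain h where h: "bij_betw h I {..<r}"
    using ex_bij_betw_finite_nat[OF assms(2)] assms(3) by (auto simp: atLeast0LessThan)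
  obtain a where a: "\<And>x. x \<in> Pi V J \<Longrightarrow> f x = (\<Sum>i<r. \<Prod>v\<in>V. a i v (x v))"
    using assms(1) unfolding rank_le_def by blast
  show ?thesis
  proof (rule that[of "\<lambda>i. a (h i)"])
    fix x assume "x \<in> Pi V J"
    thus "f x = (\<Sum>i\<in>I. \<Prod>v\<in>V. a (h i) v (x v))"
      using a sum.reindex_bij_betw[OF h, of "\<lambda>i. \<Prod>v\<in>V. a i v (x v)"] by simp
  qed
qed

lemma rank_leE:
  assumes "rank_le V J r f"
  obtains a where "\<And>x. x \<in> Pi V J \<Longrightarrow> f x = (\<Sum>i<r. \<Prod>v\<in>V. a i v (x v))"
  using assms unfolding rank_le_def by blast

lemma rank_le_mono:
  assumes "finite V" "V \<noteq> {}" "rank_le V J r f" "r \<le> r'"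
  shows "rank_le V J r' f"
proof -
  obtain a where "\<And>x. x \<in> Pi V J \<Longrightarrow> f x = (\<Sum>i<r. \<Prod>v\<in>V. a i v (x v))"
    using assms(3) unfolding rank_le_def by blast
  thus ?thesis using assms by (intro rank_leI[where I="{..<r}" and a=a]) auto
qed

lemma rank_le_cong:
  assumes "rank_le V J r f" "\<And>x. x \<in> Pi V J \<Longrightarrow> g x = f x"
  shows "rank_le V J r g"
  using assms unfolding rank_le_def by simp

lemma rank_le_pullback:
  assumes "rank_le V J r f" "\<And>x. x \<in> Pi V K \<Longrightarrow> g x = f (\<lambda>v. h v (x v))"
    and "\<And>v y. v \<in> V \<Longrightarrow> y \<in> K v \<Longrightarrow> h v y \<in> J v"
  shows "rank_le V K r g"
proof -
  obtain a where a: "\<And>x. x \<in> Pi V J \<Longrightarrow> f x = (\<Sum>i<r. \<Prod>v\<in>V. a i v (x v))"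
    by (rule rank_leE[OF assms(1)]) blast
  have "g x = (\<Sum>i<r. \<Prod>v\<in>V. a i v (h v (x v)))" if "x \<in> Pi V K" for x
    using assms(2)[OF that] a[of "\<lambda>v. h v (x v)"] assms(3) that by (simp add: Pi_iff)
  thus ?thesis unfolding rank_le_def by (intro exI[of _ "\<lambda>i v y. a i v (h v y)"]) blast
qed

lemma rank_le_simple:
  assumes "finite V" "V \<noteq> {}" "\<And>x. x \<in> Pi V J \<Longrightarrow> f x = c * (\<Prod>v\<in>V. w v (x v))"
  shows "rank_le V J 1 f"
proof -
  obtain v0 where v0: "v0 \<in> V" using assms(2) by blast
  show ?thesis
  proof (rule rank_leI[where I="{()}" and a="\<lambda>_ v y. (if v = v0 then c else 1) * w v y"])
    fix x assume "x \<in> Pi V J"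
    thus "f x = (\<Sum>i\<in>{()}. \<Prod>v\<in>V. (if v = v0 then c else 1) * w v (x v))"
      using assms(1,3) v0 by (simp add: prod.distrib prod.delta)
  qed (use assms in auto)
qed

lemma rank_le_mult:
  assumes V: "finite V" "V \<noteq> {}" and fg: "rank_le V J r f" "rank_le V J s g"
  shows "rank_le V J (r * s) (\<lambda>x. f x * g x)"
proof -
  obtain a where a: "\<And>x. x \<in> Pi V J \<Longrightarrow> f x = (\<Sum>i<r. \<Prod>v\<in>V. a i v (x v))"
    by (rule rank_leE[OF fg(1)]) blast
  obtain b where b: "\<And>x. x \<in> Pi V J \<Longrightarrow> g x = (\<Sum>i<s. \<Prod>v\<in>V. b i v (x v))"
    by (rule rank_leE[OF fg(2)]) blast
  show ?thesis
    by (rule rank_leI[where I="{..<r} \<times> {..<s}" and a="\<lambda>(i,j) v y. a i v y * b j v y"])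
      (use V in \<open>auto simp: a b sum_product sum.cartesian_product prod.distrib intro!: sum.cong\<close>)
qed

lemma rank_le_one: "finite V \<Longrightarrow> V \<noteq> {} \<Longrightarrow> rank_le V J 1 (\<lambda>x. 1)"
  by (rule rank_le_simple[where c=1 and w="\<lambda>_ _. 1"]) auto

lemma rank_le_prod:
  assumes V: "finite V" "V \<noteq> {}" and "finite S" "\<And>s. s \<in> S \<Longrightarrow> rank_le V J r (f s)"
  shows "rank_le V J (r ^ card S) (\<lambda>x. \<Prod>s\<in>S. f s x)"
  using assms(3,4)
proof (induction S)
  case empty
  thus ?case using rank_le_one[OF V] by simp
next
  case (insert s S)
  have "rank_le V J (r * r ^ card S) (\<lambda>x. f s x * (\<Prod>s\<in>S. f s x))"
    using insert by (intro rank_le_mult V) auto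
  thus ?case using insert by simp
qed

lemma rank_le_add:
  assumes V: "finite V" "V \<noteq> {}" and fg: "rank_le V J r f" "rank_le V J s g"
  shows "rank_le V J (r + s) (\<lambda>x. f x + g x)"
proof -
  obtain a where a: "\<And>x. x \<in> Pi V J \<Longrightarrow> f x = (\<Sum>i<r. \<Prod>v\<in>V. a i v (x v))"
    by (rule rank_leE[OF fg(1)]) blast
  obtain b where b: "\<And>x. x \<in> Pi V J \<Longrightarrow> g x = (\<Sum>i<s. \<Prod>v\<in>V. b i v (x v))"
    by (rule rank_leE[OF fg(2)]) blast
  have card: "card ({..<r} <+> {..<s}) = r + s" by (simp add: card_Plus)
  show ?thesis
    by (rule rank_leI[where I="{..<r} <+> {..<s}" and a="case_sum a b"])
      (use V card in \<open>auto simp: a b sum.Plus\<close>)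
qed

lemma rank_le_sum:
  assumes V: "finite V" "V \<noteq> {}" and "finite S" "\<And>s. s \<in> S \<Longrightarrow> rank_le V J r (f s)"
  shows "rank_le V J (card S * r) (\<lambda>x. \<Sum>s\<in>S. f s x)"
  using assms(3,4)
proof (induction S)
  case empty
  show ?case by (simp add: rank_le_def)
next
  case (insert s S)
  have "rank_le V J (r + card S * r) (\<lambda>x. f s x + (\<Sum>s\<in>S. f s x))"
    using insert by (intro rank_le_add V) auto
  thus ?case using insert by simp
qed

lemma rank_le_weight:
  assumes V: "finite V" "V \<noteq> {}" and f: "rank_le V J r f"
  shows "rank_le V J r (\<lambda>x. c * (\<Prod>v\<in>V. w v (x v)) * f x)"
  using rank_le_mult[OF V rank_le_simple[OF V, where f="\<lambda>x. c * (\<Prod>v\<in>V. w v (x v))"] f] by simp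

lemma rank_le_permute:
  assumes V: "finite V" and p: "p permutes V" and f: "rank_le V (\<lambda>_. J) r f"
  shows "rank_le V (\<lambda>_. J) r (\<lambda>x. f (x \<circ> p))"
proof -
  obtain a where a: "\<And>x. x \<in> Pi V (\<lambda>_. J) \<Longrightarrow> f x = (\<Sum>i<r. \<Prod>v\<in>V. a i v (x v))"
    using f unfolding rank_le_def by blast
  have "f (x \<circ> p) = (\<Sum>i<r. \<Prod>v\<in>V. a i (inv p v) (x v))" if x: "x \<in> Pi V (\<lambda>_. J)" for x
  proof -
    have "x \<circ> p \<in> Pi V (\<lambda>_. J)" using x p by (auto simp: Pi_iff permutes_in_image)
    hence "f (x \<circ> p) = (\<Sum>i<r. \<Prod>v\<in>V. a i v (x (p v)))" using a by simp
    also have "\<dots> = (\<Sum>i<r. \<Prod>v\<in>V. a i (inv p (p v)) (x (p v)))"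
      using permutes_inverses(2)[OF p] by simp
    also have "\<dots> = (\<Sum>i<r. \<Prod>v\<in>V. a i (inv p v) (x v))"
      by (intro sum.cong refl prod.reindex_bij_betw[OF permutes_imp_bij[OF p]])
    finally show ?thesis .
  qed
  thus ?thesis unfolding rank_le_def by (intro exI[of _ "\<lambda>i v. a i (inv p v)"]) blast
qed

lemma rank_le_finite:
  assumes V: "finite V" "V \<noteq> {}" and J: "\<And>v. v \<in> V \<Longrightarrow> finite (J v)"
    and f: "\<And>x. x \<in> Pi V J \<Longrightarrow> f x = f (restrict x V)"
  shows "\<exists>r. rank_le V J r f"
proof -
  have fin: "finite (PiE V J)" using V J by (intro finite_PiE) auto
  have "rank_le V J (card (PiE V J) * 1) (\<lambda>x. \<Sum>z\<in>PiE V J. f z * (\<Prod>v\<in>V. of_bool (x v = z v)))"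
    by (intro rank_le_sum[OF V fin] rank_le_simple[OF V]) (rule refl)
  moreover have "f x = (\<Sum>z\<in>PiE V J. f z * (\<Prod>v\<in>V. of_bool (x v = z v)))" if x: "x \<in> Pi V J" for x
  proof -
    have "(\<Sum>z\<in>PiE V J. f z * (\<Prod>v\<in>V. of_bool (x v = z v)))
        = (\<Sum>z\<in>{restrict x V}. f z * (\<Prod>v\<in>V. of_bool (x v = z v)))"
    proof (rule sum.mono_neutral_right[OF fin])
      show "\<forall>z\<in>PiE V J - {restrict x V}. f z * (\<Prod>v\<in>V. of_bool (x v = z v)) = 0"
      proof
        fix z assume z: "z \<in> PiE V J - {restrict x V}"
        have "\<exists>v\<in>V. x v \<noteq> z v"
        proof (rule ccontr)
          assume "\<not> ?thesis"
          hence "z = restrict x V" using z by (intro PiE_ext[of z V J "restrict x V"]) (use x in auto)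
          thus False using z by simp
        qed
        thus "f z * (\<Prod>v\<in>V. of_bool (x v = z v)) = 0" using V by auto
      qed
    qed (use x in auto)
    thus ?thesis using f[OF x] by simp
  qed
  ultimately have "rank_le V J (card (PiE V J) * 1) f" by (rule rank_le_cong)
  thus ?thesis by blast
qed

section \<open>The asymptotic sum inequality\<close>

text \<open>
  \<open>labelled V f\<close> is the product of \<open>f\<close> with a unit tensor whose basis vectors are named by labels.
\<close>

definition labelled :: "'v set \<Rightarrow> (('v \<Rightarrow> 'j) \<Rightarrow> complex) \<Rightarrow> ('v \<Rightarrow> 'l \<times> 'j) \<Rightarrow> complex" where
  "labelled V f x = of_bool (\<forall>u\<in>V. \<forall>v\<in>V. fst (x u) = fst (x v)) * f (\<lambda>v. snd (x v))"

text \<open>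
  Write \<open>T\<close> for the unit tensor with \<open>card L\<close> labels. A decomposition of \<open>T \<otimes> f\<close> of length
  \<open>card L * s\<close> exhibits \<open>T \<otimes> f\<close> as a restriction of \<open>s\<close> copies of \<open>T\<close>. Hence \<open>T \<otimes> f \<otimes> g\<close> is a
  restriction of \<open>s\<close> copies of \<open>T \<otimes> g\<close>: the factor \<open>card L\<close> is paid only once.
\<close>

lemma labelled_mult:
  fixes L :: "'l set" and f g :: "('v \<Rightarrow> 'j) \<Rightarrow> complex"
  assumes V: "finite V" "V \<noteq> {}" and L: "finite L"
    and f: "rank_le V (\<lambda>v. L \<times> J v) (card L * s) (labelled V f)"
    and g: "rank_le V (\<lambda>v. L \<times> J v) (card L * t) (labelled V g)"
  shows "rank_le V (\<lambda>v. L \<times> J v) (card L * (s * t)) (labelled V (\<lambda>x. f x * g x))"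
proof -
  obtain v0 where v0: "v0 \<in> V" using V by blast
  obtain a where a: "\<And>x. x \<in> Pi V (\<lambda>v. L \<times> J v) \<Longrightarrow>
      labelled V f x = (\<Sum>i\<in>L \<times> {..<s}. \<Prod>v\<in>V. a i v (x v))"
    using rank_le_index[OF f, of "L \<times> {..<s}"] L by (auto simp: card_cartesian_product)
  obtain b where b: "\<And>x. x \<in> Pi V (\<lambda>v. L \<times> J v) \<Longrightarrow>
      labelled V g x = (\<Sum>i<card L * t. \<Prod>v\<in>V. b i v (x v))"
    using g unfolding rank_le_def by blast
  \<comment> \<open>each leg sums over the label that the \<open>j\<close>-th copy of the unit tensor passes on to \<open>g\<close>\<close>
  define c where "c = (\<lambda>(j, i) v (y::'l \<times> 'j). \<Sum>l\<in>L. a (l, j) v y * b i v (l, snd y))"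
  show ?thesis
  proof (rule rank_leI[OF V, where I="{..<s} \<times> {..<card L * t}" and a=c])
    fix x assume x: "x \<in> Pi V (\<lambda>v. L \<times> J v)"
    have fin: "finite (PiE V (\<lambda>_. L))" using V L by (intro finite_PiE) auto
    have diag: "(\<Sum>l\<in>L. \<Prod>v\<in>V. a (l, j) v (x v)) * g (\<lambda>v. snd (x v))
        = (\<Sum>i<card L * t. \<Prod>v\<in>V. c (j, i) v (x v))" for j
    proof -
      define F where
        "F z = (\<Prod>v\<in>V. a (z v, j) v (x v)) * labelled V g (\<lambda>v. (z v, snd (x v)))" for z
      have "(\<Sum>i<card L * t. \<Prod>v\<in>V. c (j, i) v (x v))
          = (\<Sum>i<card L * t. \<Sum>z\<in>PiE V (\<lambda>_. L). \<Prod>v\<in>V. a (z v, j) v (x v) * b i v (z v, snd (x v)))"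
        unfolding c_def using V L by (simp add: prod_sum_PiE)
      also have "\<dots> = (\<Sum>z\<in>PiE V (\<lambda>_. L). F z)"
      proof (subst sum.swap, rule sum.cong[OF refl])
        fix z assume z: "z \<in> PiE V (\<lambda>_. L)"
        have "(\<lambda>v. (z v, snd (x v))) \<in> Pi V (\<lambda>v. L \<times> J v)" using x z by (auto simp: Pi_iff mem_Times_iff)
        thus "(\<Sum>i<card L * t. \<Prod>v\<in>V. a (z v, j) v (x v) * b i v (z v, snd (x v))) = F z"
          by (simp add: F_def b prod.distrib sum_distrib_left)
      qed
      also have "\<dots> = (\<Sum>z\<in>(\<lambda>l. \<lambda>v\<in>V. l) ` L. F z)"
      proof (rule sum.mono_neutral_right[OF fin])
        show "\<forall>z\<in>PiE V (\<lambda>_. L) - (\<lambda>l. \<lambda>v\<in>V. l) ` L. F z = 0"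
        proof
          fix z assume z: "z \<in> PiE V (\<lambda>_. L) - (\<lambda>l. \<lambda>v\<in>V. l) ` L"
          have "\<exists>u\<in>V. \<exists>v\<in>V. z u \<noteq> z v"
          proof (rule ccontr)
            assume "\<not> ?thesis"
            hence "z v = z v0" if "v \<in> V" for v using that v0 by blast
            hence "z = (\<lambda>v\<in>V. z v0)"
              using z by (intro extensionalityI[of z V]) (simp_all add: PiE_def)
            moreover have "z v0 \<in> L" using z v0 by auto
            ultimately show False using z by blast
          qed
          thus "F z = 0" by (auto simp: F_def labelled_def)
        qed
      qed auto
      also have "\<dots> = (\<Sum>l\<in>L. F (\<lambda>v\<in>V. l))"
        by (rule sum.reindex_cong[where l="\<lambda>l. \<lambda>v\<in>V. l"]) (auto simp: inj_on_def fun_eq_iff intro: v0)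
      also have "\<dots> = (\<Sum>l\<in>L. (\<Prod>v\<in>V. a (l, j) v (x v)) * g (\<lambda>v. snd (x v)))"
        by (auto simp: F_def labelled_def intro!: sum.cong prod.cong)
      finally show ?thesis by (simp add: sum_distrib_right)
    qed
    have "labelled V (\<lambda>x. f x * g x) x = labelled V f x * g (\<lambda>v. snd (x v))"
      by (simp add: labelled_def)
    also have "\<dots> = (\<Sum>j<s. \<Sum>l\<in>L. \<Prod>v\<in>V. a (l, j) v (x v)) * g (\<lambda>v. snd (x v))"
      using a[OF x] by (subst sum.swap) (simp add: sum.cartesian_product)
    also have "\<dots> = (\<Sum>j<s. \<Sum>i<card L * t. \<Prod>v\<in>V. c (j, i) v (x v))"
      by (subst sum_distrib_right) (simp only: diag)
    finally show "labelled V (\<lambda>x. f x * g x) x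
        = (\<Sum>i\<in>{..<s} \<times> {..<card L * t}. \<Prod>v\<in>V. c i v (x v))"
      by (simp add: sum.cartesian_product)
  qed (auto simp: card_cartesian_product)
qed

lemma labelled_one:
  assumes V: "finite V" "V \<noteq> {}" and L: "finite L"
  shows "rank_le V (\<lambda>v. L \<times> J v) (card L) (labelled V (\<lambda>_. 1))"
proof (rule rank_leI[OF V L order_refl, where a="\<lambda>l v y. of_bool (fst y = l)"])
  fix x assume x: "x \<in> Pi V (\<lambda>v. L \<times> J v)"
  obtain v0 where v0: "v0 \<in> V" using V by blast
  have "(\<Sum>l\<in>L. \<Prod>v\<in>V. of_bool (fst (x v) = l)) = (\<Sum>l\<in>L. of_bool (\<forall>v\<in>V. fst (x v) = l) :: complex)"
    using V by (intro sum.cong refl) (auto simp: of_bool_def)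
  also have "\<dots> = (\<Sum>l\<in>L. if l = fst (x v0) then of_bool (\<forall>v\<in>V. fst (x v) = fst (x v0)) else 0)"
    using v0 by (intro sum.cong refl) (auto intro: bexI[of _ v0])
  also have "\<dots> = of_bool (\<forall>v\<in>V. fst (x v) = fst (x v0))"
    using L x v0 by (auto simp: sum.delta Pi_iff mem_Times_iff)
  also have "(\<forall>v\<in>V. fst (x v) = fst (x v0)) \<longleftrightarrow> (\<forall>u\<in>V. \<forall>v\<in>V. fst (x u) = fst (x v))"
    using v0 by metis
  also have "of_bool \<dots> = labelled V (\<lambda>_. 1) x"
    by (simp add: labelled_def)
  finally show "labelled V (\<lambda>_. 1) x = (\<Sum>l\<in>L. \<Prod>v\<in>V. of_bool (fst (x v) = l))" ..
qed

text \<open>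
  Schonhage's inequality in the form used below: a bound on \<open>T \<otimes> f\<close> becomes a bound on the powers
  of \<open>f\<close>, in which the number of labels costs only a factor independent of the power.
\<close>

lemma rank_le_power_of_labelled:
  fixes L :: "'l set" and f :: "('v \<Rightarrow> 'j) \<Rightarrow> complex"
  assumes V: "finite V" "V \<noteq> {}" and L: "finite L" "L \<noteq> {}"
    and f: "rank_le V (\<lambda>v. L \<times> J v) (card L * s) (labelled V f)" and N: "finite (N :: 'n set)"
  shows "rank_le V (\<lambda>v. Pi N (\<lambda>_. J v)) (card L * s ^ card N) (\<lambda>x. \<Prod>n\<in>N. f (\<lambda>v. x v n))"
proof -
  have "rank_le V (\<lambda>v. L \<times> Pi N (\<lambda>_. J v)) (card L * s ^ card A)
          (labelled V (\<lambda>x. \<Prod>n\<in>A. f (\<lambda>v. x v n)))" if "finite A" "A \<subseteq> N" for A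
    using that
  proof (induction A)
    case empty
    thus ?case using labelled_one[OF V L(1)] by simp
  next
    case (insert n A)
    have "rank_le V (\<lambda>v. L \<times> Pi N (\<lambda>_. J v)) (card L * s) (labelled V (\<lambda>x. f (\<lambda>v. x v n)))"
      by (rule rank_le_pullback[OF f, where h="\<lambda>v y. (fst y, snd y n)"])
        (use insert in \<open>auto simp: labelled_def Pi_iff\<close>)
    thus ?case using labelled_mult[OF V L(1) _ insert.IH] insert by (simp add: mult.assoc)
  qed
  from this[OF N order_refl]
  have *: "rank_le V (\<lambda>v. L \<times> Pi N (\<lambda>_. J v)) (card L * s ^ card N)
          (labelled V (\<lambda>x. \<Prod>n\<in>N. f (\<lambda>v. x v n)))" .
  obtain l where "l \<in> L" using L by blast
  thus ?thesis
    by (intro rank_le_pullback[OF *, where h="\<lambda>v y. (l, y)"]) (auto simp: labelled_def)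
qed

section \<open>Rank of powers of the Coppersmith-Winograd tensor\<close>

lemma sum_roots_of_unity_power:
  assumes "i < L"
  shows "(\<Sum>j<L. (cis (2 * pi / real L) ^ j) ^ i) = (if i = 0 then of_nat L else 0)"
proof (cases "i = 0")
  case False
  let ?w = "cis (2 * pi / real L) ^ i"
  have w: "?w = cis (2 * pi * real i / real L)" by (simp add: DeMoivre mult_ac)
  have "?w \<noteq> 1"
  proof
    assume "?w = 1"
    hence eq: "cis (2 * pi * real i / real L) = cis (2 * pi * real 0 / real L)" using w by simp
    have "inj_on (\<lambda>k. cis (2 * pi * real k / real L)) {..<L}"
      using bij_betw_roots_unity[of L] assms by (auto simp: bij_betw_def)
    from inj_onD[OF this eq] show False using False assms by auto
  qed
  moreover have "?w ^ L = 1"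
  proof -
    have "cis (2 * pi / real L) ^ L = 1" using assms by (simp add: DeMoivre)
    moreover have "?w ^ L = (cis (2 * pi / real L) ^ L) ^ i" by (simp only: power_mult[symmetric] mult.commute)
    ultimately show ?thesis by simp
  qed
  ultimately have "(\<Sum>j<L. ?w ^ j) = 0" by (simp add: geometric_sum)
  thus ?thesis using False by (simp add: power_mult[symmetric] mult.commute)
qed auto

lemma unity_average:
  fixes p :: "complex poly"
  assumes "degree p < L"
  shows "(\<Sum>j<L. 1 / of_nat L * poly p (cis (2 * pi / real L) ^ j)) = coeff p 0"
proof -
  have "(\<Sum>j<L. poly p (cis (2 * pi / real L) ^ j))
      = (\<Sum>i\<le>degree p. coeff p i * (\<Sum>j<L. (cis (2 * pi / real L) ^ j) ^ i))"
    unfolding poly_altdef by (subst sum.swap) (simp add: sum_distrib_left)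
  also have "\<dots> = (\<Sum>i\<le>degree p. coeff p i * (if i = 0 then of_nat L else 0))"
    using assms by (intro sum.cong refl) (simp add: sum_roots_of_unity_power)
  also have "\<dots> = (\<Sum>i\<le>degree p. if i = 0 then of_nat L * coeff p 0 else 0)"
    by (intro sum.cong refl) auto
  also have "\<dots> = of_nat L * coeff p 0" by (simp add: sum.delta)
  finally show ?thesis using assms by (simp flip: sum_divide_distrib)
qed

text \<open>
  A family of tensors of rank at most \<open>R\<close> depending polynomially on \<open>t \<noteq> 0\<close> has a limit at \<open>0\<close>,
  which is the average of the family over sufficiently many roots of unity.
\<close>

lemma rank_le_of_border:
  assumes V: "finite V" "V \<noteq> {}" and deg: "\<And>x. x \<in> Pi V J \<Longrightarrow> degree (p x) \<le> D"
    and rk: "\<And>t. t \<noteq> 0 \<Longrightarrow> rank_le V J R (\<lambda>x. poly (p x) t)"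
  shows "rank_le V J ((D + 1) * R) (\<lambda>x. coeff (p x) 0)"
proof -
  have "rank_le V J (card {..<D+1} * R)
      (\<lambda>x. \<Sum>j<D+1. 1 / of_nat (D+1) * poly (p x) (cis (2 * pi / real (D+1)) ^ j))"
  proof (intro rank_le_sum V)
    fix j
    let ?t = "cis (2 * pi / real (D+1)) ^ j"
    show "rank_le V J R (\<lambda>x. 1 / of_nat (D+1) * poly (p x) ?t)"
      using rank_le_weight[OF V rk[of ?t], where c="1 / of_nat (D+1)" and w="\<lambda>_ _. 1"] by simp
  qed simp
  hence "rank_le V J (card {..<D+1} * R) (\<lambda>x. coeff (p x) 0)"
    by (rule rank_le_cong) (rule unity_average[symmetric], use deg in \<open>simp add: less_Suc_eq_le\<close>)
  thus ?thesis by simp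
qed

text \<open>
  The Coppersmith-Winograd tensor: the sum over all edges \<open>{u, v}\<close> of the complete graph on \<open>V\<close> and
  all \<open>i \<ge> 1\<close> of the basis tensor with entry \<open>i\<close> at \<open>u\<close> and \<open>v\<close>, and \<open>0\<close> elsewhere. The index
  sets \<open>{..q}\<close> in the rank bounds cut it down to \<open>q\<close> values of \<open>i\<close>.
\<close>

definition cw :: "'v set \<Rightarrow> ('v \<Rightarrow> nat) \<Rightarrow> complex" where
  "cw V x = of_bool (card {v\<in>V. x v \<noteq> 0} = 2 \<and>
                     (\<forall>u\<in>V. \<forall>v\<in>V. x u \<noteq> 0 \<longrightarrow> x v \<noteq> 0 \<longrightarrow> x u = x v))"

definition cw_poly :: "'v set \<Rightarrow> ('v \<Rightarrow> nat) \<Rightarrow> complex poly" where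
  "cw_poly V x = (let w = card {v\<in>V. x v \<noteq> 0} in
     if w \<le> 1 then 0
     else smult (of_bool (\<forall>u\<in>V. \<forall>v\<in>V. x u \<noteq> 0 \<longrightarrow> x v \<noteq> 0 \<longrightarrow> x u = x v)) (monom 1 (w - 2))
          - monom 1 (2 * w - 3))"

lemma poly_cw_poly_0: "poly (cw_poly V x) 0 = cw V x"
  by (auto simp: cw_poly_def cw_def Let_def poly_monom power_0_left of_bool_def)

lemma degree_cw_poly:
  assumes "finite V"
  shows "degree (cw_poly V x) \<le> 2 * card V"
proof -
  let ?w = "card {v\<in>V. x v \<noteq> 0}"
  have w: "?w \<le> card V" by (rule card_mono[OF assms]) auto
  have "degree (smult c (monom (1::complex) (?w - 2)) - monom 1 (2 * ?w - 3)) \<le> 2 * card V" for c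
    using w by (intro degree_diff_le order_trans[OF degree_smult_le] order_trans[OF degree_monom_le]) auto
  thus ?thesis by (simp add: cw_poly_def Let_def)
qed

lemma prod_support_weight:
  fixes t :: complex
  assumes "finite V"
  shows "(\<Prod>v\<in>V. of_bool (x v = (0::nat)) + t * of_bool (x v \<noteq> 0 \<and> P (x v)))
      = of_bool (\<forall>v\<in>V. x v \<noteq> 0 \<longrightarrow> P (x v)) * t ^ card {v\<in>V. x v \<noteq> 0}"
proof -
  have "(\<Prod>v\<in>V. of_bool (x v = (0::nat)) + t * of_bool (x v \<noteq> 0 \<and> P (x v)))
      = (\<Prod>v\<in>V. (if x v \<noteq> 0 then t else 1)) * (\<Prod>v\<in>V. of_bool (x v \<noteq> 0 \<longrightarrow> P (x v)))"
    unfolding prod.distrib[symmetric] by (rule prod.cong) auto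
  also have "(\<Prod>v\<in>V. (if x v \<noteq> 0 then t else 1)) = t ^ card {v\<in>V. x v \<noteq> 0}"
    using assms by (simp add: prod.If_cases Int_def)
  also have "(\<Prod>v\<in>V. of_bool (x v \<noteq> 0 \<longrightarrow> P (x v))) = (of_bool (\<forall>v\<in>V. x v \<noteq> 0 \<longrightarrow> P (x v)) :: complex)"
    using assms by (auto simp: of_bool_def)
  finally show ?thesis by simp
qed

text \<open>
  The border rank bound of Coppersmith and Winograd: the terms of weight at most one cancel in
  \<open>\<Sum>i. t\<^sup>-\<^sup>2 (b\<^sub>0 + t b\<^sub>i)\<^sup>\<otimes> - t\<^sup>-\<^sup>3 (b\<^sub>0 + t\<^sup>2 \<Sum>i. b\<^sub>i)\<^sup>\<otimes> + (t\<^sup>-\<^sup>3 - q t\<^sup>-\<^sup>2) b\<^sub>0\<^sup>\<otimes>\<close>.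
\<close>

lemma rank_cw_poly:
  assumes V: "finite V" "V \<noteq> {}" and t: "t \<noteq> 0"
  shows "rank_le V (\<lambda>_. {..q}) (q + 2) (\<lambda>x. poly (cw_poly V x) t)"
proof -
  define A where "A i x = 1 / t\<^sup>2 * (\<Prod>v\<in>V. of_bool (x v = (0::nat)) + t * of_bool (x v \<noteq> 0 \<and> x v = i))"
    for i x
  define B where "B x = - 1 / t^3 * (\<Prod>v\<in>V. of_bool (x v = (0::nat)) + t\<^sup>2 * of_bool (x v \<noteq> 0 \<and> True))"
    for x
  define C where "C x = (1 / t^3 - of_nat q / t\<^sup>2) * (\<Prod>v\<in>V. of_bool (x v = (0::nat)) + 0 * of_bool (x v \<noteq> 0 \<and> True))"
    for x
  have A: "rank_le V (\<lambda>_. {..q}) 1 (A i)" for i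
    by (rule rank_le_simple[OF V]) (rule A_def)
  have B: "rank_le V (\<lambda>_. {..q}) 1 B"
    by (rule rank_le_simple[OF V]) (rule B_def)
  have C: "rank_le V (\<lambda>_. {..q}) 1 C"
    by (rule rank_le_simple[OF V]) (rule C_def)
  have "rank_le V (\<lambda>_. {..q}) (card {1..q} * 1 + (1 + 1)) (\<lambda>x. (\<Sum>i\<in>{1..q}. A i x) + (B x + C x))"
    by (intro rank_le_add[OF V] rank_le_sum[OF V] A B C) simp
  moreover have "poly (cw_poly V x) t = (\<Sum>i\<in>{1..q}. A i x) + (B x + C x)"
    if x: "x \<in> Pi V (\<lambda>_. {..q})" for x
  proof -
    define w where "w = card {v\<in>V. x v \<noteq> 0}"
    define eq where "eq \<longleftrightarrow> (\<forall>u\<in>V. \<forall>v\<in>V. x u \<noteq> 0 \<longrightarrow> x v \<noteq> 0 \<longrightarrow> x u = x v)"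
    have w0: "w = 0 \<longleftrightarrow> (\<forall>v\<in>V. x v = 0)" using V by (auto simp: w_def)
    have Ai: "A i x = t ^ w / t\<^sup>2 * of_bool (\<forall>v\<in>V. x v \<noteq> 0 \<longrightarrow> x v = i)" for i
      using prod_support_weight[OF V(1), of x t "\<lambda>y. y = i"] by (simp add: A_def w_def)
    have Bx: "B x = - ((t\<^sup>2) ^ w / t ^ 3)"
      using prod_support_weight[OF V(1), of x "t\<^sup>2" "\<lambda>y. True"] by (simp add: B_def w_def)
    have Cx: "C x = (1 / t^3 - of_nat q / t\<^sup>2) * 0 ^ w"
      using prod_support_weight[OF V(1), of x 0 "\<lambda>y. True"] by (simp add: C_def w_def)
    have sumA: "(\<Sum>i\<in>{1..q}. A i x) = (if w = 0 then of_nat q / t\<^sup>2 else t ^ w / t\<^sup>2 * of_bool eq)"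
    proof (cases "w = 0")
      case True
      thus ?thesis using w0 by (simp add: Ai)
    next
      case False
      then obtain v0 where v0: "v0 \<in> V" "x v0 \<noteq> 0" using w0 by blast
      have x0: "x v0 \<in> {1..q}" using v0 x by (force simp: Pi_iff)
      have all: "(\<forall>v\<in>V. x v \<noteq> 0 \<longrightarrow> x v = i) \<longleftrightarrow> i = x v0 \<and> eq" for i
        unfolding eq_def using v0 by metis
      have "(\<Sum>i\<in>{1..q}. A i x) = (\<Sum>i\<in>{1..q}. if i = x v0 then t ^ w / t\<^sup>2 * of_bool eq else 0)"
        unfolding Ai all by (intro sum.cong refl) auto
      thus ?thesis using False x0 by (simp add: sum.delta)
    qed
    show ?thesis
    proof (cases "w \<le> 1")
      case True
      have eq: "eq" if w1: "w = 1"
      proof -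
        obtain a where a: "{v\<in>V. x v \<noteq> 0} = {a}"
          using w1 card_1_singletonE unfolding w_def by blast
        have "u = a" if "u \<in> V" "x u \<noteq> 0" for u using that a by blast
        thus ?thesis unfolding eq_def by metis
      qed
      have "poly (cw_poly V x) t = 0" using True by (simp add: cw_poly_def w_def)
      moreover consider "w = 0" | "w = 1" "eq" using True eq by linarith
      hence "(if w = 0 then of_nat q / t\<^sup>2 else t ^ w / t\<^sup>2 * of_bool eq)
          + (- ((t\<^sup>2) ^ w / t ^ 3) + (1 / t^3 - of_nat q / t\<^sup>2) * 0 ^ w) = 0"
        using t by cases (simp_all add: field_simps eval_nat_numeral)
      ultimately show ?thesis unfolding sumA Bx Cx by simp
    next
      case False
      then obtain d where d: "w = d + 2" by (metis add.commute le_Suc_ex not_less_eq_eq numeral_2_eq_2 One_nat_def)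
      have "poly (cw_poly V x) t = of_bool eq * t ^ d - t ^ (2 * d + 1)"
        unfolding cw_poly_def Let_def w_def[symmetric] eq_def[symmetric] by (simp add: d poly_monom)
      moreover have "t ^ w / t\<^sup>2 = t ^ d" "(t\<^sup>2) ^ w / t ^ 3 = t ^ (2 * d + 1)"
        using t by (simp_all add: d power_add power_mult[symmetric] field_simps eval_nat_numeral)
      ultimately show ?thesis unfolding sumA Bx Cx by (simp add: d)
    qed
  qed
  ultimately show ?thesis using rank_le_cong by fastforce
qed

lemma rank_cw_power:
  assumes V: "finite V" "V \<noteq> {}" and S: "finite S"
  shows "rank_le V (\<lambda>v. Pi S (\<lambda>_. {..q})) ((card S * (2 * card V) + 1) * (q + 2) ^ card S)
           (\<lambda>x. \<Prod>s\<in>S. cw V (\<lambda>v. x v s))"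
proof -
  define p where "p x = (\<Prod>s\<in>S. cw_poly V (\<lambda>v. x v s))" for x
  have "rank_le V (\<lambda>v. Pi S (\<lambda>_. {..q})) ((card S * (2 * card V) + 1) * (q + 2) ^ card S)
      (\<lambda>x. coeff (p x) 0)"
  proof (rule rank_le_of_border[OF V])
    show "degree (p x) \<le> card S * (2 * card V)" for x
    proof -
      have "degree (p x) \<le> (\<Sum>s\<in>S. degree (cw_poly V (\<lambda>v. x v s)))"
        unfolding p_def by (rule degree_prod_sum_le[OF S, unfolded o_def])
      also have "\<dots> \<le> (\<Sum>s\<in>S. 2 * card V)" by (intro sum_mono degree_cw_poly V)
      finally show ?thesis by simp
    qed
    show "rank_le V (\<lambda>v. Pi S (\<lambda>_. {..q})) ((q + 2) ^ card S) (\<lambda>x. poly (p x) t)" if t: "t \<noteq> 0" for t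
      unfolding p_def poly_prod
    proof (rule rank_le_prod[OF V S])
      fix s assume s: "s \<in> S"
      show "rank_le V (\<lambda>v. Pi S (\<lambda>_. {..q})) (q + 2) (\<lambda>x. poly (cw_poly V (\<lambda>v. x v s)) t)"
        by (rule rank_le_pullback[OF rank_cw_poly[OF V t], where h="\<lambda>v y. y s"]) (use s in auto)
    qed
  qed
  moreover have "coeff (p x) 0 = (\<Prod>s\<in>S. cw V (\<lambda>v. x v s))" for x
    by (simp add: p_def poly_prod poly_cw_poly_0 flip: poly_0_coeff_0)
  ultimately show ?thesis by simp
qed

section \<open>Block diagonals in powers of the Coppersmith-Winograd tensor\<close>

text \<open>
  The combinatorial form of monomial degeneration to a unit tensor: weights on the basis vectors
  select from the support \<open>\<Phi>\<close> a set \<open>\<Psi>\<close> whose elements differ pairwise on every leg.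
\<close>

definition diagonal_degeneration :: "'v set \<Rightarrow> ('v \<Rightarrow> 'j) set \<Rightarrow> ('v \<Rightarrow> 'j) set \<Rightarrow> bool" where
  "diagonal_degeneration V \<Phi> \<Psi> \<longleftrightarrow>
     \<Psi> \<subseteq> \<Phi> \<and> (\<forall>x\<in>\<Psi>. \<forall>y\<in>\<Psi>. \<forall>v\<in>V. x v = y v \<longrightarrow> x = y) \<and>
     (\<exists>\<alpha> :: 'v \<Rightarrow> 'j \<Rightarrow> int. (\<forall>x\<in>\<Psi>. (\<Sum>v\<in>V. \<alpha> v (x v)) = 0) \<and>
                           (\<forall>x\<in>\<Phi> - \<Psi>. (\<Sum>v\<in>V. \<alpha> v (x v)) > 0))"

definition words :: "nat \<Rightarrow> nat list set" where
  "words m = {xs. length xs = m \<and> set xs \<subseteq> {1, 2}}"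

text \<open>
  The support of the \<open>m\<close>-th power of the Dicke tensor: position \<open>j\<close> of the words names an edge of
  the complete graph, namely the two legs whose word has a \<open>1\<close> there.
\<close>

definition edge_words :: "'v set \<Rightarrow> nat \<Rightarrow> ('v \<Rightarrow> nat list) set" where
  "edge_words V m = {x \<in> PiE V (\<lambda>_. words m). \<forall>j<m. card {v\<in>V. x v ! j = 1} = 2}"

lemma finite_words: "finite (words m)"
proof (rule finite_subset)
  show "words m \<subseteq> {xs. set xs \<subseteq> {1, 2} \<and> length xs = m}" by (auto simp: words_def)
qed (rule finite_lists_length_eq, simp)

lemma finite_edge_words: "finite V \<Longrightarrow> finite (edge_words V m)"
  unfolding edge_words_def by (rule finite_subset[of _ "PiE V (\<lambda>_. words m)"])
    (auto intro: finite_PiE finite_words)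

definition pattern_word :: "nat \<Rightarrow> (nat \<Rightarrow> nat) \<Rightarrow> nat list" where
  "pattern_word m z = map (\<lambda>j. if z j = 0 then 2 else 1) [0..<m]"

lemma pattern_word_in_words: "pattern_word m z \<in> words m"
  by (auto simp: pattern_word_def words_def)

lemma nth_pattern_word: "j < m \<Longrightarrow> pattern_word m z ! j = (if z j = 0 then 2 else 1)"
  by (simp add: pattern_word_def)

lemma power_int_sum:
  fixes t :: complex
  assumes "finite S" "t \<noteq> 0"
  shows "t powi (\<Sum>s\<in>S. f s) = (\<Prod>s\<in>S. t powi f s)"
  using assms(1) by (induction S) (simp_all add: power_int_add assms(2))

text \<open>
  The \<open>M\<close>-th power of the part of the \<open>m\<close>-th power of \<open>cw\<close> that lies over the edge sequences in \<open>\<Psi>\<close>.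
\<close>

definition block_power ::
    "'v set \<Rightarrow> nat \<Rightarrow> ('v \<Rightarrow> nat list) set \<Rightarrow> nat \<Rightarrow> ('v \<Rightarrow> nat \<times> nat \<Rightarrow> nat) \<Rightarrow> complex" where
  "block_power V m \<Psi> M y = (\<Prod>s\<in>{..<M} \<times> {..<m}. cw V (\<lambda>v. y v s)) *
     of_bool (\<forall>n<M. (\<lambda>v\<in>V. pattern_word m (\<lambda>j. y v (n, j))) \<in> \<Psi>)"

text \<open>
  In the \<open>M\<close>-th power of the block tensor the weights of a degeneration add up to an exponent
  between \<open>0\<close> and a constant times \<open>M\<close>, so that extracting the blocks of \<open>\<Psi>\<close> costs a factor
  linear in \<open>M\<close> only.
\<close>

lemma rank_block_power:
  assumes V: "finite V" "V \<noteq> {}" and deg: "diagonal_degeneration V (edge_words V m) \<Psi>"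
  obtains A where "\<And>M. rank_le V (\<lambda>v. Pi ({..<M} \<times> {..<m}) (\<lambda>_. {..q}))
      ((M * A + 1) * ((M * m * (2 * card V) + 1) * (q + 2) ^ (M * m)))
      (block_power V m \<Psi> M)"
proof -
  obtain \<alpha> :: "'a \<Rightarrow> nat list \<Rightarrow> int" where
    \<alpha>: "\<forall>x\<in>\<Psi>. (\<Sum>v\<in>V. \<alpha> v (x v)) = 0" "\<forall>x\<in>edge_words V m - \<Psi>. (\<Sum>v\<in>V. \<alpha> v (x v)) > 0"
    using deg unfolding diagonal_degeneration_def by blast
  have zero: "(\<Sum>v\<in>V. \<alpha> v (x v)) = 0" if "x \<in> \<Psi>" for x using \<alpha>(1) that by blast
  have pos: "(\<Sum>v\<in>V. \<alpha> v (x v)) > 0" if "x \<in> edge_words V m" "x \<notin> \<Psi>" for x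
    using \<alpha>(2) that by blast
  define A where "A = (\<Sum>x\<in>edge_words V m. nat (\<Sum>v\<in>V. \<alpha> v (x v)))"
  have le_A: "(\<Sum>v\<in>V. \<alpha> v (x v)) \<le> int A" if "x \<in> edge_words V m" for x
  proof -
    have "nat (\<Sum>v\<in>V. \<alpha> v (x v)) \<le> A"
      unfolding A_def by (rule member_le_sum[OF that]) (auto simp: finite_edge_words V)
    thus ?thesis by simp
  qed
  show ?thesis
  proof (rule that[of A])
    fix M :: nat
    define S where "S = {..<M} \<times> {..<m}"
    define P where "P y = (\<Prod>s\<in>S. cw V (\<lambda>v. y v s))" for y
    define X where "X y n = (\<lambda>v\<in>V. pattern_word m (\<lambda>j. y v (n, j)))"
      for y :: "'a \<Rightarrow> nat \<times> nat \<Rightarrow> nat" and n :: nat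
    \<comment> \<open>the exponent is nonnegative wherever \<open>P\<close> does not vanish, so \<open>p y\<close> is an honest polynomial\<close>
    define e where "e y = (\<Sum>n<M. \<Sum>v\<in>V. \<alpha> v (X y n v))" for y :: "'a \<Rightarrow> nat \<times> nat \<Rightarrow> nat"
    define p where "p y = (if P y = 0 then 0 else monom (P y) (nat (e y)))" for y
    have P: "rank_le V (\<lambda>v. Pi S (\<lambda>_. {..q})) ((M * m * (2 * card V) + 1) * (q + 2) ^ (M * m)) P"
      using rank_cw_power[OF V, of S q] by (simp add: P_def[abs_def] S_def card_cartesian_product)
    have X: "X y n \<in> edge_words V m" if y: "P y \<noteq> 0" and n: "n < M" for y n
    proof -
      have "card {v\<in>V. X y n v ! j = 1} = 2" if j: "j < m" for j
      proof -
        have "cw V (\<lambda>v. y v (n, j)) \<noteq> 0" using y n j by (auto simp: P_def S_def)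
        hence "card {v\<in>V. y v (n, j) \<noteq> 0} = 2" by (auto simp: cw_def of_bool_def split: if_splits)
        moreover have "{v\<in>V. X y n v ! j = 1} = {v\<in>V. y v (n, j) \<noteq> 0}"
          using j by (auto simp: X_def nth_pattern_word)
        ultimately show ?thesis by simp
      qed
      thus ?thesis by (auto simp: edge_words_def X_def pattern_word_in_words)
    qed
    have nonneg: "(\<Sum>v\<in>V. \<alpha> v (X y n v)) \<ge> 0" if "P y \<noteq> 0" "n < M" for y n
      using X[OF that] zero pos by force
    have e_nonneg: "e y \<ge> 0" if "P y \<noteq> 0" for y
      unfolding e_def by (rule sum_nonneg) (use nonneg[OF that] in auto)
    have e_zero: "e y = 0 \<longleftrightarrow> (\<forall>n<M. X y n \<in> \<Psi>)" if y: "P y \<noteq> 0" for y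
    proof -
      have "e y = 0 \<longleftrightarrow> (\<forall>n\<in>{..<M}. (\<Sum>v\<in>V. \<alpha> v (X y n v)) = 0)"
        unfolding e_def by (rule sum_nonneg_eq_0_iff) (use nonneg[OF y] in auto)
      also have "\<dots> \<longleftrightarrow> (\<forall>n<M. X y n \<in> \<Psi>)"
        using zero pos X[OF y] by (metis lessThan_iff less_irrefl)
      finally show ?thesis .
    qed
    have "rank_le V (\<lambda>v. Pi S (\<lambda>_. {..q}))
        ((M * A + 1) * ((M * m * (2 * card V) + 1) * (q + 2) ^ (M * m))) (\<lambda>y. coeff (p y) 0)"
    proof (rule rank_le_of_border[OF V])
      fix y
      show "degree (p y) \<le> M * A"
      proof (cases "P y = 0")
        case False
        have "e y \<le> (\<Sum>n<M. int A)"
          unfolding e_def by (rule sum_mono) (use X[OF False] le_A in auto)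
        thus ?thesis using False by (auto simp: p_def degree_monom_eq nat_le_iff)
      qed (simp add: p_def)
    next
      fix t :: complex assume t: "t \<noteq> 0"
      have "poly (p y) t
          = 1 * (\<Prod>v\<in>V. t powi (\<Sum>n<M. \<alpha> v (pattern_word m (\<lambda>j. y v (n, j))))) * P y" for y
      proof (cases "P y = 0")
        case False
        have "e y = (\<Sum>v\<in>V. \<Sum>n<M. \<alpha> v (pattern_word m (\<lambda>j. y v (n, j))))"
          unfolding e_def by (subst sum.swap) (simp add: X_def)
        hence "(\<Prod>v\<in>V. t powi (\<Sum>n<M. \<alpha> v (pattern_word m (\<lambda>j. y v (n, j))))) = t powi e y"
          using V t by (simp add: power_int_sum)
        also have "\<dots> = t ^ nat (e y)" using e_nonneg[OF False] by (simp add: power_int_def)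
        finally show ?thesis using False by (simp add: p_def poly_monom)
      qed (simp add: p_def)
      thus "rank_le V (\<lambda>v. Pi S (\<lambda>_. {..q})) ((M * m * (2 * card V) + 1) * (q + 2) ^ (M * m))
          (\<lambda>y. poly (p y) t)"
        using rank_le_weight[OF V P, where c=1 and
            w="\<lambda>v y. t powi (\<Sum>n<M. \<alpha> v (pattern_word m (\<lambda>j. y (n, j))))"] by simp
    qed
    moreover have "coeff (p y) 0 = P y * of_bool (\<forall>n<M. X y n \<in> \<Psi>)" for y
      using e_nonneg[of y] e_zero[of y] by (auto simp: p_def)
    ultimately show "rank_le V (\<lambda>v. Pi ({..<M} \<times> {..<m}) (\<lambda>_. {..q}))
      ((M * A + 1) * ((M * m * (2 * card V) + 1) * (q + 2) ^ (M * m)))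
      (block_power V m \<Psi> M)"
      unfolding block_power_def[abs_def] by (simp add: P_def X_def S_def)
  qed
qed

text \<open>
  The graph tensor of the multigraph with one edge \<open>e p\<close> for each position \<open>p \<in> P\<close>. All legs are
  indexed by maps on the same set of positions, which makes products and relabellings of
  multigraphs into disjoint unions and compositions of the maps \<open>e\<close>.
\<close>

definition multigraph_tensor :: "'p set \<Rightarrow> ('p \<Rightarrow> 'v set) \<Rightarrow> ('v \<Rightarrow> 'p \<Rightarrow> nat) \<Rightarrow> complex" where
  "multigraph_tensor P e y = of_bool (\<forall>p\<in>P. \<forall>u\<in>e p. \<forall>v\<in>e p. y u p = y v p)"

lemma prod_of_bool:
  "finite S \<Longrightarrow> (\<Prod>s\<in>S. of_bool (P s)) = (of_bool (\<forall>s\<in>S. P s) :: 'a :: comm_semiring_1)"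
  by (induction S rule: finite_induct) auto

text \<open>
  If the edge sequences in \<open>\<Psi>\<close> are rearrangements of one sequence \<open>e\<close>, then the blocks of \<open>\<Psi>\<close>
  are copies of the multigraph tensor of \<open>e\<close>, and they form a direct sum because \<open>\<Psi>\<close> is diagonal.
\<close>

lemma rank_labelled_multigraph:
  fixes \<beta> :: "('v \<Rightarrow> nat list) \<Rightarrow> nat \<Rightarrow> nat"
  assumes V: "finite V" "V \<noteq> {}" and deg: "diagonal_degeneration V (edge_words V m) \<Psi>"
    and sub: "\<Psi>' \<subseteq> \<Psi>" and bij: "\<And>x. x \<in> \<Psi>' \<Longrightarrow> bij_betw (\<beta> x) {..<m} {..<m}"
    and edge: "\<And>x j. x \<in> \<Psi>' \<Longrightarrow> j < m \<Longrightarrow> {v\<in>V. x v ! j = 1} = e (\<beta> x j)"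
  obtains A where "\<And>M. rank_le V
      (\<lambda>v. PiE {..<M} (\<lambda>_. \<Psi>') \<times> Pi ({..<M} \<times> {..<m}) (\<lambda>_. {1..q}))
      ((M * A + 1) * ((M * m * (2 * card V) + 1) * (q + 2) ^ (M * m)))
      (labelled V (multigraph_tensor ({..<M} \<times> {..<m}) (\<lambda>p. e (snd p))))"
proof -
  obtain v0 where v0: "v0 \<in> V" using V by blast
  obtain A where A: "\<And>M. rank_le V (\<lambda>v. Pi ({..<M} \<times> {..<m}) (\<lambda>_. {..q}))
      ((M * A + 1) * ((M * m * (2 * card V) + 1) * (q + 2) ^ (M * m)))
      (block_power V m \<Psi> M)"
    using rank_block_power[OF V deg] by blast
  have \<Psi>: "\<Psi> \<subseteq> edge_words V m" and diag: "\<And>x y v. x \<in> \<Psi> \<Longrightarrow> y \<in> \<Psi> \<Longrightarrow> v \<in> V \<Longrightarrow> x v = y v \<Longrightarrow> x = y"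
    using deg unfolding diagonal_degeneration_def by blast+
  \<comment> \<open>a label \<open>l\<close> fixes the block of every factor, and \<open>\<beta>\<close> moves the entries of \<open>z\<close> to its edges\<close>
  define h :: "'v \<Rightarrow> (nat \<Rightarrow> 'v \<Rightarrow> nat list) \<times> (nat \<times> nat \<Rightarrow> nat) \<Rightarrow> nat \<times> nat \<Rightarrow> nat" where
    "h v = (\<lambda>(l, z) (n, j). if l n v ! j = 1 then z (n, \<beta> (l n) j) else 0)" for v
  have h_apply: "h v (l, z) (n, j) = (if l n v ! j = 1 then z (n, \<beta> (l n) j) else 0)" for v l z n j
    by (simp add: h_def)
  show ?thesis
  proof (rule that[of A], rule rank_le_pullback[OF A, where h=h])
    fix M v and y :: "(nat \<Rightarrow> 'v \<Rightarrow> nat list) \<times> (nat \<times> nat \<Rightarrow> nat)"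
    assume y: "y \<in> PiE {..<M} (\<lambda>_. \<Psi>') \<times> Pi ({..<M} \<times> {..<m}) (\<lambda>_. {1..q})"
    obtain l z where lz: "y = (l, z)" by fastforce
    show "h v y \<in> Pi ({..<M} \<times> {..<m}) (\<lambda>_. {..q})"
    proof (clarsimp simp: lz h_apply)
      fix n j assume nj: "n < M" "j < m"
      have "\<beta> (l n) j \<in> {..<m}"
        using y lz nj bij[of "l n"] by (auto simp: PiE_iff dest: bij_betwE)
      thus "z (n, \<beta> (l n) j) \<le> q" using y lz nj by (auto simp: Pi_iff)
    qed
  next
    fix M and x :: "'v \<Rightarrow> (nat \<Rightarrow> 'v \<Rightarrow> nat list) \<times> (nat \<times> nat \<Rightarrow> nat)"
    assume x: "x \<in> Pi V (\<lambda>v. PiE {..<M} (\<lambda>_. \<Psi>') \<times> Pi ({..<M} \<times> {..<m}) (\<lambda>_. {1..q}))"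
    define l where "l v = fst (x v)" for v
    define z where "z v = snd (x v)" for v
    define y where "y v = h v (x v)" for v
    have xlz: "x v = (l v, z v)" for v by (simp add: l_def z_def)
    have l: "l v \<in> PiE {..<M} (\<lambda>_. \<Psi>')" if "v \<in> V" for v
      using x that by (simp add: l_def Pi_iff mem_Times_iff)
    have z: "z v (n, j) \<ge> 1" if "v \<in> V" "n < M" "j < m" for v n j
    proof -
      have "z v \<in> Pi ({..<M} \<times> {..<m}) (\<lambda>_. {1..q})"
        using x that(1) by (simp add: z_def Pi_iff mem_Times_iff)
      thus ?thesis using that by (auto simp: Pi_iff)
    qed
    have lw: "l v n \<in> \<Psi>'" if "v \<in> V" "n < M" for v n using l[OF that(1)] that(2) by (auto simp: PiE_iff)
    have y_apply: "y v (n, j) = (if l v n v ! j = 1 then z v (n, \<beta> (l v n) j) else 0)" for v n j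
      by (simp add: y_def xlz h_apply)
    have \<beta>m: "\<beta> (l v n) j < m" if "v \<in> V" "n < M" "j < m" for v n j
      using bij[OF lw[OF that(1,2)]] that(3) by (auto dest: bij_betwE)
    have y0: "y v (n, j) \<noteq> 0 \<longleftrightarrow> l v n v ! j = 1" if "v \<in> V" "n < M" "j < m" for v n j
      using z[OF that(1,2) \<beta>m[OF that]] by (simp add: y_apply)
    have pat: "pattern_word m (\<lambda>j. y v (n, j)) = l v n v" if v: "v \<in> V" and n: "n < M" for v n
    proof -
      have "l v n \<in> edge_words V m" using lw[OF v n] sub \<Psi> by blast
      hence w: "l v n v \<in> words m" using v by (auto simp: edge_words_def PiE_iff)
      show ?thesis
      proof (rule nth_equalityI)
        fix j assume "j < length (pattern_word m (\<lambda>j. y v (n, j)))"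
        hence j: "j < m" by (simp add: pattern_word_def)
        have "l v n v ! j \<in> {1, 2}" using w j unfolding words_def by (auto dest: nth_mem)
        thus "pattern_word m (\<lambda>j. y v (n, j)) ! j = l v n v ! j"
          using y0[OF v n j] j by (auto simp: nth_pattern_word)
      qed (use w in \<open>simp add: pattern_word_def words_def\<close>)
    qed
    let ?P = "{..<M} \<times> {..<m}" and ?f = "multigraph_tensor ({..<M} \<times> {..<m}) (\<lambda>p. e (snd p))"
    show "labelled V ?f x = block_power V m \<Psi> M (\<lambda>v. h v (x v))"
    proof (cases "\<forall>u\<in>V. \<forall>v\<in>V. l u = l v")
      case True
      define l0 where "l0 = l v0"
      have l0: "l v = l0" if "v \<in> V" for v unfolding l0_def using True that v0 by blast
      have l0\<Psi>: "l0 n \<in> \<Psi>'" if "n < M" for n using lw[OF v0 that] by (simp add: l0_def)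
      have "(\<lambda>v\<in>V. pattern_word m (\<lambda>j. y v (n, j))) = l0 n" if n: "n < M" for n
      proof -
        have "l0 n \<in> extensional V" using l0\<Psi>[OF n] sub \<Psi> by (auto simp: edge_words_def PiE_def)
        thus ?thesis by (intro extensionalityI[of _ V]) (auto simp: pat[OF _ n] l0)
      qed
      hence all: "(\<forall>n<M. (\<lambda>v\<in>V. pattern_word m (\<lambda>j. y v (n, j))) \<in> \<Psi>) \<longleftrightarrow> True"
        using l0\<Psi> sub by auto
      define agree where "agree n p \<longleftrightarrow> (\<forall>u\<in>e p. \<forall>v\<in>e p. z u (n, p) = z v (n, p))" for n p
      have cw: "cw V (\<lambda>v. y v (n, j)) = of_bool (agree n (\<beta> (l0 n) j))"
        if n: "n < M" and j: "j < m" for n j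
      proof -
        let ?E = "{v\<in>V. l0 n v ! j = 1}"
        have E: "?E = e (\<beta> (l0 n) j)" by (rule edge[OF l0\<Psi>[OF n] j])
        have supp: "y v (n, j) \<noteq> 0 \<longleftrightarrow> v \<in> ?E" if "v \<in> V" for v
          using y0[OF that n j] that by (simp add: l0)
        hence set: "{v\<in>V. y v (n, j) \<noteq> 0} = ?E" by blast
        have card: "card ?E = 2"
          using l0\<Psi>[OF n] sub \<Psi> j by (auto simp: edge_words_def)
        have yz: "y v (n, j) = z v (n, \<beta> (l0 n) j)" if "v \<in> ?E" for v
        proof -
          have v: "v \<in> V" "l0 n v ! j = 1" using that by auto
          show ?thesis unfolding y_apply l0[OF v(1)] by (simp only: v(2) refl if_True)
        qed
        have "(\<forall>u\<in>V. \<forall>v\<in>V. y u (n, j) \<noteq> 0 \<longrightarrow> y v (n, j) \<noteq> 0 \<longrightarrow> y u (n, j) = y v (n, j))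
            \<longleftrightarrow> (\<forall>u\<in>?E. \<forall>v\<in>?E. y u (n, j) = y v (n, j))"
          using set by blast
        also have "\<dots> \<longleftrightarrow> (\<forall>u\<in>?E. \<forall>v\<in>?E. z u (n, \<beta> (l0 n) j) = z v (n, \<beta> (l0 n) j))"
          by (intro ball_cong refl) (simp only: yz)
        finally have iff: "(\<forall>u\<in>V. \<forall>v\<in>V. y u (n, j) \<noteq> 0 \<longrightarrow> y v (n, j) \<noteq> 0 \<longrightarrow> y u (n, j) = y v (n, j))
            \<longleftrightarrow> (\<forall>u\<in>?E. \<forall>v\<in>?E. z u (n, \<beta> (l0 n) j) = z v (n, \<beta> (l0 n) j))" .
        have "cw V (\<lambda>v. y v (n, j))
            = of_bool (\<forall>u\<in>?E. \<forall>v\<in>?E. z u (n, \<beta> (l0 n) j) = z v (n, \<beta> (l0 n) j))"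
          unfolding cw_def set card iff by (simp only: refl simp_thms)
        thus ?thesis unfolding E agree_def .
      qed
      have "(\<Prod>s\<in>?P. cw V (\<lambda>v. y v s))
          = (\<Prod>s\<in>?P. of_bool (agree (fst s) (\<beta> (l0 (fst s)) (snd s))))"
        by (intro prod.cong refl) (auto simp: cw)
      also have "\<dots> = of_bool (\<forall>n<M. \<forall>j<m. agree n (\<beta> (l0 n) j))"
        by (subst prod_of_bool) auto
      also have "(\<forall>n<M. \<forall>j<m. agree n (\<beta> (l0 n) j)) \<longleftrightarrow> (\<forall>n<M. \<forall>p<m. agree n p)"
      proof -
        have "(\<forall>j<m. agree n (\<beta> (l0 n) j)) \<longleftrightarrow> (\<forall>p<m. agree n p)" if n: "n < M" for n
        proof -
          have "\<beta> (l0 n) ` {..<m} = {..<m}" using bij[OF l0\<Psi>[OF n]] by (simp add: bij_betw_def)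
          thus ?thesis by (metis (no_types, lifting) imageE imageI lessThan_iff)
        qed
        thus ?thesis by blast
      qed
      also have "\<dots> \<longleftrightarrow> (\<forall>p\<in>?P. agree (fst p) (snd p))" by auto
      finally have "(\<Prod>s\<in>?P. cw V (\<lambda>v. y v s)) = ?f z"
        unfolding multigraph_tensor_def agree_def prod.collapse .
      moreover have "labelled V ?f x
          = ?f z"
      proof -
        have same: "(\<forall>u\<in>V. \<forall>v\<in>V. fst (x u) = fst (x v)) \<longleftrightarrow> True"
          using True unfolding l_def by blast
        show ?thesis unfolding labelled_def z_def same by simp
      qed
      ultimately show ?thesis
        unfolding block_power_def y_def[symmetric] all by simp
    next
      case False
      have "\<not> (\<forall>n<M. (\<lambda>v\<in>V. pattern_word m (\<lambda>j. y v (n, j))) \<in> \<Psi>)"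
      proof
        assume in\<Psi>: "\<forall>n<M. (\<lambda>v\<in>V. pattern_word m (\<lambda>j. y v (n, j))) \<in> \<Psi>"
        have eq: "l v n = (\<lambda>v\<in>V. pattern_word m (\<lambda>j. y v (n, j)))" if v: "v \<in> V" and n: "n < M" for v n
          by (rule diag[OF _ _ v]) (use in\<Psi> n v lw[OF v n] sub in \<open>auto simp: pat\<close>)
        have "l u = l v" if "u \<in> V" "v \<in> V" for u v
          by (rule PiE_ext[OF l l]) (use that eq in auto)
        thus False using False by blast
      qed
      thus ?thesis
        using False unfolding block_power_def y_def[symmetric] labelled_def l_def by auto
    qed
  qed
qed

section \<open>Subadditive sequences\<close>

text \<open>
  Fekete's lemma. Division with remainder by a fixed \<open>m\<close> gives \<open>a n / n \<le> a m / m + B / n\<close> with a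
  bound \<open>B\<close> depending on \<open>m\<close> only.
\<close>

lemma fekete_nat:
  fixes a :: "nat \<Rightarrow> nat"
  assumes sub: "\<And>m n. a (m + n) \<le> a m + a n"
  obtains l where "(\<lambda>n. real (a n) / real n) \<longlonglongrightarrow> l" "l \<ge> 0" "\<And>n. n \<ge> 1 \<Longrightarrow> l \<le> real (a n) / real n"
proof -
  define l where "l = (INF n\<in>{1..}. real (a n) / real n)"
  have bdd: "bdd_below ((\<lambda>n. real (a n) / real n) ` {1..})"
    by (rule bdd_belowI[of _ 0]) auto
  have l_le: "l \<le> real (a n) / real n" if "n \<ge> 1" for n
    unfolding l_def by (rule cINF_lower[OF bdd]) (use that in auto)
  have mult: "a (k * m + r) \<le> k * a m + a r" for k m r
  proof (induction k)
    case (Suc k)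
    have "a (Suc k * m + r) = a (m + (k * m + r))" by (simp add: algebra_simps)
    also have "\<dots> \<le> a m + a (k * m + r)" by (rule sub)
    finally show ?case using Suc by simp
  qed simp
  have "(\<lambda>n. real (a n) / real n) \<longlonglongrightarrow> l"
  proof (rule LIMSEQ_I)
    fix e :: real assume e: "e > 0"
    obtain m where m: "m \<ge> 1" "real (a m) / real m < l + e / 2"
      using cINF_less_iff[OF _ bdd, of "l + e / 2"] e unfolding l_def by fastforce
    define B where "B = (\<Sum>r<m. a r)"
    obtain N :: nat where N: "real N > 2 * real B / e" using reals_Archimedean2 by blast
    have "norm (real (a n) / real n - l) < e" if n: "n \<ge> max 1 N" for n
    proof -
      have n0: "real n > 0" using n by simp
      have "a n \<le> (n div m) * a m + a (n mod m)"
        using mult[of "n div m" m "n mod m"] by simp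
      also have "a (n mod m) \<le> B"
        unfolding B_def by (rule member_le_sum) (use m in auto)
      finally have "real (a n) \<le> real (n div m) * real (a m) + real B"
        by (metis add_left_mono of_nat_add of_nat_le_iff of_nat_mult order_trans)
      also have "real (n div m) * real (a m) \<le> (real n / real m) * real (a m)"
        by (intro mult_right_mono of_nat_div_le_of_nat) auto
      finally have "real (a n) / real n \<le> real (a m) / real m + real B / real n"
        using n0 by (simp add: field_simps)
      also have "real B / real n < e / 2"
        using N n n0 e by (simp add: field_simps) (smt (verit) mult_le_cancel_left_pos of_nat_le_iff)
      finally show ?thesis using m l_le[of n] n by simp
    qed
    thus "\<exists>no. \<forall>n\<ge>no. norm (real (a n) / real n - l) < e" by blast
  qed
  moreover have "l \<ge> 0" unfolding l_def by (rule cINF_greatest) auto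
  ultimately show ?thesis using that l_le by blast
qed

section \<open>Exponents as growth rates of ranks\<close>

lemma card_words: "card (words m) = 2 ^ m"
proof -
  have "words m = {xs. set xs \<subseteq> {1, 2} \<and> length xs = m}" by (auto simp: words_def)
  moreover have "card {xs. set xs \<subseteq> {1, 2::nat} \<and> length xs = m} = card {1, 2::nat} ^ m"
    by (rule card_lists_length_eq) simp
  ultimately show ?thesis by (simp add: numeral_2_eq_2)
qed

lemma words_altdef: "words m = {xs. length xs = m \<and> set xs \<subseteq> {1..2}}"
proof -
  have "{1..2} = {1, 2::nat}" by auto
  thus ?thesis by (simp add: words_def)
qed

lemma nth_words: "xs \<in> words m \<Longrightarrow> j < m \<Longrightarrow> xs ! j = 1 \<or> xs ! j = 2"
  unfolding words_def by (auto dest!: nth_mem[of j xs])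

lemma multi_idx_unit_power: "multi_idx (tensor_power (unit_tensor V 2) m) = PiE V (\<lambda>_. words m)"
  by (simp add: multi_idx_def tensor_power_def unit_tensor_def words_altdef)

lemma coord_unit_power:
  assumes V: "finite V" "V \<noteq> {}" and x: "x \<in> PiE V (\<lambda>_. words m)"
  shows "coord (tensor_power (unit_tensor V 2) m) x = of_bool (\<exists>l\<in>words m. x = (\<lambda>v\<in>V. l))"
proof -
  have eq: "coord (tensor_power (unit_tensor V 2) m) x
      = (\<Prod>j<m. \<Sum>i = 1..2. \<Prod>v\<in>V. of_bool (x v ! j = i))"
    by (simp add: tensor_power_def unit_tensor_def)
  show ?thesis
  proof (cases "\<exists>l\<in>words m. x = (\<lambda>v\<in>V. l)")
    case True
    then obtain l where l: "l \<in> words m" "x = (\<lambda>v\<in>V. l)" by blast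
    have "(\<Sum>i = 1..2. \<Prod>v\<in>V. of_bool (x v ! j = i)) = (1::complex)" if j: "j < m" for j
    proof -
      have "(\<Sum>i = 1..2. \<Prod>v\<in>V. of_bool (x v ! j = i)) = (\<Sum>i\<in>{1, 2}. of_bool (l ! j = i) :: complex)"
        using V l by (intro sum.cong) auto
      thus ?thesis using nth_words[OF l(1) j] by auto
    qed
    thus ?thesis using True by (simp add: eq)
  next
    case False
    obtain v0 where v0: "v0 \<in> V" using V by blast
    have "\<exists>v\<in>V. x v \<noteq> x v0"
    proof (rule ccontr)
      assume "\<not> ?thesis"
      hence "x = (\<lambda>v\<in>V. x v0)" using x by (intro extensionalityI[of _ V]) (auto simp: PiE_def)
      thus False using False x v0 by blast
    qed
    then obtain v where v: "v \<in> V" "x v \<noteq> x v0" by blast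
    have len: "length (x v) = m" "length (x v0) = m" using x v v0 by (auto simp: words_def PiE_iff)
    then obtain j where j: "j < m" "x v ! j \<noteq> x v0 ! j" using v(2) nth_equalityI by metis
    have "(\<Sum>i = 1..2. \<Prod>v\<in>V. of_bool (x v ! j = i)) = (0::complex)"
    proof (rule sum.neutral, rule ballI)
      fix i
      have "\<exists>w\<in>V. x w ! j \<noteq> i" using v v0 j(2) by metis
      thus "(\<Prod>v\<in>V. of_bool (x v ! j = i)) = (0::complex)" using V by auto
    qed
    hence "(\<Prod>j<m. \<Sum>i = 1..2. \<Prod>v\<in>V. of_bool (x v ! j = i)) = (0::complex)"
      using j(1) by (intro prod_zero) auto
    thus ?thesis using False by (simp add: eq)
  qed
qed

lemma coord_tensor_map_unit_power:
  assumes V: "finite V" "V \<noteq> {}"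
  shows "coord (tensor_map A L (tensor_power (unit_tensor V 2) m)) y
       = (\<Sum>l\<in>words m. \<Prod>v\<in>V. A v (y v) l)"
proof -
  let ?T = "tensor_power (unit_tensor V 2) m"
  have legs: "legs ?T = V" by (simp add: tensor_power_def unit_tensor_def)
  have fin: "finite (PiE V (\<lambda>_. words m))" using V finite_words by (intro finite_PiE) auto
  have "coord (tensor_map A L ?T) y = (\<Sum>x\<in>PiE V (\<lambda>_. words m). (\<Prod>v\<in>V. A v (y v) (x v)) * coord ?T x)"
    by (simp only: tensor_map_def legs multi_idx_unit_power tensor.simps)
  also have "\<dots> = (\<Sum>x\<in>(\<lambda>l. \<lambda>v\<in>V. l) ` words m. \<Prod>v\<in>V. A v (y v) (x v))"
    by (rule sum.mono_neutral_cong_right[OF fin]) (auto simp: coord_unit_power[OF V])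
  also have "\<dots> = (\<Sum>l\<in>words m. \<Prod>v\<in>V. A v (y v) l)"
  proof (rule sum.reindex_cong[where l="\<lambda>l. \<lambda>v\<in>V. l"])
    show "inj_on (\<lambda>l. \<lambda>v\<in>V. l) (words m)"
      using V by (auto simp: inj_on_def fun_eq_iff)
  qed (auto intro!: prod.cong)
  finally show ?thesis .
qed

text \<open>
  The power \<open>T\<^sub>2\<^sup>\<otimes>\<^sup>m\<close> is a unit tensor with \<open>2 ^ m\<close> basis vectors, so restricting it to a tensor is the
  same as writing that tensor as a sum of \<open>2 ^ m\<close> simple ones.
\<close>

lemma restricts_unit_power_iff_rank:
  assumes V: "finite V" "V \<noteq> {}" and legs: "legs \<psi> = V"
  shows "restricts_to (tensor_power (unit_tensor V 2) m) \<psi>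
     \<longleftrightarrow> rank_le V (idx \<psi>) (2 ^ m) (\<lambda>x. coord \<psi> (restrict x V))"
proof
  assume "restricts_to (tensor_power (unit_tensor V 2) m) \<psi>"
  then obtain A where A: "\<And>y. y \<in> PiE V (idx \<psi>) \<Longrightarrow> coord \<psi> y = (\<Sum>l\<in>words m. \<Prod>v\<in>V. A v (y v) l)"
    unfolding restricts_to_def by (auto simp: multi_idx_def legs coord_tensor_map_unit_power[OF V])
  show "rank_le V (idx \<psi>) (2 ^ m) (\<lambda>x. coord \<psi> (restrict x V))"
  proof (rule rank_leI[OF V finite_words, where a="\<lambda>l v y. A v y l"])
    fix x assume "x \<in> Pi V (idx \<psi>)"
    hence "restrict x V \<in> PiE V (idx \<psi>)" by auto
    thus "coord \<psi> (restrict x V) = (\<Sum>l\<in>words m. \<Prod>v\<in>V. A v (x v) l)"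
      by (simp add: A)
  qed (simp add: card_words)
next
  assume r: "rank_le V (idx \<psi>) (2 ^ m) (\<lambda>x. coord \<psi> (restrict x V))"
  obtain a where a: "\<And>x. x \<in> Pi V (idx \<psi>) \<Longrightarrow> coord \<psi> (restrict x V) = (\<Sum>l\<in>words m. \<Prod>v\<in>V. a l v (x v))"
    using rank_le_index[OF r finite_words card_words] by blast
  have "coord \<psi> y = (\<Sum>l\<in>words m. \<Prod>v\<in>V. a l v (y v))" if y: "y \<in> PiE V (idx \<psi>)" for y
  proof -
    have "restrict y V = y" using y by (simp add: PiE_def extensional_restrict)
    thus ?thesis using a[of y] y by (auto simp: PiE_def)
  qed
  hence "\<forall>y\<in>multi_idx \<psi>. coord \<psi> y = coord (tensor_map (\<lambda>v y l. a l v y) (idx \<psi>)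
      (tensor_power (unit_tensor V 2) m)) y"
    by (simp add: multi_idx_def legs coord_tensor_map_unit_power[OF V])
  thus "restricts_to (tensor_power (unit_tensor V 2) m) \<psi>"
    unfolding restricts_to_def using legs
    by (auto simp: tensor_power_def unit_tensor_def intro!: exI[of _ "\<lambda>v y l. a l v y"])
qed

text \<open>
  Ranks of powers are submultiplicative, so the limit defining the exponent exists and is
  the infimum of its sequence: every single power gives an upper bound.
\<close>

lemma exponent_le:
  assumes V: "finite V" "V \<noteq> {}" and legs: "legs \<psi> = V" and fin: "\<And>v. v \<in> V \<Longrightarrow> finite (idx \<psi> v)"
  shows "exponent \<psi> \<ge> 0"
    and "\<And>b m. b \<ge> 1 \<Longrightarrow> rank_le V (idx (tensor_power \<psi> b)) (2 ^ m)
           (\<lambda>x. coord (tensor_power \<psi> b) (restrict x V)) \<Longrightarrow> exponent \<psi> \<le> real m / real b"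
proof -
  let ?T = "tensor_power (unit_tensor V 2)"
  let ?J = "\<lambda>n. idx (tensor_power \<psi> n)"
  let ?f = "\<lambda>n x. coord (tensor_power \<psi> n) (restrict x V)"
  define a where "a n = (LEAST m. restricts_to (?T m) (tensor_power \<psi> n))" for n
  have legsn: "legs (tensor_power \<psi> n) = V" for n by (simp add: tensor_power_def legs)
  note iff = restricts_unit_power_iff_rank[OF V legsn]
  have f: "?f n x = (\<Prod>j<n. coord \<psi> (\<lambda>v\<in>V. x v ! j))" for n x
    by (auto simp: tensor_power_def legs intro!: prod.cong arg_cong[of _ _ "coord \<psi>"] restrict_ext)
  have ex: "\<exists>m. restricts_to (?T m) (tensor_power \<psi> n)" for n
  proof -
    have "finite (?J n v)" if "v \<in> V" for v
      using finite_lists_length_eq[OF fin[OF that], of n] by (simp add: tensor_power_def conj_commute)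
    hence "\<exists>r. rank_le V (?J n) r (?f n)" by (intro rank_le_finite V) auto
    then obtain r where "rank_le V (?J n) r (?f n)" by blast
    hence "rank_le V (?J n) (2 ^ r) (?f n)" by (rule rank_le_mono[OF V]) simp
    thus ?thesis using iff by blast
  qed
  have a: "restricts_to (?T (a n)) (tensor_power \<psi> n)" for n
    unfolding a_def by (rule LeastI_ex[OF ex])
  have a_le: "a n \<le> m" if "rank_le V (?J n) (2 ^ m) (?f n)" for n m
    unfolding a_def by (rule Least_le) (use that iff in blast)
  have rank_a: "rank_le V (?J n) (2 ^ a n) (?f n)" for n
    using a iff by blast
  have "a (m + n) \<le> a m + a n" for m n
  proof (rule a_le)
    have *: "rank_le V (?J (m + n)) (2 ^ a m) (\<lambda>x. ?f m (\<lambda>v. take m (x v)))"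
      by (rule rank_le_pullback[OF rank_a, where h="\<lambda>v. take m"])
        (auto simp: tensor_power_def dest: in_set_takeD)
    have **: "rank_le V (?J (m + n)) (2 ^ a n) (\<lambda>x. ?f n (\<lambda>v. drop m (x v)))"
      by (rule rank_le_pullback[OF rank_a, where h="\<lambda>v. drop m"])
        (auto simp: tensor_power_def dest: in_set_dropD)
    have split: "?f (m + n) x = ?f m (\<lambda>v. take m (x v)) * ?f n (\<lambda>v. drop m (x v))"
      if x: "x \<in> Pi V (?J (m + n))" for x
    proof -
      have len: "length (x v) = m + n" if "v \<in> V" for v using x that by (auto simp: tensor_power_def)
      have "j \<in> {..<m} \<union> (\<lambda>j. m + j) ` {..<n}" if "j < m + n" for j
        using that by (cases "j < m") (auto intro!: image_eqI[of _ _ "j - m"])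
      hence "{..<m + n} = {..<m} \<union> (\<lambda>j. m + j) ` {..<n}" by auto
      hence "?f (m + n) x = (\<Prod>j<m. coord \<psi> (\<lambda>v\<in>V. x v ! j)) * (\<Prod>j\<in>(\<lambda>j. m + j) ` {..<n}. coord \<psi> (\<lambda>v\<in>V. x v ! j))"
        unfolding f by (subst prod.union_disjoint[symmetric]) auto
      also have "(\<Prod>j\<in>(\<lambda>j. m + j) ` {..<n}. coord \<psi> (\<lambda>v\<in>V. x v ! j)) = (\<Prod>j<n. coord \<psi> (\<lambda>v\<in>V. x v ! (m + j)))"
        by (subst prod.reindex) auto
      also have "(\<Prod>j<n. coord \<psi> (\<lambda>v\<in>V. x v ! (m + j))) = ?f n (\<lambda>v. drop m (x v))"
        unfolding f using len by (auto intro!: prod.cong arg_cong[of _ _ "coord \<psi>"] restrict_ext)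
      also have "(\<Prod>j<m. coord \<psi> (\<lambda>v\<in>V. x v ! j)) = ?f m (\<lambda>v. take m (x v))"
        unfolding f by (auto intro!: prod.cong arg_cong[of _ _ "coord \<psi>"] restrict_ext)
      finally show ?thesis .
    qed
    show "rank_le V (?J (m + n)) (2 ^ (a m + a n)) (?f (m + n))"
      by (rule rank_le_cong[OF _ split]) (use rank_le_mult[OF V * **] in \<open>simp add: power_add\<close>)
  qed
  then obtain l where l: "(\<lambda>n. real (a n) / real n) \<longlonglongrightarrow> l" "l \<ge> 0" "\<And>n. n \<ge> 1 \<Longrightarrow> l \<le> real (a n) / real n"
    using fekete_nat by blast
  have "exponent \<psi> = l"
    unfolding exponent_def legs using limI[OF l(1)] by (simp add: a_def)
  thus "exponent \<psi> \<ge> 0" using l by simp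
  fix b m assume b: "b \<ge> 1" and r: "rank_le V (?J b) (2 ^ m) (?f b)"
  have "l \<le> real (a b) / real b" by (rule l(3)[OF b])
  also have "\<dots> \<le> real m / real b" using a_le[OF r] by (intro divide_right_mono) auto
  finally show "exponent \<psi> \<le> real m / real b" using \<open>exponent \<psi> = l\<close> by simp
qed

section \<open>Symmetrization over the vertices\<close>

text \<open>
  A labelling \<open>i\<close> of the edges contributes to the coordinate \<open>x\<close> exactly when every leg reads off
  \<open>i\<close> on its edges, so the sum has at most one nonzero term.
\<close>

lemma coord_graph_tensor:
  assumes V: "finite V" and E: "finite E" "\<And>e. e \<in> E \<Longrightarrow> e \<subseteq> V \<and> e \<noteq> {}"
    and x: "\<And>v. v \<in> V \<Longrightarrow> x v \<in> PiE (incident E v) (\<lambda>_. {1..n})"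
  shows "coord (graph_tensor n V E) x = of_bool (\<forall>e\<in>E. \<forall>u\<in>e. \<forall>v\<in>e. x u e = x v e)"
proof -
  define C where "C i \<longleftrightarrow> (\<forall>v\<in>V. x v = restrict i (incident E v))" for i
  have fin: "finite (PiE E (\<lambda>_. {1..n}))" using E by (intro finite_PiE) auto
  have eq: "coord (graph_tensor n V E) x = (\<Sum>i\<in>PiE E (\<lambda>_. {1..n}). of_bool (C i))"
    by (simp add: graph_tensor_def C_def prod_of_bool[OF V])
  have C_iff: "C i \<longleftrightarrow> (\<forall>e\<in>E. \<forall>v\<in>e. i e = x v e)" for i
  proof
    assume "C i"
    show "\<forall>e\<in>E. \<forall>v\<in>e. i e = x v e"
    proof (intro ballI)
      fix e v assume ev: "e \<in> E" "v \<in> e"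
      hence "x v = restrict i (incident E v)" using \<open>C i\<close> E(2) unfolding C_def by blast
      thus "i e = x v e" using ev by (simp add: incident_def)
    qed
  next
    assume *: "\<forall>e\<in>E. \<forall>v\<in>e. i e = x v e"
    show "C i" unfolding C_def
    proof
      fix v assume v: "v \<in> V"
      show "x v = restrict i (incident E v)"
        by (rule extensionalityI[of _ "incident E v"]) (use x[OF v] * in \<open>auto simp: PiE_def incident_def\<close>)
    qed
  qed
  show ?thesis
  proof (cases "\<forall>e\<in>E. \<forall>u\<in>e. \<forall>v\<in>e. x u e = x v e")
    case True
    define i where "i = (\<lambda>e\<in>E. x (SOME v. v \<in> e) e)"
    have some: "(SOME v. v \<in> e) \<in> e" if "e \<in> E" for e using E(2)[OF that] by (simp add: some_in_eq)
    have i: "i e = x v e" if "e \<in> E" "v \<in> e" for e v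
    proof -
      have "i e = x (SOME v. v \<in> e) e" using that by (simp add: i_def)
      also have "\<dots> = x v e" using True some that by blast
      finally show ?thesis .
    qed
    have "i \<in> PiE E (\<lambda>_. {1..n})"
    proof (rule PiE_I)
      fix e assume e: "e \<in> E"
      let ?v = "SOME v. v \<in> e"
      have "?v \<in> V" using some[OF e] E(2)[OF e] by blast
      hence "x ?v e \<in> {1..n}" using x[of ?v] e some[OF e] by (auto simp: incident_def PiE_iff)
      thus "i e \<in> {1..n}" using i[OF e some[OF e]] by simp
    qed (simp add: i_def)
    moreover have "C j \<longleftrightarrow> j = i" if j: "j \<in> PiE E (\<lambda>_. {1..n})" for j
    proof
      assume "C j"
      show "j = i"
        by (rule extensionalityI[of _ E]) (use j \<open>C j\<close> C_iff i some in \<open>auto simp: PiE_def i_def\<close>)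
    next
      assume "j = i" thus "C j" using i C_iff by blast
    qed
    ultimately have "(\<Sum>j\<in>PiE E (\<lambda>_. {1..n}). of_bool (C j)) = (\<Sum>j\<in>PiE E (\<lambda>_. {1..n}). of_bool (j = i) :: complex)"
      by (intro sum.cong refl) simp
    also have "\<dots> = 1" using fin \<open>i \<in> _\<close> by (simp add: of_bool_def)
    finally have one: "(\<Sum>j\<in>PiE E (\<lambda>_. {1..n}). of_bool (C j)) = (1 :: complex)" .
    have all: "(\<forall>e\<in>E. \<forall>u\<in>e. \<forall>v\<in>e. x u e = x v e) \<longleftrightarrow> True" using True by blast
    show ?thesis unfolding eq one all by simp
  next
    case False
    hence "\<not> C i" for i using C_iff by metis
    thus ?thesis using False by (simp add: eq)
  qed
qed

text \<open>
  The \<open>b\<close>-th power of a graph tensor is the tensor of the multigraph with \<open>b\<close> parallel copies of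
  every edge. Positions away from \<open>v\<close> get the dummy value \<open>1\<close> on the leg \<open>v\<close>.
\<close>

lemma rank_graph_power:
  assumes V: "finite V" "V \<noteq> {}" and E: "finite E" "\<And>e. e \<in> E \<Longrightarrow> e \<subseteq> V \<and> e \<noteq> {}"
    and r: "rank_le V (\<lambda>_. Pi ({..<b} \<times> E) (\<lambda>_. {1..2})) R (multigraph_tensor ({..<b} \<times> E) snd)"
  shows "rank_le V (idx (tensor_power (graph_tensor 2 V E) b)) R
           (\<lambda>x. coord (tensor_power (graph_tensor 2 V E) b) (restrict x V))"
proof (rule rank_le_pullback[OF r, where h="\<lambda>v xs p. if v \<in> snd p then (xs ! fst p) (snd p) else 1"])
  fix v xs assume "v \<in> V" and xs: "xs \<in> idx (tensor_power (graph_tensor 2 V E) b) v"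
  hence "length xs = b" "set xs \<subseteq> PiE (incident E v) (\<lambda>_. {1..2})"
    by (simp_all add: tensor_power_def graph_tensor_def)
  hence "xs ! j \<in> PiE (incident E v) (\<lambda>_. {1..2})" if "j < b" for j
    using that nth_mem[of j xs] by blast
  thus "(\<lambda>p. if v \<in> snd p then (xs ! fst p) (snd p) else 1) \<in> Pi ({..<b} \<times> E) (\<lambda>_. {1..2})"
    by (auto simp: incident_def PiE_iff Pi_iff)
next
  fix x assume x: "x \<in> Pi V (idx (tensor_power (graph_tensor 2 V E) b))"
  have xj: "x v ! j \<in> PiE (incident E v) (\<lambda>_. {1..2})" if "v \<in> V" "j < b" for v j
  proof -
    have "x v \<in> idx (tensor_power (graph_tensor 2 V E) b) v" using x that(1) by blast
    hence "length (x v) = b" "set (x v) \<subseteq> PiE (incident E v) (\<lambda>_. {1..2})"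
      by (simp_all add: tensor_power_def graph_tensor_def)
    thus ?thesis using that nth_mem[of j "x v"] by blast
  qed
  have legs: "legs (graph_tensor 2 V E) = V" by (simp add: graph_tensor_def)
  define agree where "agree j e \<longleftrightarrow> (\<forall>u\<in>e. \<forall>v\<in>e. (x u ! j) e = (x v ! j) e)" for j e
  have "coord (tensor_power (graph_tensor 2 V E) b) (restrict x V)
      = (\<Prod>j<b. coord (graph_tensor 2 V E) (\<lambda>v\<in>V. x v ! j))"
    by (auto simp: tensor_power_def legs intro!: prod.cong arg_cong[of _ _ "coord _"] restrict_ext)
  also have "\<dots> = (\<Prod>j<b. of_bool (\<forall>e\<in>E. agree j e))"
  proof (rule prod.cong[OF refl])
    fix j assume "j \<in> {..<b}"
    hence j: "j < b" by simp
    have "coord (graph_tensor 2 V E) (\<lambda>v\<in>V. x v ! j) = of_bool (\<forall>e\<in>E. \<forall>u\<in>e. \<forall>v\<in>e.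
        (\<lambda>v\<in>V. x v ! j) u e = (\<lambda>v\<in>V. x v ! j) v e)"
      by (rule coord_graph_tensor[OF V(1) E]) (use xj[OF _ j] in auto)
    also have "(\<forall>e\<in>E. \<forall>u\<in>e. \<forall>v\<in>e. (\<lambda>v\<in>V. x v ! j) u e = (\<lambda>v\<in>V. x v ! j) v e)
        \<longleftrightarrow> (\<forall>e\<in>E. agree j e)"
      unfolding agree_def by (intro ball_cong refl) (use E(2) in \<open>auto simp: subset_iff\<close>)
    finally show "coord (graph_tensor 2 V E) (\<lambda>v\<in>V. x v ! j) = of_bool (\<forall>e\<in>E. agree j e)" .
  qed
  also have "\<dots> = of_bool (\<forall>j<b. \<forall>e\<in>E. agree j e)"
    by (subst prod_of_bool) auto
  also have "(\<forall>j<b. \<forall>e\<in>E. agree j e) \<longleftrightarrow> (\<forall>p\<in>{..<b} \<times> E. agree (fst p) (snd p))" by auto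
  also have "of_bool \<dots> = multigraph_tensor ({..<b} \<times> E) snd
      (\<lambda>v p. if v \<in> snd p then (x v ! fst p) (snd p) else 1)"
    unfolding multigraph_tensor_def agree_def
    by (intro arg_cong[of _ _ of_bool] ball_cong refl) simp
  finally show "coord (tensor_power (graph_tensor 2 V E) b) (restrict x V)
      = multigraph_tensor ({..<b} \<times> E) snd (\<lambda>v p. if v \<in> snd p then (x v ! fst p) (snd p) else 1)" .
qed

text \<open>
  A multigraph in which every edge of \<open>E\<close> occurs \<open>c\<close> times carries an index of \<open>q ^ c\<close> values on
  every edge, which can encode \<open>b\<close> bits.
\<close>

lemma rank_multigraph_bits:
  assumes e: "\<And>p. p \<in> P \<Longrightarrow> e p \<in> E" and P: "finite P"
    and card: "\<And>e0. e0 \<in> E \<Longrightarrow> card {p\<in>P. e p = e0} = c" and b: "2 ^ b \<le> q ^ c"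
    and E: "\<And>e. e \<in> E \<Longrightarrow> e \<subseteq> V"
    and r: "rank_le V (\<lambda>_. Pi P (\<lambda>_. {1..q})) R (multigraph_tensor P e)"
  shows "rank_le V (\<lambda>_. Pi ({..<b} \<times> E) (\<lambda>_. {1..2})) R (multigraph_tensor ({..<b} \<times> E) snd)"
proof -
  have "\<forall>e0\<in>E. \<exists>f. f ` PiE {..<b} (\<lambda>_. {1..2}) \<subseteq> PiE {p\<in>P. e p = e0} (\<lambda>_. {1..q}) \<and>
            inj_on f (PiE {..<b} (\<lambda>_. {1..2::nat}))"
  proof
    fix e0 assume e0: "e0 \<in> E"
    have "card (PiE {..<b} (\<lambda>_. {1..2::nat})) \<le> card (PiE {p\<in>P. e p = e0} (\<lambda>_. {1..q}))"
      using b card[OF e0] P by (simp add: card_PiE)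
    thus "\<exists>f. f ` PiE {..<b} (\<lambda>_. {1..2}) \<subseteq> PiE {p\<in>P. e p = e0} (\<lambda>_. {1..q}) \<and>
            inj_on f (PiE {..<b} (\<lambda>_. {1..2::nat}))"
      by (intro card_le_inj finite_PiE) (use P in auto)
  qed
  from bchoice[OF this] obtain f where f_all:
    "\<forall>e0\<in>E. f e0 ` PiE {..<b} (\<lambda>_. {1..2}) \<subseteq> PiE {p\<in>P. e p = e0} (\<lambda>_. {1..q}) \<and>
            inj_on (f e0) (PiE {..<b} (\<lambda>_. {1..2::nat}))" ..
  have f: "inj_on (f e0) (PiE {..<b} (\<lambda>_. {1..2::nat}))"
      "f e0 ` PiE {..<b} (\<lambda>_. {1..2}) \<subseteq> PiE {p\<in>P. e p = e0} (\<lambda>_. {1..q})" if "e0 \<in> E" for e0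
    using bspec[OF f_all that] by simp_all
  define bits where "bits y e0 = (\<lambda>j\<in>{..<b}. y (j, e0))" for y :: "nat \<times> 'b set \<Rightarrow> nat" and e0
  have bits: "bits y e0 \<in> PiE {..<b} (\<lambda>_. {1..2})"
    if "y \<in> Pi ({..<b} \<times> E) (\<lambda>_. {1..2})" "e0 \<in> E" for y e0
    using that by (auto simp: bits_def Pi_iff)
  show ?thesis
  proof (rule rank_le_pullback[OF r, where h="\<lambda>v y p. f (e p) (bits y (e p)) p"])
    fix v y assume y: "y \<in> Pi ({..<b} \<times> E) (\<lambda>_. {1..2::nat})"
    show "(\<lambda>p. f (e p) (bits y (e p)) p) \<in> Pi P (\<lambda>_. {1..q})"
    proof
      fix p assume p: "p \<in> P"
      have "f (e p) (bits y (e p)) \<in> PiE {p'\<in>P. e p' = e p} (\<lambda>_. {1..q})"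
        using f(2)[OF e[OF p]] bits[OF y e[OF p]] by blast
      thus "f (e p) (bits y (e p)) p \<in> {1..q}" using p by auto
    qed
  next
    fix x assume x: "x \<in> Pi V (\<lambda>_. Pi ({..<b} \<times> E) (\<lambda>_. {1..2::nat}))"
    have edge: "(\<forall>p\<in>{p\<in>P. e p = e0}. f e0 (bits (x u) e0) p = f e0 (bits (x v) e0) p)
        \<longleftrightarrow> (\<forall>j<b. x u (j, e0) = x v (j, e0))" if e0: "e0 \<in> E" and uv: "u \<in> e0" "v \<in> e0" for e0 u v
    proof -
      have V: "u \<in> V" "v \<in> V" using E[OF e0] uv by auto
      have bu: "bits (x u) e0 \<in> PiE {..<b} (\<lambda>_. {1..2})"
        by (rule bits[OF Pi_mem[OF x V(1)] e0])
      have bv: "bits (x v) e0 \<in> PiE {..<b} (\<lambda>_. {1..2})"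
        by (rule bits[OF Pi_mem[OF x V(2)] e0])
      have fu: "f e0 (bits (x u) e0) \<in> PiE {p\<in>P. e p = e0} (\<lambda>_. {1..q})"
        and fv: "f e0 (bits (x v) e0) \<in> PiE {p\<in>P. e p = e0} (\<lambda>_. {1..q})"
        using f(2)[OF e0] bu bv by blast+
      have "(\<forall>p\<in>{p\<in>P. e p = e0}. f e0 (bits (x u) e0) p = f e0 (bits (x v) e0) p)
          \<longleftrightarrow> f e0 (bits (x u) e0) = f e0 (bits (x v) e0)"
        using PiE_ext[OF fu fv] by metis
      also have "\<dots> \<longleftrightarrow> bits (x u) e0 = bits (x v) e0"
        using inj_onD[OF f(1)[OF e0] _ bu bv] by metis
      also have "\<dots> \<longleftrightarrow> (\<forall>j<b. x u (j, e0) = x v (j, e0))"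
        by (auto simp: bits_def fun_eq_iff restrict_def)
      finally show ?thesis .
    qed
    have "(\<forall>p\<in>P. \<forall>u\<in>e p. \<forall>v\<in>e p. f (e p) (bits (x u) (e p)) p = f (e p) (bits (x v) (e p)) p)
        \<longleftrightarrow> (\<forall>e0\<in>E. \<forall>u\<in>e0. \<forall>v\<in>e0. \<forall>p\<in>{p\<in>P. e p = e0}. f e0 (bits (x u) e0) p = f e0 (bits (x v) e0) p)"
      using e by blast
    also have "\<dots> \<longleftrightarrow> (\<forall>e0\<in>E. \<forall>u\<in>e0. \<forall>v\<in>e0. \<forall>j<b. x u (j, e0) = x v (j, e0))"
      by (intro ball_cong refl edge)
    also have "\<dots> \<longleftrightarrow> (\<forall>p\<in>{..<b} \<times> E. \<forall>u\<in>snd p. \<forall>v\<in>snd p. x u p = x v p)"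
      unfolding split_paired_Ball_Sigma snd_conv by blast
    finally show "multigraph_tensor ({..<b} \<times> E) snd x
        = multigraph_tensor P e (\<lambda>v p. f (e p) (bits (x v) (e p)) p)"
      unfolding multigraph_tensor_def by (rule arg_cong[OF sym])
  qed
qed

lemma finite_complete_edges: "finite V \<Longrightarrow> finite (complete_edges V)"
  by (simp add: complete_edges_def)

lemma permutation_of_edges:
  assumes "d \<in> complete_edges V" "e \<in> complete_edges V"
  obtains \<tau> where "\<tau> permutes V" "\<tau> ` d = e"
proof -
  obtain a b where ab: "d = {a, b}" "a \<noteq> b" "a \<in> V" "b \<in> V"
    using assms(1) by (auto simp: complete_edges_def card_2_iff)
  obtain c f where cf: "e = {c, f}" "c \<noteq> f" "c \<in> V" "f \<in> V"
    using assms(2) by (auto simp: complete_edges_def card_2_iff)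
  define s where "s = Transposition.transpose a c"
  \<comment> \<open>\<open>s b \<noteq> c\<close>, so the second transposition moves \<open>s b\<close> to \<open>f\<close> and keeps \<open>c\<close> in place\<close>
  define \<tau> where "\<tau> = Transposition.transpose (s b) f \<circ> s"
  have s: "s a = c" "s b \<noteq> c" "s permutes V"
    using ab cf by (auto simp: s_def permutes_swap_id Transposition.transpose_def)
  have "s b \<in> V" using s(3) ab(4) by (simp add: permutes_in_image)
  hence "\<tau> permutes V" unfolding \<tau>_def using s cf by (intro permutes_compose permutes_swap_id)
  moreover have "\<tau> ` d = e" using s ab cf by (auto simp: \<tau>_def Transposition.transpose_def)
  ultimately show ?thesis by (rule that)
qed

text \<open>
  Taking the product over all relabellings of the vertices distributes the positions evenly over
  the edges of the complete graph, at the price of raising the rank bound to the power \<open>k!\<close>.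
\<close>

lemma rank_complete_graph_power:
  fixes V :: "'v set" and e :: "'p \<Rightarrow> 'v set"
  assumes V: "finite V" "card V \<ge> 2" and P: "finite P"
    and e: "\<And>p. p \<in> P \<Longrightarrow> e p \<in> complete_edges V"
    and r: "rank_le V (\<lambda>_. Pi P (\<lambda>_. {1..q})) R (multigraph_tensor P e)"
    and c: "c * card (complete_edges V) = fact (card V) * card P" and b: "2 ^ b \<le> q ^ c"
  shows "rank_le V (idx (tensor_power (graph_tensor 2 V (complete_edges V)) b)) (R ^ fact (card V))
           (\<lambda>x. coord (tensor_power (graph_tensor 2 V (complete_edges V)) b) (restrict x V))"
proof -
  let ?E = "complete_edges V"
  have V0: "V \<noteq> {}" using V by auto
  define S where "S = {\<sigma>. \<sigma> permutes V}"
  define e' :: "('v \<Rightarrow> 'v) \<times> 'p \<Rightarrow> 'v set" where "e' = (\<lambda>(\<sigma>, p). \<sigma> ` e p)"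
  have S: "finite S" "card S = fact (card V)"
    using finite_permutations[OF V(1)] card_permutations[OF refl V(1)] by (auto simp: S_def)
  have image: "\<sigma> ` d \<in> ?E" if "\<sigma> \<in> S" "d \<in> ?E" for \<sigma> d
  proof -
    have \<sigma>: "\<sigma> permutes V" using that(1) by (simp add: S_def)
    have "card (\<sigma> ` d) = card d" by (rule card_image) (use permutes_inj[OF \<sigma>] in \<open>auto simp: inj_on_def\<close>)
    moreover have "\<sigma> ` d \<subseteq> V" using that(2) permutes_in_image[OF \<sigma>] by (auto simp: complete_edges_def)
    ultimately show ?thesis using that(2) by (simp add: complete_edges_def)
  qed
  have e': "e' p \<in> ?E" if "p \<in> S \<times> P" for p
    using that image e by (auto simp: e'_def)
  have fin: "finite {p \<in> S \<times> P. e' p = d}" for d using S P by auto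
  have le: "card {p \<in> S \<times> P. e' p = d} \<le> card {p \<in> S \<times> P. e' p = d'}" if dd': "d \<in> ?E" "d' \<in> ?E" for d d'
  proof -
    obtain \<tau> where \<tau>: "\<tau> permutes V" "\<tau> ` d = d'" by (rule permutation_of_edges[OF dd'])
    show ?thesis
    proof (rule card_inj_on_le[OF _ _ fin])
      show "inj_on (\<lambda>(\<sigma>, p). (\<tau> \<circ> \<sigma>, p)) {p \<in> S \<times> P. e' p = d}"
        using permutes_inj[OF \<tau>(1)] by (auto simp: inj_on_def fun.inj_map_strong fun_eq_iff)
      show "(\<lambda>(\<sigma>, p). (\<tau> \<circ> \<sigma>, p)) ` {p \<in> S \<times> P. e' p = d} \<subseteq> {p \<in> S \<times> P. e' p = d'}"
        using \<tau> by (auto simp: e'_def S_def permutes_compose image_comp[symmetric])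
    qed
  qed
  have card: "card {p \<in> S \<times> P. e' p = d} = c" if d: "d \<in> ?E" for d
  proof -
    have "S \<times> P = (\<Union>d'\<in>?E. {p \<in> S \<times> P. e' p = d'})" using e' by blast
    hence "card (S \<times> P) = card (\<Union>d'\<in>?E. {p \<in> S \<times> P. e' p = d'})" by simp
    also have "\<dots> = (\<Sum>d'\<in>?E. card {p \<in> S \<times> P. e' p = d'})"
      by (rule card_UN_disjoint) (use fin finite_complete_edges[OF V(1)] in auto)
    also have "\<dots> = (\<Sum>d'\<in>?E. card {p \<in> S \<times> P. e' p = d})"
      by (intro sum.cong refl antisym le d)
    finally have "card {p \<in> S \<times> P. e' p = d} * card ?E = fact (card V) * card P"
      using S by (simp add: card_cartesian_product mult.commute)
    hence "card {p \<in> S \<times> P. e' p = d} * card ?E = c * card ?E" using c by simp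
    moreover have "card ?E > 0" using d finite_complete_edges[OF V(1)] card_gt_0_iff by blast
    ultimately show ?thesis by simp
  qed
  have "rank_le V (\<lambda>_. Pi (S \<times> P) (\<lambda>_. {1..q})) (R ^ card S)
      (\<lambda>y. \<Prod>\<sigma>\<in>S. multigraph_tensor P (\<lambda>p. \<sigma> ` e p) (\<lambda>v p. y v (\<sigma>, p)))"
  proof (rule rank_le_prod[OF V(1) V0 S(1)])
    fix \<sigma> assume \<sigma>: "\<sigma> \<in> S"
    have "rank_le V (\<lambda>_. Pi P (\<lambda>_. {1..q})) R (\<lambda>x. multigraph_tensor P e (x \<circ> \<sigma>))"
      using \<sigma> by (intro rank_le_permute[OF V(1) _ r]) (simp add: S_def)
    moreover have "multigraph_tensor P e (x \<circ> \<sigma>) = multigraph_tensor P (\<lambda>p. \<sigma> ` e p) x" for x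
      by (simp add: multigraph_tensor_def)
    ultimately have "rank_le V (\<lambda>_. Pi P (\<lambda>_. {1..q})) R (multigraph_tensor P (\<lambda>p. \<sigma> ` e p))"
      by simp
    thus "rank_le V (\<lambda>_. Pi (S \<times> P) (\<lambda>_. {1..q})) R
        (\<lambda>y. multigraph_tensor P (\<lambda>p. \<sigma> ` e p) (\<lambda>v p. y v (\<sigma>, p)))"
      by (rule rank_le_pullback[where h="\<lambda>v y p. y (\<sigma>, p)"]) (use \<sigma> in auto)
  qed
  moreover have "(\<Prod>\<sigma>\<in>S. multigraph_tensor P (\<lambda>p. \<sigma> ` e p) (\<lambda>v p. y v (\<sigma>, p)))
      = multigraph_tensor (S \<times> P) e' y" for y
    unfolding multigraph_tensor_def by (subst prod_of_bool[OF S(1)]) (simp add: e'_def)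
  ultimately have "rank_le V (\<lambda>_. Pi (S \<times> P) (\<lambda>_. {1..q})) (R ^ fact (card V)) (multigraph_tensor (S \<times> P) e')"
    by (simp add: S)
  hence "rank_le V (\<lambda>_. Pi ({..<b} \<times> ?E) (\<lambda>_. {1..2})) (R ^ fact (card V)) (multigraph_tensor ({..<b} \<times> ?E) snd)"
    by (rule rank_multigraph_bits[rotated -1])
      (use e' S P card b in \<open>auto simp: complete_edges_def\<close>)
  thus ?thesis
    by (rule rank_graph_power[OF V(1) V0 finite_complete_edges[OF V(1)], rotated])
      (auto simp: complete_edges_def)
qed

section \<open>From degenerations to the exponent\<close>

lemma le_of_linear_growth:
  fixes a b c d :: real
  assumes "\<And>n :: nat. n \<ge> 1 \<Longrightarrow> a * real n \<le> b * real n + c * ln (real n) + d"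
  shows "a \<le> b"
proof (rule LIMSEQ_le_const)
  have "(\<lambda>n. ln (real n) / real n) \<longlonglongrightarrow> 0"
    by (rule filterlim_compose[OF ln_x_over_x_tendsto_0 filterlim_real_sequentially])
  moreover have "(\<lambda>n. d / real n) \<longlonglongrightarrow> 0"
    by (rule lim_const_over_n)
  ultimately show "(\<lambda>n. b + c * (ln (real n) / real n) + d / real n) \<longlonglongrightarrow> b"
    using tendsto_add[OF tendsto_add[OF tendsto_const tendsto_mult[OF tendsto_const]], of _ 0] by fastforce
  have "a \<le> b + c * (ln (real n) / real n) + d / real n" if n: "n \<ge> 1" for n
  proof -
    have "a = a * real n / real n" using n by simp
    also have "\<dots> \<le> (b * real n + c * ln (real n) + d) / real n"
      using assms[OF n] by (intro divide_right_mono) auto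
    also have "\<dots> = b + c * (ln (real n) / real n) + d / real n"
      using n by (simp add: add_divide_distrib)
    finally show ?thesis .
  qed
  thus "\<exists>N. \<forall>n\<ge>N. a \<le> b + c * (ln (real n) / real n) + d / real n" by blast
qed

text \<open>
  A single rank bound for a multigraph tensor bounds the exponent, since every power of the
  graph tensor gives an upper bound. The additive constants come from rounding to whole bits and are
  negligible for large multigraphs.
\<close>

lemma exponent_le_of_rank:
  fixes V :: "'v set" and e :: "'p \<Rightarrow> 'v set"
  assumes V: "finite V" "card V \<ge> 2" and P: "finite P" "P \<noteq> {}" and q: "q \<ge> 2"
    and e: "\<And>p. p \<in> P \<Longrightarrow> e p \<in> complete_edges V"
    and r: "rank_le V (\<lambda>_. Pi P (\<lambda>_. {1..q})) R (multigraph_tensor P e)"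
    and c: "c * card (complete_edges V) = fact (card V) * card P" and R: "R \<ge> 1"
  shows "exponent (graph_tensor 2 V (complete_edges V)) * (real c * log 2 (real q) - 1)
           \<le> fact (card V) * log 2 (real R) + 1"
proof -
  let ?E = "complete_edges V"
  let ?G = "graph_tensor 2 V ?E"
  have V0: "V \<noteq> {}" using V by auto
  have "c * card ?E > 0" unfolding c using P by (simp add: card_gt_0_iff)
  hence c1: "c \<ge> 1" by (cases c) auto
  have lq: "log 2 (real q) \<ge> 1" using q by (simp add: le_log_iff)
  have clq: "real c * log 2 (real q) \<ge> 1"
  proof -
    have "1 * 1 \<le> real c * log 2 (real q)" using c1 lq by (intro mult_mono) auto
    thus ?thesis by simp
  qed
  \<comment> \<open>the largest number of bits that fits into \<open>c\<close> symbols of an alphabet of size \<open>q\<close>\<close>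
  define b where "b = nat \<lfloor>real c * log 2 (real q)\<rfloor>"
  have b: "real b \<le> real c * log 2 (real q)" "real b > real c * log 2 (real q) - 1" "b \<ge> 1"
    using clq unfolding b_def by linarith+
  have "(2::real) ^ b \<le> real q ^ c"
  proof -
    have "(2::real) ^ b = 2 powr real b" by (simp add: powr_realpow)
    also have "\<dots> \<le> 2 powr (real c * log 2 (real q))" using b(1) by simp
    also have "\<dots> = (2 powr log 2 (real q)) powr real c" by (simp add: powr_powr mult.commute)
    also have "\<dots> = real q ^ c" using q by (simp add: powr_realpow)
    finally show ?thesis .
  qed
  hence "2 ^ b \<le> q ^ c" by (metis of_nat_le_iff of_nat_numeral of_nat_power)
  note rank = rank_complete_graph_power[OF V P(1) e r c this]
  define m where "m = nat \<lceil>fact (card V) * log 2 (real R)\<rceil>"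
  have logR: "fact (card V) * log 2 (real R) \<ge> 0" using R by simp
  have m: "fact (card V) * log 2 (real R) \<le> real m" "real m \<le> fact (card V) * log 2 (real R) + 1"
    unfolding m_def using logR by linarith+
  have "real R ^ fact (card V) \<le> (2::real) ^ m"
  proof -
    have "real R ^ fact (card V) = real R powr real (fact (card V))"
      using R by (intro powr_realpow[symmetric]) simp
    also have "\<dots> = (2 powr log 2 (real R)) powr real (fact (card V))" using R by simp
    also have "\<dots> = 2 powr (fact (card V) * log 2 (real R))"
      by (simp only: powr_powr of_nat_fact mult.commute)
    also have "\<dots> \<le> 2 powr real m" using m by simp
    finally show ?thesis by (simp add: powr_realpow)
  qed
  hence "R ^ fact (card V) \<le> 2 ^ m" by (metis of_nat_le_iff of_nat_numeral of_nat_power)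
  note rank2 = rank_le_mono[OF V(1) V0 rank this]
  have legs: "legs ?G = V" by (simp add: graph_tensor_def)
  have fin: "finite (idx ?G v)" for v
    using finite_complete_edges[OF V(1)]
    by (auto simp: graph_tensor_def incident_def intro!: finite_PiE)
  have "exponent ?G \<le> real m / real b"
    by (rule exponent_le(2)[OF V(1) V0 legs fin b(3) rank2])
  hence "exponent ?G * real b \<le> real m" using b(3) by (simp add: field_simps)
  moreover have "exponent ?G * (real c * log 2 (real q) - 1) \<le> exponent ?G * real b"
    using exponent_le(1)[OF V(1) V0 legs fin] b(2) by (intro mult_left_mono) auto
  ultimately show ?thesis using m(2) by linarith
qed

definition edge_list :: "'v set \<Rightarrow> nat \<Rightarrow> ('v \<Rightarrow> nat list) \<Rightarrow> 'v set list" where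
  "edge_list V m x = map (\<lambda>j. {v\<in>V. x v ! j = 1}) [0..<m]"

lemma set_edge_list: "x \<in> edge_words V m \<Longrightarrow> set (edge_list V m x) \<subseteq> complete_edges V"
  by (auto simp: edge_list_def edge_words_def complete_edges_def)

lemma card_diagonal_le:
  assumes V: "V \<noteq> {}" and deg: "diagonal_degeneration V (edge_words V m) \<Psi>"
  shows "finite \<Psi>" "card \<Psi> \<le> 2 ^ m"
proof -
  obtain v0 where v0: "v0 \<in> V" using V by blast
  have inj: "inj_on (\<lambda>x. x v0) \<Psi>"
    using deg v0 unfolding diagonal_degeneration_def inj_on_def by blast
  have sub: "(\<lambda>x. x v0) ` \<Psi> \<subseteq> words m"
    using deg v0 by (auto simp: diagonal_degeneration_def edge_words_def PiE_iff)
  show "finite \<Psi>" by (rule inj_on_finite[OF inj sub finite_words])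
  show "card \<Psi> \<le> 2 ^ m" using card_inj_on_le[OF inj sub finite_words] by (simp add: card_words)
qed

text \<open>
  The bound for blocks of one type. The rank of \<open>M\<close>-th powers has a polynomial overhead in \<open>M\<close>;
  the labels cost a constant factor relative to the \<open>N\<close>-th power of the block. Letting first \<open>N\<close>
  and then \<open>M\<close> tend to infinity removes both.
\<close>

lemma exponent_bound_uniform_blocks:
  fixes V :: "'v set"
  assumes V: "finite V" "card V \<ge> 2" and q: "q \<ge> 2" and m: "m \<ge> 1"
    and deg: "diagonal_degeneration V (edge_words V m) \<Psi>"
    and sub: "\<Psi>' \<subseteq> \<Psi>" and ne: "\<Psi>' \<noteq> {}" and type: "\<And>x. x \<in> \<Psi>' \<Longrightarrow> mset (edge_list V m x) = X"
  shows "exponent_per_edge V (complete_edges V) * (real m * log 2 (real q))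
           \<le> real m * log 2 (real q + 2) - log 2 (real (card \<Psi>'))"
proof -
  let ?E = "complete_edges V"
  define \<omega> where "\<omega> = exponent (graph_tensor 2 V ?E)"
  have V0: "V \<noteq> {}" using V by auto
  have \<Psi>: "\<Psi> \<subseteq> edge_words V m" using deg by (simp add: diagonal_degeneration_def)
  have fin\<Psi>: "finite \<Psi>'" using card_diagonal_le[OF V0 deg] sub finite_subset by blast
  define r where "r = card \<Psi>'"
  have r1: "r \<ge> 1" using ne fin\<Psi> by (simp add: r_def Suc_le_eq card_gt_0_iff)
  have "card \<Psi>' \<le> card \<Psi>" using card_diagonal_le[OF V0 deg] sub by (intro card_mono)
  hence r2: "r \<le> 2 ^ m" using card_diagonal_le[OF V0 deg] by (simp add: r_def)
  obtain x0 where x0: "x0 \<in> \<Psi>'" using ne by blast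
  define e where "e p = edge_list V m x0 ! p" for p
  have eE: "e p \<in> ?E" if "p < m" for p
  proof -
    have "x0 \<in> edge_words V m" using x0 sub \<Psi> by blast
    moreover have "e p \<in> set (edge_list V m x0)" using that by (simp add: e_def edge_list_def)
    ultimately show ?thesis using set_edge_list by blast
  qed
  have "\<exists>\<beta>. \<beta> permutes {..<m} \<and> permute_list \<beta> (edge_list V m x0) = edge_list V m x" if "x \<in> \<Psi>'" for x
  proof -
    have "mset (edge_list V m x) = mset (edge_list V m x0)" using type that x0 by simp
    then obtain p where "p permutes {..<length (edge_list V m x0)}"
        "permute_list p (edge_list V m x0) = edge_list V m x"
      by (rule mset_eq_permutation)
    thus ?thesis by (auto simp: edge_list_def)
  qed
  then obtain \<beta> where \<beta>: "\<And>x. x \<in> \<Psi>' \<Longrightarrow> \<beta> x permutes {..<m}"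
      "\<And>x. x \<in> \<Psi>' \<Longrightarrow> permute_list (\<beta> x) (edge_list V m x0) = edge_list V m x"
    by metis
  have bij: "bij_betw (\<beta> x) {..<m} {..<m}" if "x \<in> \<Psi>'" for x
    by (rule permutes_imp_bij[OF \<beta>(1)[OF that]])
  have edge: "{v\<in>V. x v ! j = 1} = e (\<beta> x j)" if x: "x \<in> \<Psi>'" and j: "j < m" for x j
  proof -
    have len: "length (edge_list V m x0) = m" by (simp add: edge_list_def)
    have "{v\<in>V. x v ! j = 1} = edge_list V m x ! j" using j by (simp add: edge_list_def)
    also have "\<dots> = permute_list (\<beta> x) (edge_list V m x0) ! j" by (simp only: \<beta>(2)[OF x])
    also have "\<dots> = e (\<beta> x j)"
      unfolding e_def by (rule permute_list_nth) (use \<beta>(1)[OF x] j len in simp_all)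
    finally show ?thesis .
  qed
  obtain A where A: "\<And>M. rank_le V
      (\<lambda>v. PiE {..<M} (\<lambda>_. \<Psi>') \<times> Pi ({..<M} \<times> {..<m}) (\<lambda>_. {1..q}))
      ((M * A + 1) * ((M * m * (2 * card V) + 1) * (q + 2) ^ (M * m)))
      (labelled V (multigraph_tensor ({..<M} \<times> {..<m}) (\<lambda>p. e (snd p))))"
    using rank_labelled_multigraph[OF V(1) V0 deg sub bij edge] by blast
  define E where "E = card ?E"
  have E1: "E \<ge> 1"
  proof -
    have "e 0 \<in> ?E" using eE m by simp
    thus ?thesis using finite_complete_edges[OF V(1)] by (auto simp: E_def Suc_le_eq card_gt_0_iff)
  qed
  \<comment> \<open>both polynomial overheads are at most \<open>M * K\<close>\<close>
  define K where "K = A + m * (2 * card V) + 1"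
  have growth: "\<omega> * (real m * log 2 (real q)) * real M
      \<le> real E * (real m * log 2 (real q + 2) - log 2 (real r)) * real M
         + 2 * real E / ln 2 * ln (real M) + real E * (1 + 2 * log 2 (real K))" if M: "M \<ge> 1" for M :: nat
  proof -
    define Q where "Q = (M * A + 1) * ((M * m * (2 * card V) + 1) * (q + 2) ^ (M * m))"
    \<comment> \<open>the rank per label: the least number with \<open>Q < r ^ M * s\<close>\<close>
    define s where "s = Q div r ^ M + 1"
    let ?P = "{..<M} \<times> {..<m}"
    let ?f = "multigraph_tensor ?P (\<lambda>p. e (snd p))"
    define L where "L = PiE {..<M} (\<lambda>_. \<Psi>')"
    have L: "finite L" "card L = r ^ M" "L \<noteq> {}"
      using fin\<Psi> ne by (auto simp: L_def card_PiE r_def PiE_eq_empty_iff intro!: finite_PiE)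
    have rM: "r ^ M \<ge> 1" using r1 by simp
    have "Q \<le> card L * s"
      unfolding s_def L(2) using rM
      by (metis add_mult_distrib2 div_mult_mod_eq dual_order.order_iff_strict less_le_trans mod_less_divisor
          mult.commute mult.right_neutral nat_add_left_cancel_le zero_less_one)
    from rank_le_mono[OF V(1) V0 A[of M, folded Q_def L_def] this]
    have lab: "rank_le V (\<lambda>v. L \<times> Pi ?P (\<lambda>_. {1..q})) (card L * s) (labelled V ?f)" .
    have s_le: "real s \<le> 2 * (real Q / real r ^ M)"
    proof -
      have "r ^ M \<le> Q"
      proof -
        have "r ^ M \<le> (2 ^ m) ^ M" by (rule power_mono[OF r2]) simp
        also have "\<dots> = 2 ^ (M * m)" by (simp add: power_mult[symmetric] mult.commute)
        also have "\<dots> \<le> (q + 2) ^ (M * m)" by (rule power_mono) auto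
        also have "\<dots> \<le> Q" by (simp add: Q_def)
        finally show ?thesis .
      qed
      hence "1 \<le> real Q / real r ^ M" using rM r1 by (simp add: le_divide_eq_1_pos flip: of_nat_power)
      moreover have "real (Q div r ^ M) \<le> real Q / real r ^ M"
        using of_nat_div_le_of_nat[of Q "r ^ M", where ?'a=real] by simp
      ultimately show ?thesis by (simp add: s_def)
    qed
    have s1: "s \<ge> 1" by (simp add: s_def)
    have lin: "\<omega> * (fact (card V) * (real M * real m) * log 2 (real q)) * real n
        \<le> fact (card V) * real E * log 2 (real s) * real n + 0 * ln (real n)
           + (fact (card V) * log 2 (real r ^ M) + 1 + \<omega>)" if n: "n \<ge> 1" for n :: nat
    proof -
      \<comment> \<open>powers that are multiples of \<open>E\<close> make the symmetrized multiplicity \<open>?c\<close> an integer\<close>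
      let ?N = "{..<E * n}"
      have "rank_le V (\<lambda>v. Pi ?N (\<lambda>_. Pi ?P (\<lambda>_. {1..q}))) (card L * s ^ card ?N)
          (\<lambda>x. \<Prod>i\<in>?N. ?f (\<lambda>v. x v i))"
        by (rule rank_le_power_of_labelled[OF V(1) V0 L(1,3) lab]) simp
      hence rank: "rank_le V (\<lambda>v. Pi (?N \<times> ?P) (\<lambda>_. {1..q})) (card L * s ^ card ?N)
          (multigraph_tensor (?N \<times> ?P) (\<lambda>p. e (snd (snd p))))"
      proof (rule rank_le_pullback[where h="\<lambda>v y i p. y (i, p)"])
        fix x :: "'v \<Rightarrow> nat \<times> nat \<times> nat \<Rightarrow> nat"
        have "multigraph_tensor (?N \<times> ?P) (\<lambda>p. e (snd (snd p))) x
            = of_bool (\<forall>i\<in>?N. \<forall>p\<in>?P. \<forall>u\<in>e (snd p). \<forall>v\<in>e (snd p). x u (i, p) = x v (i, p))"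
          unfolding multigraph_tensor_def by (simp only: split_paired_Ball_Sigma snd_conv)
        also have "\<dots> = (\<Prod>i\<in>?N. of_bool (\<forall>p\<in>?P. \<forall>u\<in>e (snd p). \<forall>v\<in>e (snd p). x u (i, p) = x v (i, p)))"
          by (rule prod_of_bool[symmetric]) simp
        finally show "multigraph_tensor (?N \<times> ?P) (\<lambda>p. e (snd (snd p))) x
            = (\<Prod>i\<in>?N. ?f (\<lambda>v p. x v (i, p)))"
          unfolding multigraph_tensor_def .
      qed auto
      let ?c = "fact (card V) * (n * (M * m))"
      have c: "?c * card ?E = fact (card V) * card (?N \<times> ?P)"
        by (simp add: E_def card_cartesian_product algebra_simps)
      have "\<omega> * (real ?c * log 2 (real q) - 1)
          \<le> fact (card V) * log 2 (real (card L * s ^ card ?N)) + 1"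
        unfolding \<omega>_def
        by (rule exponent_le_of_rank[OF V _ _ q _ rank c])
          (use n M m E1 L(2) rM s1 eE in \<open>auto simp: Suc_le_eq lessThan_empty_iff\<close>)
      also have "log 2 (real (card L * s ^ card ?N)) = log 2 (real r ^ M) + real (E * n) * log 2 (real s)"
        using r1 s1 by (simp add: L(2) log_mult log_nat_power)
      finally show ?thesis by (simp add: algebra_simps)
    qed
    have "\<omega> * (fact (card V) * (real M * real m) * log 2 (real q))
        \<le> fact (card V) * real E * log 2 (real s)"
      by (rule le_of_linear_growth[OF lin])
    hence "fact (card V) * (\<omega> * (real M * real m) * log 2 (real q))
        \<le> fact (card V) * (real E * log 2 (real s))"
      by (simp only: mult_ac)
    hence "\<omega> * (real M * real m) * log 2 (real q) \<le> real E * log 2 (real s)"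
      by (rule mult_left_le_imp_le) simp
    also have "\<dots> \<le> real E * (1 + 2 * log 2 (real K) + 2 * log 2 (real M)
        + real M * (real m * log 2 (real q + 2) - log 2 (real r)))"
    proof (rule mult_left_mono)
      have "M * A + 1 \<le> M * K" "M * m * (2 * card V) + 1 \<le> M * K"
        using M by (simp_all add: K_def algebra_simps)
      hence "(M * A + 1) * (M * m * (2 * card V) + 1) \<le> (M * K) * (M * K)"
        by (rule mult_mono) auto
      hence "(M * A + 1) * (M * m * (2 * card V) + 1) * (q + 2) ^ (M * m) \<le> (M * K) * (M * K) * (q + 2) ^ (M * m)"
        by (rule mult_right_mono) simp
      hence "Q \<le> (M * K)^2 * (q + 2) ^ (M * m)"
        by (simp only: Q_def mult.assoc power2_eq_square)
      hence "real Q \<le> real ((M * K)^2 * (q + 2) ^ (M * m))" by (simp only: of_nat_le_iff)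
      hence QK: "real Q \<le> (real M * real K)^2 * (real q + 2) ^ (M * m)"
        by (simp add: add.commute)
      have K1: "K \<ge> 1" by (simp add: K_def)
      have "real s \<le> 2 * (real M * real K)^2 * (real q + 2) ^ (M * m) / real r ^ M"
        using s_le divide_right_mono[OF QK, of "real r ^ M"] by simp
      hence "log 2 (real s) \<le> log 2 (2 * (real M * real K)^2 * (real q + 2) ^ (M * m) / real r ^ M)"
        using s1 by (subst log_le_cancel_iff) auto
      also have "\<dots> = 1 + 2 * (log 2 (real M) + log 2 (real K)) + real (M * m) * log 2 (real q + 2)
          - real M * log 2 (real r)"
        using M K1 r1 by (simp add: log_mult log_divide log_nat_power)
      finally show "log 2 (real s) \<le> 1 + 2 * log 2 (real K) + 2 * log 2 (real M)
        + real M * (real m * log 2 (real q + 2) - log 2 (real r))"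
        by (simp add: algebra_simps)
    qed simp
    finally show ?thesis using M by (simp add: algebra_simps log_def add_divide_distrib)
  qed
  have "\<omega> * (real m * log 2 (real q)) \<le> real E * (real m * log 2 (real q + 2) - log 2 (real r))"
    by (rule le_of_linear_growth[OF growth])
  thus ?thesis using E1
    by (simp add: exponent_per_edge_def \<omega>_def[symmetric] E_def[symmetric] r_def[symmetric] field_simps)
qed

text \<open>
  There are at most \<open>(m + 1) ^ card E\<close> multisets of \<open>m\<close> edges, so a fixed type of block loses
  only a polynomial factor.
\<close>

lemma large_uniform_block_set:
  assumes V: "finite V" and \<Psi>: "\<Psi> \<subseteq> edge_words V m" "\<Psi> \<noteq> {}"
  obtains \<Psi>' X where "\<Psi>' \<subseteq> \<Psi>" "\<Psi>' \<noteq> {}" "\<And>x. x \<in> \<Psi>' \<Longrightarrow> mset (edge_list V m x) = X"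
    "card \<Psi> \<le> (m + 1) ^ card (complete_edges V) * card \<Psi>'"
proof -
  let ?E = "complete_edges V"
  define type where "type x = mset (edge_list V m x)" for x
  define T where "T = type ` \<Psi>"
  have fin: "finite \<Psi>" using \<Psi>(1) finite_edge_words[OF V] finite_subset by blast
  have finT: "finite T" "T \<noteq> {}" using fin \<Psi>(2) by (simp_all add: T_def)
  have "card T \<le> card (PiE ?E (\<lambda>_. {..m}))"
  proof (rule card_inj_on_le)
    show "inj_on (\<lambda>X. restrict (count X) ?E) T"
    proof (rule inj_onI)
      fix X Y assume XY: "X \<in> T" "Y \<in> T" and eq: "restrict (count X) ?E = restrict (count Y) ?E"
      have set: "set_mset Z \<subseteq> ?E" if Z: "Z \<in> T" for Z
      proof -
        obtain x where x: "x \<in> \<Psi>" "Z = mset (edge_list V m x)" using Z by (auto simp: T_def type_def)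
        have "x \<in> edge_words V m" using x(1) \<Psi>(1) by blast
        from set_edge_list[OF this] show ?thesis by (simp add: x(2))
      qed
      show "X = Y"
      proof (rule multiset_eqI)
        fix d
        show "count X d = count Y d"
        proof (cases "d \<in> ?E")
          case True thus ?thesis using fun_cong[OF eq, of d] by simp
        next
          case False
          hence "d \<notin># X" "d \<notin># Y" using set XY by blast+
          thus ?thesis by (simp add: not_in_iff)
        qed
      qed
    qed
    have "count Z d \<le> m" if "Z \<in> T" for Z d
      using that by (auto simp: T_def type_def edge_list_def intro: order_trans[OF count_le_size])
    thus "(\<lambda>X. restrict (count X) ?E) ` T \<subseteq> PiE ?E (\<lambda>_. {..m})" by auto
    show "finite (PiE ?E (\<lambda>_. {..m}))" using finite_complete_edges[OF V] by (intro finite_PiE) auto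
  qed
  hence cardT: "card T \<le> (m + 1) ^ card ?E" using finite_complete_edges[OF V] by (simp add: card_PiE)
  define f where "f Y = card {x\<in>\<Psi>. type x = Y}" for Y
  have "Max (f ` T) \<in> f ` T" using finT by (intro Max_in) auto
  then obtain X where X: "X \<in> T" and X_max: "Max (f ` T) = f X" by (rule imageE)
  have max: "f Y \<le> f X" if "Y \<in> T" for Y
  proof -
    have "f Y \<le> Max (f ` T)" using finT that by (intro Max_ge) auto
    thus ?thesis by (simp only: X_max)
  qed
  show ?thesis
  proof (rule that[of "{x\<in>\<Psi>. type x = X}" X])
    have "card \<Psi> = card (\<Union>Y\<in>T. {x\<in>\<Psi>. type x = Y})"
      by (rule arg_cong[of _ _ card]) (auto simp: T_def)
    also have "\<dots> = (\<Sum>Y\<in>T. card {x\<in>\<Psi>. type x = Y})"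
      by (rule card_UN_disjoint) (use finT fin in auto)
    also have "\<dots> \<le> (\<Sum>Y\<in>T. card {x\<in>\<Psi>. type x = X})" by (rule sum_mono) (rule max[unfolded f_def])
    also have "\<dots> \<le> (m + 1) ^ card ?E * card {x\<in>\<Psi>. type x = X}" using cardT by simp
    finally show "card \<Psi> \<le> (m + 1) ^ card ?E * card {x\<in>\<Psi>. type x = X}" .
  qed (use X in \<open>auto simp: T_def type_def\<close>)
qed

lemma exponent_bound_diagonal:
  assumes V: "finite V" "card V \<ge> 2" and q: "q \<ge> 2" and m: "m \<ge> 1"
    and deg: "diagonal_degeneration V (edge_words V m) \<Psi>" and ne: "\<Psi> \<noteq> {}"
  shows "exponent_per_edge V (complete_edges V) * (real m * log 2 (real q))
           \<le> real m * log 2 (real q + 2) - log 2 (real (card \<Psi>))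
              + real (card (complete_edges V)) * log 2 (real m + 1)"
proof -
  have V0: "V \<noteq> {}" using V by auto
  have \<Psi>: "\<Psi> \<subseteq> edge_words V m" using deg by (simp add: diagonal_degeneration_def)
  obtain \<Psi>' X where \<Psi>': "\<Psi>' \<subseteq> \<Psi>" "\<Psi>' \<noteq> {}" "\<And>x. x \<in> \<Psi>' \<Longrightarrow> mset (edge_list V m x) = X"
    "card \<Psi> \<le> (m + 1) ^ card (complete_edges V) * card \<Psi>'"
    using large_uniform_block_set[OF V(1) \<Psi> ne] by blast
  have fin: "finite \<Psi>" by (rule card_diagonal_le(1)[OF V0 deg])
  have pos: "card \<Psi> > 0" "card \<Psi>' > 0"
    using ne \<Psi>' fin finite_subset[OF \<Psi>'(1) fin] by (simp_all add: card_gt_0_iff)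
  have "real (card \<Psi>) \<le> real ((m + 1) ^ card (complete_edges V) * card \<Psi>')"
    using \<Psi>'(4) by (simp only: of_nat_le_iff)
  hence "real (card \<Psi>) \<le> (real m + 1) ^ card (complete_edges V) * real (card \<Psi>')"
    by (simp add: add.commute)
  hence "log 2 (real (card \<Psi>)) \<le> log 2 ((real m + 1) ^ card (complete_edges V) * real (card \<Psi>'))"
    using pos by (subst log_le_cancel_iff) auto
  also have "\<dots> = real (card (complete_edges V)) * log 2 (real m + 1) + log 2 (real (card \<Psi>'))"
    using pos by (simp add: log_mult log_nat_power)
  finally show ?thesis
    using exponent_bound_uniform_blocks[OF V q m deg \<Psi>'(1,2,3)] by linarith
qed

text \<open>A single block suffices for the bound without the gain from the subexponent.\<close>

lemma exponent_bound_trivial: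
  assumes V: "finite V" "card V \<ge> 2" and q: "q \<ge> 2"
  shows "exponent_per_edge V (complete_edges V) * log 2 (real q) \<le> log 2 (real q + 2)"
proof -
  obtain d where d: "d \<subseteq> V" "card d = 2" using obtain_subset_with_card_n[OF V(2)] by blast
  define x where "x = (\<lambda>v\<in>V. [if v \<in> d then 1 else 2::nat])"
  have "{v\<in>V. x v ! 0 = 1} = d" using d by (auto simp: x_def)
  hence x: "x \<in> edge_words V 1" using d by (auto simp: edge_words_def words_def x_def)
  have "diagonal_degeneration V (edge_words V 1) {x}"
    unfolding diagonal_degeneration_def
  proof (intro conjI exI[of _ "\<lambda>v w. of_bool (w \<noteq> x v)"])
    show "\<forall>y\<in>edge_words V 1 - {x}. (\<Sum>v\<in>V. of_bool (y v \<noteq> x v)) > (0::int)"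
    proof
      fix y assume y: "y \<in> edge_words V 1 - {x}"
      have "\<exists>v\<in>V. y v \<noteq> x v"
      proof (rule ccontr)
        assume "\<not> ?thesis"
        hence "y = x" using x y by (intro PiE_ext[of y V "\<lambda>_. words 1"]) (auto simp: edge_words_def)
        thus False using y by simp
      qed
      then obtain v where "v \<in> V" "y v \<noteq> x v" by blast
      thus "(\<Sum>v\<in>V. of_bool (y v \<noteq> x v)) > (0::int)" using V(1) by (intro sum_pos2[of V v]) auto
    qed
  qed (use x in auto)
  from exponent_bound_uniform_blocks[OF V q order_refl this order_refl]
  show ?thesis by simp
qed

section \<open>A theorem of the alternative\<close>

text \<open>
  Homogeneous linear inequalities, written as pairs of a coefficient vector and a flag that tells
  whether the inequality is strict. The set below collects their consequences by positive
  combinations.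
\<close>

inductive_set consequences ::
    "(('i \<Rightarrow> rat) \<times> bool) set \<Rightarrow> (('i \<Rightarrow> rat) \<times> bool) set" for C where
  base: "c \<in> C \<Longrightarrow> c \<in> consequences C"
| add: "(a, s) \<in> consequences C \<Longrightarrow> (b, t) \<in> consequences C \<Longrightarrow>
    (\<lambda>i. a i + b i, s \<or> t) \<in> consequences C"
| scale: "(a, s) \<in> consequences C \<Longrightarrow> l > 0 \<Longrightarrow> (\<lambda>i. l * a i, s) \<in> consequences C"

definition satisfies :: "'i set \<Rightarrow> ('i \<Rightarrow> rat) \<Rightarrow> ('i \<Rightarrow> rat) \<times> bool \<Rightarrow> bool" where
  "satisfies I x = (\<lambda>(a, s). (\<Sum>i\<in>I. a i * x i) \<ge> 0 \<and> (s \<longrightarrow> (\<Sum>i\<in>I. a i * x i) > 0))"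

lemma between_bounds:
  fixes f :: "'a \<Rightarrow> rat"
  assumes fin: "finite P" "finite N"
    and le: "\<And>p n. p \<in> P \<Longrightarrow> n \<in> N \<Longrightarrow> f p \<le> f n"
    and less: "\<And>p n. p \<in> P \<Longrightarrow> n \<in> N \<Longrightarrow> s p \<or> s n \<Longrightarrow> f p < f n"
  obtains y where "\<And>p. p \<in> P \<Longrightarrow> f p \<le> y" "\<And>p. p \<in> P \<Longrightarrow> s p \<Longrightarrow> f p < y"
    "\<And>n. n \<in> N \<Longrightarrow> y \<le> f n" "\<And>n. n \<in> N \<Longrightarrow> s n \<Longrightarrow> y < f n"
proof -
  consider "P = {}" "N = {}" | "P = {}" "N \<noteq> {}" | "P \<noteq> {}" "N = {}" | "P \<noteq> {}" "N \<noteq> {}" by blast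
  thus ?thesis
  proof cases
    case 1
    thus ?thesis using that[of 0] by simp
  next
    case 2
    have "Min (f ` N) - 1 < f n" if "n \<in> N" for n
    proof -
      have "Min (f ` N) \<le> f n" using fin that by (intro Min_le) auto
      thus ?thesis by linarith
    qed
    thus ?thesis using 2 that[of "Min (f ` N) - 1"] by (simp add: order.strict_implies_order)
  next
    case 3
    have "f p < Max (f ` P) + 1" if "p \<in> P" for p
    proof -
      have "f p \<le> Max (f ` P)" using fin that by (intro Max_ge) auto
      thus ?thesis by linarith
    qed
    thus ?thesis using 3 that[of "Max (f ` P) + 1"] by (simp add: order.strict_implies_order)
  next
    case 4
    have "Max (f ` P) \<in> f ` P" "Min (f ` N) \<in> f ` N" using fin 4 by (auto intro!: Max_in Min_in)
    then obtain p0 n0 where p0: "p0 \<in> P" "Max (f ` P) = f p0" and n0: "n0 \<in> N" "Min (f ` N) = f n0"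
      by blast
    have P: "f p \<le> f p0" if "p \<in> P" for p
      unfolding p0(2)[symmetric] using fin that by (intro Max_ge) auto
    have N: "f n0 \<le> f n" if "n \<in> N" for n
      unfolding n0(2)[symmetric] using fin that by (intro Min_le) auto
    show ?thesis
    proof (cases "f p0 < f n0")
      case True
      then obtain y where y: "f p0 < y" "y < f n0" using dense by blast
      show ?thesis
        by (rule that[of y]) (use y P N in \<open>force+\<close>)
    next
      case False
      hence eq: "f n0 = f p0" using le[OF p0(1) n0(1)] by simp
      show ?thesis
      proof (rule that[of "f p0"])
        fix p assume p: "p \<in> P"
        show "f p \<le> f p0" by (rule P[OF p])
        show "f p < f p0" if "s p" using less[OF p n0(1)] that eq by simp
      next
        fix n assume n: "n \<in> N"
        show "f p0 \<le> f n" by (rule le[OF p0(1) n])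
        show "f p0 < f n" if "s n" using less[OF p0(1) n] that by simp
      qed
    qed
  qed
qed

text \<open>
  Fourier-Motzkin elimination of one variable \<open>j\<close>: every inequality with positive coefficient of
  \<open>j\<close> is combined with every one with negative coefficient.
\<close>

lemma solution_or_contradiction:
  assumes "finite I" "finite C"
  shows "(\<exists>x. \<forall>c\<in>C. satisfies I x c) \<or> (\<exists>a. (a, True) \<in> consequences C \<and> (\<forall>i\<in>I. a i = 0))"
  using assms
proof (induction I arbitrary: C rule: finite_induct)
  case empty
  show ?case
  proof (cases "\<exists>a. (a, True) \<in> C")
    case True
    thus ?thesis using consequences.base by fastforce
  next
    case False
    thus ?thesis by (auto simp: satisfies_def)
  qed
next
  case (insert j I)
  define comb :: "(('a \<Rightarrow> rat) \<times> bool) \<times> (('a \<Rightarrow> rat) \<times> bool) \<Rightarrow> ('a \<Rightarrow> rat) \<times> bool"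
    where "comb = (\<lambda>((a, s), (b, t)). (\<lambda>i. - b j * a i + a j * b i, s \<or> t))"
  define Z where "Z = {c \<in> C. fst c j = 0}"
  define P where "P = {c \<in> C. fst c j > 0}"
  define N where "N = {c \<in> C. fst c j < 0}"
  define C' where "C' = Z \<union> comb ` (P \<times> N)"
  have C: "C = Z \<union> P \<union> N" by (auto simp: Z_def P_def N_def)
  have fin: "finite Z" "finite P" "finite N" "finite C'"
    using insert.prems by (auto simp: Z_def P_def N_def C'_def)
  have comb_in: "comb (c, d) \<in> consequences C" if "c \<in> P" "d \<in> N" for c d
  proof -
    obtain a s b t where cd: "c = (a, s)" "d = (b, t)" by fastforce
    have "(\<lambda>i. - b j * a i, s) \<in> consequences C"
      by (rule consequences.scale[OF consequences.base]) (use that cd in \<open>auto simp: P_def N_def\<close>)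
    moreover have "(\<lambda>i. a j * b i, t) \<in> consequences C"
      by (rule consequences.scale[OF consequences.base]) (use that cd in \<open>auto simp: P_def N_def\<close>)
    ultimately have "(\<lambda>i. - b j * a i + a j * b i, s \<or> t) \<in> consequences C"
      by (rule consequences.add)
    thus ?thesis by (simp add: comb_def cd)
  qed
  have C'_sub: "C' \<subseteq> consequences C"
    using comb_in by (auto simp: C'_def Z_def intro: consequences.base)
  have sub: "c \<in> consequences C \<and> fst c j = 0" if "c \<in> consequences C'" for c
    using that
  proof induction
    case (base c)
    have "fst c j = 0" using base by (auto simp: C'_def Z_def comb_def)
    thus ?case using base C'_sub by auto
  qed (auto intro: consequences.intros)
  from insert.IH[OF fin(4)] show ?case
  proof
    assume "\<exists>a. (a, True) \<in> consequences C' \<and> (\<forall>i\<in>I. a i = 0)"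
    then obtain a where a: "(a, True) \<in> consequences C'" "\<forall>i\<in>I. a i = 0" by blast
    have "(a, True) \<in> consequences C" "a j = 0" using sub[OF a(1)] by simp_all
    thus ?thesis using a(2) by (intro disjI2 exI[of _ a]) simp
  next
    assume "\<exists>x. \<forall>c\<in>C'. satisfies I x c"
    then obtain x where x: "\<And>c. c \<in> C' \<Longrightarrow> satisfies I x c" by blast
    define v where "v c = (\<Sum>i\<in>I. fst c i * x i)" for c :: "('a \<Rightarrow> rat) \<times> bool"
    define f where "f c = - v c / fst c j" for c
    have v_comb: "v (comb (c, d)) = - fst d j * v c + fst c j * v d" for c d
      by (simp add: v_def comb_def split_beta algebra_simps sum.distrib sum_distrib_left sum_subtractf sum_negf)
    have cross: "- fst d j * v c + fst c j * v d \<ge> 0"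
      "snd c \<or> snd d \<Longrightarrow> - fst d j * v c + fst c j * v d > 0" if cd: "c \<in> P" "d \<in> N" for c d
    proof -
      have "satisfies I x (comb (c, d))" by (rule x) (use cd in \<open>auto simp: C'_def\<close>)
      moreover have "snd (comb (c, d)) = (snd c \<or> snd d)" by (simp add: comb_def split_beta)
      ultimately have "v (comb (c, d)) \<ge> 0" "snd c \<or> snd d \<Longrightarrow> v (comb (c, d)) > 0"
        by (simp_all add: satisfies_def v_def split_beta)
      thus "- fst d j * v c + fst c j * v d \<ge> 0"
        "snd c \<or> snd d \<Longrightarrow> - fst d j * v c + fst c j * v d > 0" by (simp_all only: v_comb)
    qed
    have le: "f c \<le> f d" if "c \<in> P" "d \<in> N" for c d
      using cross(1)[OF that] that by (simp add: f_def P_def N_def field_simps)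
    have less: "f c < f d" if "c \<in> P" "d \<in> N" "snd c \<or> snd d" for c d
      using cross(2)[OF that] that by (simp add: f_def P_def N_def field_simps)
    obtain y where y: "\<And>c. c \<in> P \<Longrightarrow> f c \<le> y" "\<And>c. c \<in> P \<Longrightarrow> snd c \<Longrightarrow> f c < y"
        "\<And>c. c \<in> N \<Longrightarrow> y \<le> f c" "\<And>c. c \<in> N \<Longrightarrow> snd c \<Longrightarrow> y < f c"
      using between_bounds[OF fin(2,3), of f snd] le less by blast
    define x' where "x' = x(j := y)"
    have sum: "(\<Sum>i\<in>insert j I. fst c i * x' i) = fst c j * y + v c" for c
    proof -
      have "(\<Sum>i\<in>I. fst c i * x' i) = v c"
        unfolding v_def by (rule sum.cong) (use insert.hyps in \<open>auto simp: x'_def\<close>)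
      thus ?thesis using insert.hyps by (simp add: x'_def)
    qed
    have "satisfies (insert j I) x' c" if c: "c \<in> C" for c
    proof -
      have "fst c j * y + v c \<ge> 0 \<and> (snd c \<longrightarrow> fst c j * y + v c > 0)"
      proof -
        consider "c \<in> Z" | "c \<in> P" | "c \<in> N" using c C by blast
        thus ?thesis
        proof cases
          case 1
          have "satisfies I x c" by (rule x) (use 1 in \<open>simp add: C'_def\<close>)
          thus ?thesis using 1 by (simp add: satisfies_def v_def Z_def split_beta)
        next
          case 2
          thus ?thesis using y(1,2)[OF 2] by (auto simp: f_def P_def field_simps)
        next
          case 3
          thus ?thesis using y(3,4)[OF 3] by (auto simp: f_def N_def field_simps)
        qed
      qed
      thus ?thesis unfolding satisfies_def split_beta sum .
    qed
    thus ?thesis by blast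
  qed
qed

section \<open>Monomial degeneration to unit tensors\<close>

lemma polynomial_functions_prod_power:
  assumes "finite S" "S \<subseteq> I"
  shows "(\<lambda>z. \<Prod>x\<in>S. z x ^ m x) \<in> polynomial_functions I"
  using assms
proof (induction S)
  case empty
  show ?case by (simp add: polynomial_functions.const)
next
  case (insert x S)
  have "(\<lambda>z. z x ^ k) \<in> polynomial_functions I" for k
    using insert.prems
    by (induction k) (auto intro: polynomial_functions.intros)
  from polynomial_functions.mult[OF this insert.IH] insert show ?case by simp
qed

lemma polynomial_functions_diff:
  assumes "p \<in> polynomial_functions I" "q \<in> polynomial_functions I"
  shows "(\<lambda>z. p z - q z) \<in> polynomial_functions I"
  using polynomial_functions.add[OF assms(1) polynomial_functions.mult[OF polynomial_functions.const[of "-1"] assms(2)]]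
  by simp

lemma polynomial_functions_prod:
  assumes "finite S" "\<And>s. s \<in> S \<Longrightarrow> p s \<in> polynomial_functions I"
  shows "(\<lambda>z. \<Prod>s\<in>S. p s z) \<in> polynomial_functions I"
  using assms
  by (induction S) (auto intro: polynomial_functions.intros)

lemma polynomial_functions_tendsto:
  assumes "p \<in> polynomial_functions I" "\<And>i. i \<in> I \<Longrightarrow> (\<lambda>n::nat. z n i) \<longlonglongrightarrow> w i"
  shows "(\<lambda>n. p (z n)) \<longlonglongrightarrow> p w"
  using assms(1)
  by induction (auto intro!: tendsto_intros assms(2))

lemma common_denominator:
  fixes x :: "'i \<Rightarrow> rat"
  assumes "finite I"
  obtains N :: nat and y :: "'i \<Rightarrow> int" where "N > 0" "\<And>i. i \<in> I \<Longrightarrow> of_int (y i) = of_nat N * x i"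
proof -
  define d where "d i = snd (quotient_of (x i))" for i
  define N where "N = nat (\<Prod>i\<in>I. d i)"
  have d: "d i > 0" for i by (simp add: d_def quotient_of_denom_pos')
  have N: "int N = (\<Prod>i\<in>I. d i)" "N > 0"
    using d prod_pos[of I d] by (simp_all add: N_def less_imp_le)
  show ?thesis
  proof (rule that[of N "\<lambda>i. \<lfloor>of_nat N * x i\<rfloor>"])
    fix i assume i: "i \<in> I"
    have xi: "x i = of_int (fst (quotient_of (x i))) / of_int (d i)"
      unfolding d_def by (rule quotient_of_div) simp
    have "(of_nat N :: rat) = of_int (\<Prod>i\<in>I. d i)" using N(1) by (metis of_int_of_nat_eq)
    also have "(\<Prod>i\<in>I. d i) = d i * (\<Prod>i\<in>I - {i}. d i)" by (rule prod.remove[OF assms i])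
    finally have eq: "of_nat N * x i = of_int ((\<Prod>i\<in>I - {i}. d i) * fst (quotient_of (x i)))"
      using d[of i] by (subst xi) simp
    show "of_int \<lfloor>of_nat N * x i\<rfloor> = of_nat N * x i" unfolding eq floor_of_int ..
  qed (rule N(2))
qed

text \<open>
  The linear system for the weights of a degeneration of \<open>\<Phi>\<close> to \<open>\<Psi>\<close>. A tuple is encoded by the
  indicator of its entries, and each equation for a tuple of \<open>\<Psi>\<close> by two weak inequalities.
\<close>

definition weight_inequalities ::
    "('v \<Rightarrow> 'j) set \<Rightarrow> ('v \<Rightarrow> 'j) set \<Rightarrow> ((('v \<times> 'j) \<Rightarrow> rat) \<times> bool) set" where
  "weight_inequalities \<Phi> \<Psi> =
     (\<lambda>x. (\<lambda>(v, b). of_bool (x v = b), x \<notin> \<Psi>)) ` \<Phi> \<union>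
     (\<lambda>x. (\<lambda>(v, b). - of_bool (x v = b), False)) ` \<Psi>"

text \<open>
  Clearing denominators turns a positive combination of the inequalities into a difference of two
  sums of tuples. Only inequalities of tuples of \<open>\<Psi>\<close> occur with a negative sign, which is what makes
  the two monomials of the binomial below behave differently at \<open>\<Psi>\<close>.
\<close>

lemma consequence_of_weight_inequalities:
  assumes fin: "finite \<Phi>" and sub: "\<Psi> \<subseteq> \<Phi>" and c: "c \<in> consequences (weight_inequalities \<Phi> \<Psi>)"
  shows "\<exists>(N::nat) (m :: ('v \<Rightarrow> 'j) \<Rightarrow> nat) m'. N > 0 \<and>
    (\<forall>v b. of_nat N * fst c (v, b) = (\<Sum>x\<in>\<Phi>. (of_nat (m x) - of_nat (m' x)) * of_bool (x v = b))) \<and>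
    (\<forall>x. x \<notin> \<Psi> \<longrightarrow> m' x = 0) \<and> (snd c \<longrightarrow> (\<exists>x\<in>\<Phi> - \<Psi>. m x > 0))"
  using c
proof induction
  case (base c)
  then consider x where "x \<in> \<Phi>" "c = (\<lambda>(v, b). of_bool (x v = b), x \<notin> \<Psi>)"
    | x where "x \<in> \<Psi>" "c = (\<lambda>(v, b). - of_bool (x v = b), False)"
    unfolding weight_inequalities_def by blast
  thus ?case
  proof cases
    case (1 x)
    have "(\<Sum>y\<in>\<Phi>. (of_nat (of_bool (y = x)) - of_nat 0) * of_bool (y v = b))
        = (\<Sum>y\<in>\<Phi>. if y = x then of_bool (x v = b) else (0::rat))" for v b
      by (rule sum.cong) auto
    hence "of_nat 1 * fst c (v, b) = (\<Sum>y\<in>\<Phi>. (of_nat (of_bool (y = x)) - of_nat 0) * of_bool (y v = b))" for v b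
      using fin 1 by (simp add: sum.delta)
    moreover have "snd c \<longrightarrow> (\<exists>y\<in>\<Phi> - \<Psi>. (of_bool (y = x) :: nat) > 0)" using 1 by auto
    ultimately show ?thesis
      by (intro exI[of _ 1] exI[of _ "\<lambda>y. of_bool (y = x)"] exI[of _ "\<lambda>_. 0"]) auto
  next
    case (2 x)
    have "(\<Sum>y\<in>\<Phi>. (of_nat 0 - of_nat (of_bool (y = x))) * of_bool (y v = b))
        = (\<Sum>y\<in>\<Phi>. if y = x then - of_bool (x v = b) else (0::rat))" for v b
      by (rule sum.cong) auto
    hence "of_nat 1 * fst c (v, b) = (\<Sum>y\<in>\<Phi>. (of_nat 0 - of_nat (of_bool (y = x))) * of_bool (y v = b))" for v b
      using fin 2 sub by (auto simp: sum.delta)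
    moreover have "\<forall>y. y \<notin> \<Psi> \<longrightarrow> (of_bool (y = x) :: nat) = 0" using 2 by auto
    ultimately show ?thesis using 2
      by (intro exI[of _ 1] exI[of _ "\<lambda>_. 0"] exI[of _ "\<lambda>y. of_bool (y = x)"]) auto
  qed
next
  case (add a s b t)
  from add.IH(1) obtain N1 :: nat and m1 m1' :: "('v \<Rightarrow> 'j) \<Rightarrow> nat" where 1: "N1 > 0"
      "\<And>v c. of_nat N1 * a (v, c) = (\<Sum>x\<in>\<Phi>. (of_nat (m1 x) - of_nat (m1' x)) * of_bool (x v = c))"
      "\<And>x. x \<notin> \<Psi> \<Longrightarrow> m1' x = 0" "s \<Longrightarrow> \<exists>x\<in>\<Phi> - \<Psi>. m1 x > 0"
    by (simp only: fst_conv snd_conv) blast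
  from add.IH(2) obtain N2 :: nat and m2 m2' :: "('v \<Rightarrow> 'j) \<Rightarrow> nat" where 2: "N2 > 0"
      "\<And>v c. of_nat N2 * b (v, c) = (\<Sum>x\<in>\<Phi>. (of_nat (m2 x) - of_nat (m2' x)) * of_bool (x v = c))"
      "\<And>x. x \<notin> \<Psi> \<Longrightarrow> m2' x = 0" "t \<Longrightarrow> \<exists>x\<in>\<Phi> - \<Psi>. m2 x > 0"
    by (simp only: fst_conv snd_conv) blast
  show ?case
  proof (rule exI[of _ "N1 * N2"], rule exI[of _ "\<lambda>x. N2 * m1 x + N1 * m2 x"],
      rule exI[of _ "\<lambda>x. N2 * m1' x + N1 * m2' x"], intro conjI allI impI)
    fix v c
    have "of_nat (N1 * N2) * (a (v, c) + b (v, c))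
        = of_nat N2 * (of_nat N1 * a (v, c)) + of_nat N1 * (of_nat N2 * b (v, c))"
      by (simp add: algebra_simps)
    also have "\<dots> = (\<Sum>x\<in>\<Phi>. of_nat N2 * ((of_nat (m1 x) - of_nat (m1' x)) * of_bool (x v = c))
        + of_nat N1 * ((of_nat (m2 x) - of_nat (m2' x)) * of_bool (x v = c)))"
      by (simp only: 1(2) 2(2) sum_distrib_left sum.distrib)
    also have "\<dots> = (\<Sum>x\<in>\<Phi>. (of_nat (N2 * m1 x + N1 * m2 x) - of_nat (N2 * m1' x + N1 * m2' x)) * of_bool (x v = c))"
      by (rule sum.cong) (simp_all add: algebra_simps)
    finally show "of_nat (N1 * N2) * fst (\<lambda>i. a i + b i, s \<or> t) (v, c)
        = (\<Sum>x\<in>\<Phi>. (of_nat (N2 * m1 x + N1 * m2 x) - of_nat (N2 * m1' x + N1 * m2' x)) * of_bool (x v = c))"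
      by simp
  next
    assume "snd (\<lambda>i. a i + b i, s \<or> t)"
    thus "\<exists>x\<in>\<Phi> - \<Psi>. N2 * m1 x + N1 * m2 x > 0" using 1 2 by auto
  qed (use 1 2 in auto)
next
  case (scale a s l)
  from scale.IH obtain N :: nat and m m' :: "('v \<Rightarrow> 'j) \<Rightarrow> nat" where 1: "N > 0"
      "\<And>v c. of_nat N * a (v, c) = (\<Sum>x\<in>\<Phi>. (of_nat (m x) - of_nat (m' x)) * of_bool (x v = c))"
      "\<And>x. x \<notin> \<Psi> \<Longrightarrow> m' x = 0" "s \<Longrightarrow> \<exists>x\<in>\<Phi> - \<Psi>. m x > 0"
    by (simp only: fst_conv snd_conv) blast
  obtain d :: nat and y :: "unit \<Rightarrow> int" where d: "d > 0" "of_int (y ()) = of_nat d * l"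
    using common_denominator[of "{()}" "\<lambda>_. l"] by auto
  define k where "k = nat (y ())"
  have "of_int (y ()) > (0::rat)" using d scale.hyps by simp
  hence k: "k > 0" "of_nat k = of_nat d * l" using d by (simp_all add: k_def)
  show ?case
  proof (rule exI[of _ "N * d"], rule exI[of _ "\<lambda>x. k * m x"], rule exI[of _ "\<lambda>x. k * m' x"],
      intro conjI allI impI)
    fix v c
    have "of_nat (N * d) * (l * a (v, c)) = of_nat k * (of_nat N * a (v, c))"
      by (simp add: k(2))
    also have "\<dots> = (\<Sum>x\<in>\<Phi>. of_nat k * ((of_nat (m x) - of_nat (m' x)) * of_bool (x v = c)))"
      by (simp only: 1(2) sum_distrib_left)
    also have "\<dots> = (\<Sum>x\<in>\<Phi>. (of_nat (k * m x) - of_nat (k * m' x)) * of_bool (x v = c))"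
      by (rule sum.cong) (simp_all add: algebra_simps)
    finally show "of_nat (N * d) * fst (\<lambda>i. l * a i, s) (v, c)
        = (\<Sum>x\<in>\<Phi>. (of_nat (k * m x) - of_nat (k * m' x)) * of_bool (x v = c))"
      by simp
  next
    assume "snd (\<lambda>i. l * a i, s)"
    thus "\<exists>x\<in>\<Phi> - \<Psi>. k * m x > 0" using 1 k by auto
  qed (use 1 d in auto)
qed

lemma torus_monomial:
  fixes t :: "'v \<Rightarrow> 'j \<Rightarrow> complex"
  assumes V: "finite V" "\<And>v. v \<in> V \<Longrightarrow> finite (K v)" and \<Phi>: "finite \<Phi>" "\<Phi> \<subseteq> PiE V K"
  shows "(\<Prod>x\<in>\<Phi>. (\<Prod>v\<in>V. t v (x v)) ^ m x)
       = (\<Prod>v\<in>V. \<Prod>b\<in>K v. t v b ^ (\<Sum>x\<in>\<Phi>. m x * of_bool (x v = b)))"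
proof -
  have "(\<Prod>x\<in>\<Phi>. (\<Prod>v\<in>V. t v (x v)) ^ m x) = (\<Prod>v\<in>V. \<Prod>x\<in>\<Phi>. t v (x v) ^ m x)"
    by (subst prod.swap) (simp add: prod_power_distrib)
  also have "\<dots> = (\<Prod>v\<in>V. \<Prod>b\<in>K v. t v b ^ (\<Sum>x\<in>\<Phi>. m x * of_bool (x v = b)))"
  proof (rule prod.cong[OF refl])
    fix v assume v: "v \<in> V"
    have "(\<Prod>x\<in>\<Phi>. t v (x v) ^ m x) = (\<Prod>x\<in>\<Phi>. \<Prod>b\<in>K v. t v b ^ (m x * of_bool (x v = b)))"
    proof (rule prod.cong[OF refl])
      fix x assume x: "x \<in> \<Phi>"
      have "(\<Prod>b\<in>K v. t v b ^ (m x * of_bool (x v = b))) = (\<Prod>b\<in>K v. if b = x v then t v (x v) ^ m x else 1)"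
        by (rule prod.cong) auto
      also have "\<dots> = t v (x v) ^ m x" using V(2)[OF v] \<Phi> x v by (auto simp: prod.delta PiE_iff)
      finally show "t v (x v) ^ m x = (\<Prod>b\<in>K v. t v b ^ (m x * of_bool (x v = b)))" ..
    qed
    also have "\<dots> = (\<Prod>b\<in>K v. \<Prod>x\<in>\<Phi>. t v b ^ (m x * of_bool (x v = b)))" by (rule prod.swap)
    also have "\<dots> = (\<Prod>b\<in>K v. t v b ^ (\<Sum>x\<in>\<Phi>. m x * of_bool (x v = b)))" by (simp add: power_sum)
    finally show "(\<Prod>x\<in>\<Phi>. t v (x v) ^ m x) = (\<Prod>b\<in>K v. t v b ^ (\<Sum>x\<in>\<Phi>. m x * of_bool (x v = b)))" .
  qed
  finally show ?thesis .
qed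

text \<open>
  Such a polynomial witnesses that the tensor with support \<open>\<Psi>\<close> and coordinates \<open>0\<close> and \<open>1\<close> is outside
  the Zariski closure of the torus orbit of the one with support \<open>\<Phi>\<close>.
\<close>

definition separates :: "'v set \<Rightarrow> ('v \<Rightarrow> 'j set) \<Rightarrow> ((('v \<Rightarrow> 'j) \<Rightarrow> complex) \<Rightarrow> complex) \<Rightarrow>
    ('v \<Rightarrow> 'j) set \<Rightarrow> ('v \<Rightarrow> 'j) set \<Rightarrow> bool" where
  "separates V K p \<Phi> \<Psi> \<longleftrightarrow>
       (\<forall>t z. (\<forall>x\<in>PiE V K. z x = (\<Prod>v\<in>V. t v (x v)) * of_bool (x \<in> \<Phi>)) \<longrightarrow> p z = 0) \<and>
       (\<forall>z. (\<forall>x\<in>PiE V K. z x = of_bool (x \<in> \<Psi>)) \<longrightarrow> p z \<noteq> 0)"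

text \<open>
  The heart of the translation. If no weights degenerate the support \<open>\<Phi>\<close> to \<open>\<Psi>\<close>, then a
  contradiction between the weight inequalities is an integer relation between index tuples. It
  gives a binomial that vanishes on all torus translates of the indicator of \<open>\<Phi>\<close>. At the indicator
  of \<open>\<Psi>\<close> one monomial is \<open>0\<close>, having a factor outside \<open>\<Psi>\<close>, and the other one is \<open>1\<close>.
\<close>

lemma weights_or_binomial:
  assumes V: "finite V" "\<And>v. v \<in> V \<Longrightarrow> finite (K v)" and \<Phi>: "\<Phi> \<subseteq> PiE V K" and \<Psi>: "\<Psi> \<subseteq> PiE V K"
  shows "(\<Psi> \<subseteq> \<Phi> \<and> (\<exists>\<alpha> :: 'v \<Rightarrow> 'j \<Rightarrow> int. (\<forall>x\<in>\<Psi>. (\<Sum>v\<in>V. \<alpha> v (x v)) = 0) \<and>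
                            (\<forall>x\<in>\<Phi> - \<Psi>. (\<Sum>v\<in>V. \<alpha> v (x v)) > 0))) \<or>
    (\<exists>p\<in>polynomial_functions (PiE V K). separates V K p \<Phi> \<Psi>)"
proof (cases "\<Psi> \<subseteq> \<Phi>")
  case False
  then obtain x where x: "x \<in> \<Psi>" "x \<notin> \<Phi>" by blast
  have "(\<lambda>z. z x) \<in> polynomial_functions (PiE V K)" using x \<Psi> by (intro polynomial_functions.var) auto
  moreover have "z x = 0" if "\<forall>x\<in>PiE V K. z x = (\<Prod>v\<in>V. t v (x v)) * of_bool (x \<in> \<Phi>)"
    for t :: "'v \<Rightarrow> 'j \<Rightarrow> complex" and z
    using bspec[OF that, of x] x \<Psi> by auto
  moreover have "z x \<noteq> 0" if "\<forall>x\<in>PiE V K. z x = of_bool (x \<in> \<Psi>)" for z :: "('v \<Rightarrow> 'j) \<Rightarrow> complex"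
    using bspec[OF that, of x] x \<Psi> by auto
  ultimately show ?thesis unfolding separates_def by (intro disjI2 bexI[of _ "\<lambda>z. z x"]) blast+
next
  case sub: True
  define I where "I = Sigma V K"
  have finI: "finite I" using V by (auto simp: I_def)
  have fin\<Phi>: "finite \<Phi>" using V \<Phi> by (meson finite_PiE finite_subset)
  have finC: "finite (weight_inequalities \<Phi> \<Psi>)"
    using fin\<Phi> finite_subset[OF sub] by (simp add: weight_inequalities_def)
  have pairing: "(\<Sum>i\<in>I. (case i of (v, b) \<Rightarrow> of_bool (x v = b)) * y i) = (\<Sum>v\<in>V. y (v, x v))"
    if x: "x \<in> PiE V K" for x and y :: "'v \<times> 'j \<Rightarrow> rat"
  proof -
    have "(\<Sum>i\<in>I. (case i of (v, b) \<Rightarrow> of_bool (x v = b)) * y i)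
        = (\<Sum>v\<in>V. \<Sum>b\<in>K v. of_bool (x v = b) * y (v, b))"
      unfolding I_def using V by (subst sum.Sigma) (auto intro!: sum.cong)
    also have "\<dots> = (\<Sum>v\<in>V. \<Sum>b\<in>K v. if b = x v then y (v, x v) else 0)"
      by (intro sum.cong refl) auto
    also have "\<dots> = (\<Sum>v\<in>V. y (v, x v))"
      by (rule sum.cong) (use V x in \<open>auto simp: sum.delta PiE_iff\<close>)
    finally show ?thesis .
  qed
  from solution_or_contradiction[OF finI finC] show ?thesis
  proof
    assume "\<exists>y. \<forall>c\<in>weight_inequalities \<Phi> \<Psi>. satisfies I y c"
    then obtain y where y: "\<And>c. c \<in> weight_inequalities \<Phi> \<Psi> \<Longrightarrow> satisfies I y c" by blast
    have ge: "(\<Sum>v\<in>V. y (v, x v)) \<ge> 0" "x \<notin> \<Psi> \<Longrightarrow> (\<Sum>v\<in>V. y (v, x v)) > 0" if x: "x \<in> \<Phi>" for x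
    proof -
      have "satisfies I y (\<lambda>(v, b). of_bool (x v = b), x \<notin> \<Psi>)"
        using x by (intro y) (auto simp: weight_inequalities_def)
      thus "(\<Sum>v\<in>V. y (v, x v)) \<ge> 0" "x \<notin> \<Psi> \<Longrightarrow> (\<Sum>v\<in>V. y (v, x v)) > 0"
        using pairing[of x y] x \<Phi> by (auto simp: satisfies_def)
    qed
    have le: "(\<Sum>v\<in>V. y (v, x v)) \<le> 0" if x: "x \<in> \<Psi>" for x
    proof -
      have "satisfies I y (\<lambda>(v, b). - of_bool (x v = b), False)"
        using x by (intro y) (auto simp: weight_inequalities_def)
      hence "(\<Sum>i\<in>I. (case i of (v, b) \<Rightarrow> - of_bool (x v = b)) * y i) \<ge> 0" by (simp add: satisfies_def)
      also have "(\<Sum>i\<in>I. (case i of (v, b) \<Rightarrow> - of_bool (x v = b)) * y i)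
          = - (\<Sum>i\<in>I. (case i of (v, b) \<Rightarrow> of_bool (x v = b)) * y i)"
        by (simp add: split_beta sum_negf)
      also have "\<dots> = - (\<Sum>v\<in>V. y (v, x v))" using pairing[of x y] x \<Psi> by auto
      finally show ?thesis by simp
    qed
    obtain N \<alpha> where N: "(N::nat) > 0" and \<alpha>: "\<And>i. i \<in> I \<Longrightarrow> of_int (\<alpha> i) = of_nat N * y i"
      using common_denominator[OF finI, of y] by blast
    have sum\<alpha>: "of_int (\<Sum>v\<in>V. \<alpha> (v, x v)) = of_nat N * (\<Sum>v\<in>V. y (v, x v))" if "x \<in> PiE V K" for x
    proof -
      have "of_int (\<Sum>v\<in>V. \<alpha> (v, x v)) = (\<Sum>v\<in>V. of_nat N * y (v, x v))"
        unfolding of_int_sum by (rule sum.cong) (use that in \<open>auto intro!: \<alpha> simp: I_def PiE_iff\<close>)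
      thus ?thesis by (simp add: sum_distrib_left)
    qed
    have "(\<Sum>v\<in>V. \<alpha> (v, x v)) = 0" if x: "x \<in> \<Psi>" for x
    proof -
      have "(\<Sum>v\<in>V. y (v, x v)) = 0" using le[OF x] ge(1)[of x] x sub by force
      hence "of_int (\<Sum>v\<in>V. \<alpha> (v, x v)) = (0::rat)" using sum\<alpha>[of x] x \<Psi> by auto
      thus ?thesis by (simp only: of_int_eq_0_iff)
    qed
    moreover have "(\<Sum>v\<in>V. \<alpha> (v, x v)) > 0" if x: "x \<in> \<Phi> - \<Psi>" for x
    proof -
      have "(\<Sum>v\<in>V. y (v, x v)) > 0" using ge(2)[of x] x by blast
      hence "of_int (\<Sum>v\<in>V. \<alpha> (v, x v)) > (0::rat)" using sum\<alpha>[of x] x \<Phi> N by auto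
      thus ?thesis by (simp only: of_int_0_less_iff)
    qed
    ultimately show ?thesis using sub by (intro disjI1 conjI exI[of _ "\<lambda>v b. \<alpha> (v, b)"]) auto
  next
    assume "\<exists>a. (a, True) \<in> consequences (weight_inequalities \<Phi> \<Psi>) \<and> (\<forall>i\<in>I. a i = 0)"
    then obtain a where a: "(a, True) \<in> consequences (weight_inequalities \<Phi> \<Psi>)" "\<And>i. i \<in> I \<Longrightarrow> a i = 0"
      by blast
    from consequence_of_weight_inequalities[OF fin\<Phi> sub a(1)]
    obtain N :: nat and m m' :: "('v \<Rightarrow> 'j) \<Rightarrow> nat" where m: "N > 0"
      "\<And>v b. of_nat N * a (v, b) = (\<Sum>x\<in>\<Phi>. (of_nat (m x) - of_nat (m' x)) * of_bool (x v = b))"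
      "\<And>x. x \<notin> \<Psi> \<Longrightarrow> m' x = 0" "\<exists>x\<in>\<Phi> - \<Psi>. m x > 0"
      by (simp only: fst_conv snd_conv) blast
    have bal: "(\<Sum>x\<in>\<Phi>. m x * of_bool (x v = b)) = (\<Sum>x\<in>\<Phi>. m' x * of_bool (x v = b))"
      if "v \<in> V" "b \<in> K v" for v b
    proof -
      have "(0::rat) = (\<Sum>x\<in>\<Phi>. (of_nat (m x) - of_nat (m' x)) * of_bool (x v = b))"
        using m(2)[of v b] a(2)[of "(v, b)"] that by (simp add: I_def)
      also have "\<dots> = of_nat (\<Sum>x\<in>\<Phi>. m x * of_bool (x v = b)) - of_nat (\<Sum>x\<in>\<Phi>. m' x * of_bool (x v = b))"
        by (simp add: algebra_simps sum_subtractf)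
      finally have "of_nat (\<Sum>x\<in>\<Phi>. m x * of_bool (x v = b)) = (of_nat (\<Sum>x\<in>\<Phi>. m' x * of_bool (x v = b)) :: rat)"
        by simp
      thus ?thesis by (simp only: of_nat_eq_iff)
    qed
    define p where "p z = (\<Prod>x\<in>\<Phi>. z x ^ m x) - (\<Prod>x\<in>\<Phi>. z x ^ m' x)" for z :: "('v \<Rightarrow> 'j) \<Rightarrow> complex"
    have "p \<in> polynomial_functions (PiE V K)"
      unfolding p_def using fin\<Phi> \<Phi>
      by (intro polynomial_functions_diff polynomial_functions_prod_power)
    moreover have "p z = 0" if z: "\<forall>x\<in>PiE V K. z x = (\<Prod>v\<in>V. t v (x v)) * of_bool (x \<in> \<Phi>)" for t z
    proof -
      have "(\<Prod>x\<in>\<Phi>. z x ^ k x) = (\<Prod>x\<in>\<Phi>. (\<Prod>v\<in>V. t v (x v)) ^ k x)" for k :: "_ \<Rightarrow> nat"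
        by (rule prod.cong) (use z \<Phi> in auto)
      moreover have "(\<Prod>x\<in>\<Phi>. (\<Prod>v\<in>V. t v (x v)) ^ m x) = (\<Prod>x\<in>\<Phi>. (\<Prod>v\<in>V. t v (x v)) ^ m' x)"
      proof -
        have "(\<Prod>x\<in>\<Phi>. (\<Prod>v\<in>V. t v (x v)) ^ m x)
            = (\<Prod>v\<in>V. \<Prod>b\<in>K v. t v b ^ (\<Sum>x\<in>\<Phi>. m x * of_bool (x v = b)))"
          by (rule torus_monomial[OF V fin\<Phi> \<Phi>])
        also have "\<dots> = (\<Prod>v\<in>V. \<Prod>b\<in>K v. t v b ^ (\<Sum>x\<in>\<Phi>. m' x * of_bool (x v = b)))"
          by (intro prod.cong refl) (simp only: bal)
        also have "\<dots> = (\<Prod>x\<in>\<Phi>. (\<Prod>v\<in>V. t v (x v)) ^ m' x)"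
          by (rule torus_monomial[OF V fin\<Phi> \<Phi>, symmetric])
        finally show ?thesis .
      qed
      ultimately show ?thesis by (simp add: p_def)
    qed
    moreover have "p z \<noteq> 0" if z: "\<forall>x\<in>PiE V K. z x = of_bool (x \<in> \<Psi>)" for z
    proof -
      obtain x0 where x0: "x0 \<in> \<Phi> - \<Psi>" "m x0 > 0" using m(4) by blast
      have "z x0 ^ m x0 = 0" using z x0 \<Phi> by (auto simp: power_0_left)
      hence "(\<Prod>x\<in>\<Phi>. z x ^ m x) = 0" using x0 fin\<Phi> by auto
      moreover have "(\<Prod>x\<in>\<Phi>. z x ^ m' x) = 1"
      proof (rule prod.neutral, rule ballI)
        fix x assume x: "x \<in> \<Phi>"
        show "z x ^ m' x = 1"
          by (cases "x \<in> \<Psi>") (use z x \<Phi> m(3) in auto)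
      qed
      ultimately show ?thesis by (simp add: p_def)
    qed
    ultimately show ?thesis unfolding separates_def by (intro disjI2 bexI[of _ p]) blast+
  qed
qed

definition support :: "('v, 'j) tensor \<Rightarrow> ('v \<Rightarrow> 'j) set" where
  "support \<phi> = {x \<in> multi_idx \<phi>. coord \<phi> x \<noteq> 0}"

definition pad :: "'v set \<Rightarrow> ('v \<Rightarrow> 'j \<Rightarrow> 'l) \<Rightarrow> ('v \<Rightarrow> 'j) \<Rightarrow> 'v \<Rightarrow> 'l" where
  "pad V e x = (\<lambda>v\<in>V. e v (x v))"

lemma inj_on_pad:
  assumes "\<And>v. v \<in> V \<Longrightarrow> inj_on (e v) (J v)"
  shows "inj_on (pad V e) (PiE V J)"
proof (rule inj_onI)
  fix x y assume xy: "x \<in> PiE V J" "y \<in> PiE V J" and eq: "pad V e x = pad V e y"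
  show "x = y"
  proof (rule PiE_ext[OF xy])
    fix v assume v: "v \<in> V"
    have "e v (x v) = e v (y v)" using fun_cong[OF eq, of v] v by (simp add: pad_def)
    thus "x v = y v" using inj_onD[OF assms[OF v]] xy v by (auto simp: PiE_iff)
  qed
qed

text \<open>
  For tensors with coordinates \<open>0\<close> and \<open>1\<close>, such as powers of Dicke and unit tensors, zero-padding
  only moves the support.
\<close>

lemma coord_zero_pad:
  assumes V: "finite (legs \<phi>)" "\<And>v. v \<in> legs \<phi> \<Longrightarrow> finite (idx \<phi> v)"
    and ext: "extends_bases e K \<phi>" and zo: "\<And>x. x \<in> multi_idx \<phi> \<Longrightarrow> coord \<phi> x \<in> {0, 1}"
    and y: "y \<in> PiE (legs \<phi>) K"
  shows "coord (zero_pad e K \<phi>) y = of_bool (y \<in> pad (legs \<phi>) e ` support \<phi>)"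
proof -
  have fin: "finite (multi_idx \<phi>)" unfolding multi_idx_def using V by (intro finite_PiE)
  have inj: "inj_on (pad (legs \<phi>) e) (multi_idx \<phi>)"
    unfolding multi_idx_def by (rule inj_on_pad) (use ext in \<open>auto simp: extends_bases_def\<close>)
  have eq: "(\<forall>v\<in>legs \<phi>. y v = e v (x v)) \<longleftrightarrow> y = pad (legs \<phi>) e x" for x
  proof
    assume "\<forall>v\<in>legs \<phi>. y v = e v (x v)"
    thus "y = pad (legs \<phi>) e x"
      using y by (intro extensionalityI[of _ "legs \<phi>"]) (auto simp: pad_def PiE_def)
  qed (auto simp: pad_def)
  have "coord (zero_pad e K \<phi>) y = (\<Sum>x\<in>multi_idx \<phi>. of_bool (y = pad (legs \<phi>) e x) * coord \<phi> x)"
    unfolding zero_pad_def tensor_map_def by (simp add: prod_of_bool[OF V(1)] eq)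
  also have "\<dots> = of_bool (y \<in> pad (legs \<phi>) e ` support \<phi>)"
  proof (cases "y \<in> pad (legs \<phi>) e ` support \<phi>")
    case True
    then obtain x0 where x0: "x0 \<in> support \<phi>" "y = pad (legs \<phi>) e x0" by blast
    have x0': "x0 \<in> multi_idx \<phi>" "coord \<phi> x0 = 1" using x0(1) zo by (auto simp: support_def)
    have "(\<Sum>x\<in>multi_idx \<phi>. of_bool (y = pad (legs \<phi>) e x) * coord \<phi> x)
        = (\<Sum>x\<in>multi_idx \<phi>. if x = x0 then 1 else 0)"
      by (rule sum.cong) (use x0 x0' inj in \<open>auto simp: inj_on_eq_iff\<close>)
    thus ?thesis using True fin x0' by simp
  next
    case False
    hence "(\<Sum>x\<in>multi_idx \<phi>. of_bool (y = pad (legs \<phi>) e x) * coord \<phi> x) = 0"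
      by (intro sum.neutral) (auto simp: support_def)
    thus ?thesis using False by simp
  qed
  finally show ?thesis .
qed

lemma support_unit_power:
  assumes "finite V" "V \<noteq> {}"
  shows "support (tensor_power (unit_tensor V 2) n) = (\<lambda>l. \<lambda>v\<in>V. l) ` words n"
  using coord_unit_power[OF assms, of _ n]
  by (auto simp: support_def multi_idx_unit_power of_bool_def split: if_splits)

lemma zero_one_unit_power:
  assumes "finite V" "V \<noteq> {}" "x \<in> multi_idx (tensor_power (unit_tensor V 2) n)"
  shows "coord (tensor_power (unit_tensor V 2) n) x \<in> {0, 1}"
  using coord_unit_power[OF assms(1,2), of x n] assms(3) by (auto simp: multi_idx_unit_power)

text \<open>
  Invertibility puts a nonzero entry into every row, and monomiality makes it the only one there
  and the only one in its column.
\<close>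

lemma monomial_matrix_permutation:
  assumes M: "monomial_matrix J M" "invertible_matrix J M"
  obtains \<sigma> where "\<sigma> \<in> PiE J (\<lambda>_. J)" "inj_on \<sigma> J"
    "\<And>a b. a \<in> J \<Longrightarrow> b \<in> J \<Longrightarrow> b \<noteq> \<sigma> a \<Longrightarrow> M a b = 0"
proof -
  have "\<exists>b\<in>J. M a b \<noteq> 0" if a: "a \<in> J" for a
  proof (rule ccontr)
    assume "\<not> ?thesis"
    hence "(\<Sum>b\<in>J. M a b * N b a) = 0" for N by (intro sum.neutral) auto
    moreover obtain N where "(\<Sum>b\<in>J. M a b * N b a) = 1"
      using M(2) a by (force simp: invertible_matrix_def)
    ultimately show False by simp
  qed
  then obtain s where s: "\<And>a. a \<in> J \<Longrightarrow> s a \<in> J" "\<And>a. a \<in> J \<Longrightarrow> M a (s a) \<noteq> 0" by metis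
  show ?thesis
  proof (rule that[of "restrict s J"])
    show "inj_on (restrict s J) J"
      using M(1) s unfolding monomial_matrix_def inj_on_def by (metis restrict_apply')
    show "M a b = 0" if "a \<in> J" "b \<in> J" "b \<noteq> restrict s J a" for a b
      using M(1) s that unfolding monomial_matrix_def by (metis restrict_apply')
  qed (use s in auto)
qed

lemma coord_monomial_map:
  assumes V: "finite V" "\<And>v. v \<in> V \<Longrightarrow> finite (K v)" and legs: "legs \<phi> = V" and idx: "idx \<phi> = K"
    and \<sigma>: "\<And>v. v \<in> V \<Longrightarrow> \<sigma> v \<in> PiE (K v) (\<lambda>_. K v)"
    and A: "\<And>v a b. v \<in> V \<Longrightarrow> a \<in> K v \<Longrightarrow> b \<in> K v \<Longrightarrow> b \<noteq> \<sigma> v a \<Longrightarrow> A v a b = 0"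
    and y: "y \<in> PiE V K"
  shows "coord (tensor_map A L \<phi>) y
       = (\<Prod>v\<in>V. A v (y v) (\<sigma> v (y v))) * coord \<phi> (\<lambda>v\<in>V. \<sigma> v (y v))"
proof -
  let ?z = "\<lambda>v\<in>V. \<sigma> v (y v)"
  have fin: "finite (PiE V K)" using V by (intro finite_PiE)
  have z: "?z \<in> PiE V K" using \<sigma> y by (auto simp: PiE_iff)
  have "coord (tensor_map A L \<phi>) y = (\<Sum>x\<in>PiE V K. (\<Prod>v\<in>V. A v (y v) (x v)) * coord \<phi> x)"
    by (simp add: tensor_map_def multi_idx_def legs idx)
  also have "\<dots> = (\<Sum>x\<in>{?z}. (\<Prod>v\<in>V. A v (y v) (x v)) * coord \<phi> x)"
  proof (rule sum.mono_neutral_right[OF fin])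
    show "\<forall>x\<in>PiE V K - {?z}. (\<Prod>v\<in>V. A v (y v) (x v)) * coord \<phi> x = 0"
    proof
      fix x assume x: "x \<in> PiE V K - {?z}"
      have "\<exists>v\<in>V. x v \<noteq> \<sigma> v (y v)"
      proof (rule ccontr)
        assume "\<not> ?thesis"
        hence "x = ?z" using x z by (intro PiE_ext[of x V K ?z]) auto
        thus False using x by simp
      qed
      then obtain v where v: "v \<in> V" "x v \<noteq> \<sigma> v (y v)" by blast
      hence "A v (y v) (x v) = 0" using x y by (intro A) (auto simp: PiE_iff)
      thus "(\<Prod>v\<in>V. A v (y v) (x v)) * coord \<phi> x = 0" using v V(1) by auto
    qed
  qed (use z in auto)
  also have "\<dots> = (\<Prod>v\<in>V. A v (y v) (\<sigma> v (y v))) * coord \<phi> ?z" by simp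
  finally show ?thesis .
qed

text \<open>
  There are finitely many coordinate permutations, so some permuted torus orbit closure contains
  the unit tensor: otherwise the product of the separating binomials would vanish on the monomial
  orbit, but not at the unit tensor.
\<close>

lemma diagonal_of_monomial_degeneration:
  fixes \<phi> :: "('v, 'j) tensor"
  assumes V: "finite V" "V \<noteq> {}" and legs: "legs \<phi> = V" and fin: "\<And>v. v \<in> V \<Longrightarrow> finite (idx \<phi> v)"
    and zo: "\<And>x. x \<in> multi_idx \<phi> \<Longrightarrow> coord \<phi> x \<in> {0, 1}"
    and deg: "monomially_degenerates_to \<phi> (tensor_power (unit_tensor V 2) n)"
  obtains \<Psi> where "diagonal_degeneration V (support \<phi>) \<Psi>" "card \<Psi> = 2 ^ n"
proof -
  let ?U = "tensor_power (unit_tensor V 2) n"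
  have legsU: "legs ?U = V" and idxU: "idx ?U = (\<lambda>v. words n)"
    by (simp_all add: tensor_power_def unit_tensor_def words_altdef)
  obtain K :: "'v \<Rightarrow> nat set" and e f where e: "extends_bases e K \<phi>" and f: "extends_bases f K ?U"
    and cl: "coord (zero_pad f K ?U) \<in> zariski_closure (PiE V K) (coord ` monomial_orbit (zero_pad e K \<phi>))"
    using deg unfolding monomially_degenerates_to_def legs by blast
  have K: "finite (K v)" if "v \<in> V" for v using e that by (simp add: extends_bases_def legs)
  have e_inj: "inj_on (e v) (idx \<phi> v)" "e v ` idx \<phi> v \<subseteq> K v" if "v \<in> V" for v
    using e that by (simp_all add: extends_bases_def legs)
  have f_inj: "inj_on (f v) (words n)" "f v ` words n \<subseteq> K v" if "v \<in> V" for v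
    using f that by (simp_all add: extends_bases_def legsU idxU)
  have padU: "coord (zero_pad f K ?U) y = of_bool (y \<in> pad V f ` support ?U)" if "y \<in> PiE V K" for y
    using coord_zero_pad[of ?U f K y] f that V finite_words zero_one_unit_power[OF V]
    by (simp add: legsU idxU)
  have pad\<phi>: "coord (zero_pad e K \<phi>) y = of_bool (y \<in> pad V e ` support \<phi>)" if "y \<in> PiE V K" for y
    using coord_zero_pad[of \<phi> e K y] e that V fin zo by (simp add: legs)
  define \<Sigma> where "\<Sigma> = {\<sigma> \<in> PiE V (\<lambda>v. PiE (K v) (\<lambda>_. K v)). \<forall>v\<in>V. inj_on (\<sigma> v) (K v)}"
  have fin\<Sigma>: "finite \<Sigma>"
    unfolding \<Sigma>_def by (rule finite_subset[of _ "PiE V (\<lambda>v. PiE (K v) (\<lambda>_. K v))"])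
      (use V K in \<open>auto intro!: finite_PiE\<close>)
  define S where "S \<sigma> = {y \<in> PiE V K. (\<lambda>v\<in>V. \<sigma> v (y v)) \<in> pad V e ` support \<phi>}" for \<sigma>
  define T where "T = pad V f ` support ?U"
  have T_sub: "T \<subseteq> PiE V K"
  proof -
    have "f v l \<in> K v" if "v \<in> V" "l \<in> words n" for v l using f_inj(2)[OF that(1)] that(2) by blast
    thus ?thesis by (auto simp: T_def pad_def support_unit_power[OF V])
  qed
  define good where "good \<sigma> \<longleftrightarrow> T \<subseteq> S \<sigma> \<and> (\<exists>\<alpha> :: 'v \<Rightarrow> nat \<Rightarrow> int.
      (\<forall>x\<in>T. (\<Sum>v\<in>V. \<alpha> v (x v)) = 0) \<and> (\<forall>x\<in>S \<sigma> - T. (\<Sum>v\<in>V. \<alpha> v (x v)) > 0))" for \<sigma>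
  have "\<exists>\<sigma>\<in>\<Sigma>. good \<sigma>"
  proof (rule ccontr)
    assume bad: "\<not> ?thesis"
    have "\<forall>\<sigma>\<in>\<Sigma>. \<exists>p. p \<in> polynomial_functions (PiE V K) \<and> separates V K p (S \<sigma>) T"
    proof
      fix \<sigma> assume \<sigma>: "\<sigma> \<in> \<Sigma>"
      have "S \<sigma> \<subseteq> PiE V K" by (auto simp: S_def)
      from weights_or_binomial[OF V(1) K this T_sub] bad \<sigma>
      show "\<exists>p. p \<in> polynomial_functions (PiE V K) \<and> separates V K p (S \<sigma>) T"
        unfolding good_def by blast
    qed
    from bchoice[OF this] obtain p where p: "\<forall>\<sigma>\<in>\<Sigma>. p \<sigma> \<in> polynomial_functions (PiE V K) \<and> separates V K (p \<sigma>) (S \<sigma>) T" ..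
    define P where "P z = (\<Prod>\<sigma>\<in>\<Sigma>. p \<sigma> z)" for z
    have "P \<in> polynomial_functions (PiE V K)"
      unfolding P_def using p by (intro polynomial_functions_prod[OF fin\<Sigma>]) blast
    moreover have "P z = 0" if z: "z \<in> coord ` monomial_orbit (zero_pad e K \<phi>)" for z
    proof -
      let ?Z = "zero_pad e K \<phi>"
      have legsZ: "legs ?Z = V" and idxZ: "idx ?Z = K"
        by (simp_all add: zero_pad_def tensor_map_def legs)
      obtain A where z: "z = coord (tensor_map A K ?Z)"
        and A: "\<forall>v\<in>V. monomial_matrix (K v) (A v) \<and> invertible_matrix (K v) (A v)"
        using z unfolding monomial_orbit_def legsZ idxZ by blast
      have "\<forall>v\<in>V. \<exists>s. s \<in> PiE (K v) (\<lambda>_. K v) \<and> inj_on s (K v) \<and>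
          (\<forall>a\<in>K v. \<forall>b\<in>K v. b \<noteq> s a \<longrightarrow> A v a b = 0)"
      proof
        fix v assume "v \<in> V"
        with A have "monomial_matrix (K v) (A v)" "invertible_matrix (K v) (A v)" by auto
        then obtain s where "s \<in> PiE (K v) (\<lambda>_. K v)" "inj_on s (K v)"
            "\<And>a b. a \<in> K v \<Longrightarrow> b \<in> K v \<Longrightarrow> b \<noteq> s a \<Longrightarrow> A v a b = 0"
          by (rule monomial_matrix_permutation) blast
        thus "\<exists>s. s \<in> PiE (K v) (\<lambda>_. K v) \<and> inj_on s (K v) \<and>
          (\<forall>a\<in>K v. \<forall>b\<in>K v. b \<noteq> s a \<longrightarrow> A v a b = 0)" by blast
      qed
      from bchoice[OF this] obtain s where s: "\<forall>v\<in>V. s v \<in> PiE (K v) (\<lambda>_. K v) \<and> inj_on (s v) (K v) \<and>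
          (\<forall>a\<in>K v. \<forall>b\<in>K v. b \<noteq> s v a \<longrightarrow> A v a b = 0)" ..
      define \<sigma> where "\<sigma> = restrict s V"
      have \<sigma>: "\<sigma> \<in> \<Sigma>" using s by (auto simp: \<Sigma>_def \<sigma>_def)
      have "z y = (\<Prod>v\<in>V. A v (y v) (\<sigma> v (y v))) * of_bool (y \<in> S \<sigma>)" if y: "y \<in> PiE V K" for y
      proof -
        have "(\<lambda>v\<in>V. \<sigma> v (y v)) \<in> PiE V K" using s y by (auto simp: \<sigma>_def PiE_iff)
        hence "coord ?Z (\<lambda>v\<in>V. \<sigma> v (y v)) = of_bool (y \<in> S \<sigma>)"
          using y by (simp add: pad\<phi> S_def)
        moreover have "z y = (\<Prod>v\<in>V. A v (y v) (\<sigma> v (y v))) * coord ?Z (\<lambda>v\<in>V. \<sigma> v (y v))"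
          unfolding z by (rule coord_monomial_map[OF V(1) K legsZ idxZ _ _ y])
            (use s in \<open>auto simp: \<sigma>_def\<close>)
        ultimately show ?thesis by simp
      qed
      hence zS: "\<forall>y\<in>PiE V K. z y = (\<Prod>v\<in>V. A v (y v) (\<sigma> v (y v))) * of_bool (y \<in> S \<sigma>)" by blast
      have "\<forall>t z. (\<forall>x\<in>PiE V K. z x = (\<Prod>v\<in>V. t v (x v)) * of_bool (x \<in> S \<sigma>)) \<longrightarrow> p \<sigma> z = 0"
        using p \<sigma> unfolding separates_def by blast
      from mp[OF spec[OF spec[OF this, of "\<lambda>v b. A v b (\<sigma> v b)"], of z] zS]
      have "p \<sigma> z = 0" .
      thus ?thesis using \<sigma> fin\<Sigma> by (auto simp: P_def)
    qed
    ultimately have "P (coord (zero_pad f K ?U)) = 0" using cl unfolding zariski_closure_def by blast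
    then obtain \<sigma> where "\<sigma> \<in> \<Sigma>" "p \<sigma> (coord (zero_pad f K ?U)) = 0" using fin\<Sigma> by (auto simp: P_def)
    moreover have "\<forall>x\<in>PiE V K. coord (zero_pad f K ?U) x = of_bool (x \<in> T)" using padU by (simp add: T_def)
    ultimately show False using p unfolding separates_def by blast
  qed
  then obtain \<sigma> \<alpha> where \<sigma>: "\<sigma> \<in> \<Sigma>" and TS: "T \<subseteq> S \<sigma>"
    and zero: "\<forall>x\<in>T. (\<Sum>v\<in>V. (\<alpha> :: 'v \<Rightarrow> nat \<Rightarrow> int) v (x v)) = 0"
    and pos: "\<forall>x\<in>S \<sigma> - T. (\<Sum>v\<in>V. \<alpha> v (x v)) > 0"
    unfolding good_def by blast
  have \<sigma>_inj: "inj_on (\<sigma> v) (K v)" "\<sigma> v ` K v = K v" if "v \<in> V" for v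
  proof -
    show inj: "inj_on (\<sigma> v) (K v)" using \<sigma> that by (simp add: \<Sigma>_def)
    have "\<sigma> v ` K v \<subseteq> K v" using \<sigma> that by (auto simp: \<Sigma>_def PiE_iff)
    thus "\<sigma> v ` K v = K v" using inj K[OF that] by (simp add: endo_inj_surj)
  qed
  \<comment> \<open>\<open>\<rho>\<close> identifies the support of \<open>\<phi>\<close> with the permuted support \<open>S \<sigma>\<close> in the padded space\<close>
  define g where "g v a = inv_into (K v) (\<sigma> v) (e v a)" for v a
  define \<rho> where "\<rho> x = pad V g x" for x
  have g: "\<sigma> v (g v a) = e v a" "g v a \<in> K v" if "v \<in> V" "a \<in> idx \<phi> v" for v a
  proof -
    have "e v a \<in> \<sigma> v ` K v" using e_inj(2)[OF that(1)] \<sigma>_inj(2)[OF that(1)] that(2) by blast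
    thus "\<sigma> v (g v a) = e v a" "g v a \<in> K v" by (simp_all add: g_def f_inv_into_f inv_into_into)
  qed
  have g_inj: "inj_on (g v) (idx \<phi> v)" if "v \<in> V" for v
    using e_inj(1)[OF that] g(1)[OF that] unfolding inj_on_def by metis
  have \<rho>_inj: "inj_on \<rho> (support \<phi>)"
    unfolding \<rho>_def using inj_on_pad[of V g "idx \<phi>", OF g_inj]
    by (rule inj_on_subset) (auto simp: support_def multi_idx_def legs)
  have x_idx: "x v \<in> idx \<phi> v" if "x \<in> support \<phi>" "v \<in> V" for x v
    using that by (auto simp: support_def multi_idx_def legs)
  have \<rho>_S: "\<rho> x \<in> S \<sigma>" if x: "x \<in> support \<phi>" for x
  proof -
    have "(\<lambda>v\<in>V. \<sigma> v (\<rho> x v)) = pad V e x"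
      using g(1) x_idx[OF x] by (auto simp: \<rho>_def pad_def intro!: restrict_ext)
    thus ?thesis using g(2) x_idx[OF x] x by (auto simp: S_def \<rho>_def pad_def)
  qed
  have S_\<rho>: "\<exists>x\<in>support \<phi>. \<rho> x = y" if y: "y \<in> S \<sigma>" for y
  proof -
    obtain x where x: "x \<in> support \<phi>" "(\<lambda>v\<in>V. \<sigma> v (y v)) = pad V e x" using y by (auto simp: S_def)
    have "\<rho> x v = y v" if v: "v \<in> V" for v
    proof -
      have "\<sigma> v (y v) = e v (x v)" using fun_cong[OF x(2), of v] v by (simp add: pad_def)
      hence "\<sigma> v (y v) = \<sigma> v (\<rho> x v)" using g(1)[OF v x_idx[OF x(1) v]] v by (simp add: \<rho>_def pad_def)
      moreover have "y v \<in> K v" "\<rho> x v \<in> K v"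
        using y g(2)[OF v x_idx[OF x(1) v]] v by (auto simp: S_def \<rho>_def pad_def PiE_iff)
      ultimately show ?thesis using inj_onD[OF \<sigma>_inj(1)[OF v]] by metis
    qed
    hence "\<rho> x = y"
      using y by (intro extensionalityI[of _ V]) (auto simp: S_def PiE_def \<rho>_def pad_def)
    thus ?thesis using x(1) by blast
  qed
  define \<Psi> where "\<Psi> = {x \<in> support \<phi>. \<rho> x \<in> T}"
  have img: "\<rho> ` \<Psi> = T" using S_\<rho> TS by (force simp: \<Psi>_def)
  have diagT: "x = y" if xy: "x \<in> T" "y \<in> T" and v: "v \<in> V" and eq: "x v = y v" for x y v
  proof -
    obtain l l' where l: "l \<in> words n" "l' \<in> words n" "x = pad V f (\<lambda>v\<in>V. l)" "y = pad V f (\<lambda>v\<in>V. l')"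
      using xy by (auto simp: T_def support_unit_power[OF V])
    have "l = l'" using eq l v inj_onD[OF f_inj(1)[OF v]] by (auto simp: pad_def)
    thus ?thesis using l by simp
  qed
  have "card \<Psi> = card T"
    using card_image[of \<rho> \<Psi>] inj_on_subset[OF \<rho>_inj, of \<Psi>] img by (auto simp: \<Psi>_def)
  also have "\<dots> = 2 ^ n"
  proof -
    obtain v0 where v0: "v0 \<in> V" using V by blast
    have "T = (\<lambda>l. pad V f (\<lambda>v\<in>V. l)) ` words n"
      by (simp add: T_def support_unit_power[OF V] image_image)
    moreover have "inj_on (\<lambda>l. pad V f (\<lambda>v\<in>V. l)) (words n)"
    proof (rule inj_onI)
      fix l l' assume l: "l \<in> words n" "l' \<in> words n" and eq: "pad V f (\<lambda>v\<in>V. l) = pad V f (\<lambda>v\<in>V. l')"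
      have "f v0 l = f v0 l'" using fun_cong[OF eq, of v0] v0 by (simp add: pad_def)
      thus "l = l'" using inj_onD[OF f_inj(1)[OF v0]] l by blast
    qed
    ultimately show ?thesis by (simp add: card_image card_words)
  qed
  finally have card: "card \<Psi> = 2 ^ n" .
  have sum: "(\<Sum>v\<in>V. \<alpha> v (g v (x v))) = (\<Sum>v\<in>V. \<alpha> v (\<rho> x v))" for x
    by (rule sum.cong) (simp_all add: \<rho>_def pad_def)
  have "diagonal_degeneration V (support \<phi>) \<Psi>"
    unfolding diagonal_degeneration_def
  proof (intro conjI exI[of _ "\<lambda>v a. \<alpha> v (g v a)"] ballI impI)
    show "\<Psi> \<subseteq> support \<phi>" by (auto simp: \<Psi>_def)
  next
    fix x y v assume xy: "x \<in> \<Psi>" "y \<in> \<Psi>" "v \<in> V" "x v = y v"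
    have "\<rho> x v = \<rho> y v" using xy by (simp add: \<rho>_def pad_def)
    hence "\<rho> x = \<rho> y" using diagT[of "\<rho> x" "\<rho> y" v] xy by (auto simp: \<Psi>_def)
    thus "x = y" using inj_onD[OF \<rho>_inj] xy by (auto simp: \<Psi>_def)
  next
    fix x assume "x \<in> \<Psi>"
    thus "(\<Sum>v\<in>V. \<alpha> v (g v (x v))) = 0" using zero by (simp add: sum \<Psi>_def)
  next
    fix x assume "x \<in> support \<phi> - \<Psi>"
    hence "\<rho> x \<in> S \<sigma> - T" using \<rho>_S by (auto simp: \<Psi>_def)
    thus "(\<Sum>v\<in>V. \<alpha> v (g v (x v))) > 0" using pos by (simp add: sum)
  qed
  thus ?thesis using card by (rule that)
qed

text \<open>
  Conversely, weights are the exponents of a one-parameter family of diagonal matrices along which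
  the tensor tends to its restriction to \<open>\<Psi>\<close>.
\<close>

lemma monomial_degeneration_of_diagonal:
  fixes \<phi> :: "('v, 'j) tensor"
  assumes V: "finite V" "V \<noteq> {}" and legs: "legs \<phi> = V" and fin: "\<And>v. v \<in> V \<Longrightarrow> finite (idx \<phi> v)"
    and zo: "\<And>x. x \<in> multi_idx \<phi> \<Longrightarrow> coord \<phi> x \<in> {0, 1}"
    and deg: "diagonal_degeneration V (support \<phi>) \<Psi>" and card: "card \<Psi> = 2 ^ n"
  shows "monomially_degenerates_to \<phi> (tensor_power (unit_tensor V 2) n)"
proof -
  let ?U = "tensor_power (unit_tensor V 2) n"
  have legsU: "legs ?U = V" and idxU: "idx ?U = (\<lambda>v. words n)"
    by (simp_all add: tensor_power_def unit_tensor_def words_altdef)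
  obtain \<alpha> where sub: "\<Psi> \<subseteq> support \<phi>" and diag: "\<forall>x\<in>\<Psi>. \<forall>y\<in>\<Psi>. \<forall>v\<in>V. x v = y v \<longrightarrow> x = y"
    and zero: "\<forall>x\<in>\<Psi>. (\<Sum>v\<in>V. (\<alpha> :: 'v \<Rightarrow> 'j \<Rightarrow> int) v (x v)) = 0"
    and pos: "\<forall>x\<in>support \<phi> - \<Psi>. (\<Sum>v\<in>V. \<alpha> v (x v)) > 0"
    using deg unfolding diagonal_degeneration_def by blast
  have x_idx: "x v \<in> idx \<phi> v" if "x \<in> support \<phi>" "v \<in> V" for x v
    using that by (auto simp: support_def multi_idx_def legs)
  have "\<forall>v\<in>V. \<exists>h :: 'j \<Rightarrow> nat. inj_on h (idx \<phi> v)"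
    using fin finite_imp_inj_to_nat_seg by blast
  from bchoice[OF this] obtain e :: "'v \<Rightarrow> 'j \<Rightarrow> nat" where e: "\<forall>v\<in>V. inj_on (e v) (idx \<phi> v)" ..
  define K where "K v = e v ` idx \<phi> v" for v
  have K: "finite (K v)" if "v \<in> V" for v using fin[OF that] by (simp add: K_def)
  have fin\<Psi>: "finite \<Psi>" using card by (intro card_ge_0_finite) simp
  obtain B where B: "bij_betw B (words n) \<Psi>"
    using finite_same_card_bij[OF finite_words fin\<Psi>, of n] card by (auto simp: card_words)
  have B\<Psi>: "B l \<in> \<Psi>" if "l \<in> words n" for l using B that by (auto dest: bij_betwE)
  define f where "f v l = e v (B l v)" for v l
  have ext_e: "extends_bases e K \<phi>" using e K by (simp add: extends_bases_def legs K_def)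
  have ext_f: "extends_bases f K ?U"
    unfolding extends_bases_def legsU idxU
  proof (intro ballI conjI)
    fix v assume v: "v \<in> V"
    show "finite (K v)" by (rule K[OF v])
    have idx: "B l v \<in> idx \<phi> v" if "l \<in> words n" for l
      using B\<Psi>[OF that] sub x_idx v by blast
    show "f v ` words n \<subseteq> K v" using idx by (auto simp: f_def K_def)
    show "inj_on (f v) (words n)"
    proof (rule inj_onI)
      fix l l' assume l: "l \<in> words n" "l' \<in> words n" and eq: "f v l = f v l'"
      have "B l v = B l' v" using eq e v idx l unfolding f_def by (metis inj_onD)
      hence "B l = B l'" using diag B\<Psi> l v by blast
      thus "l = l'" using B l by (metis bij_betw_def inj_onD)
    qed
  qed
  have padU: "coord (zero_pad f K ?U) y = of_bool (y \<in> pad V e ` \<Psi>)" if "y \<in> PiE V K" for y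
  proof -
    have "coord (zero_pad f K ?U) y = of_bool (y \<in> pad V f ` support ?U)"
      using coord_zero_pad[of ?U f K y] ext_f that V finite_words zero_one_unit_power[OF V]
      by (simp add: legsU idxU)
    also have "pad V f ` support ?U = pad V e ` (B ` words n)"
      unfolding support_unit_power[OF V] image_image
      by (rule image_cong) (auto simp: pad_def f_def)
    also have "B ` words n = \<Psi>" using B by (simp add: bij_betw_def)
    finally show ?thesis .
  qed
  have pad\<phi>: "coord (zero_pad e K \<phi>) y = of_bool (y \<in> pad V e ` support \<phi>)" if "y \<in> PiE V K" for y
    using coord_zero_pad[of \<phi> e K y] ext_e that V fin zo by (simp add: legs)
  let ?Z = "zero_pad e K \<phi>"
  have legsZ: "legs ?Z = V" and idxZ: "idx ?Z = K"
    by (simp_all add: zero_pad_def tensor_map_def legs)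
  define t :: "nat \<Rightarrow> complex" where "t i = of_real (inverse (real (Suc i)))" for i
  have t0: "t i \<noteq> 0" for i by (simp add: t_def del: of_nat_Suc)
  have t_lim: "t \<longlonglongrightarrow> 0"
    unfolding t_def using tendsto_of_real[OF LIMSEQ_inverse_real_of_nat, where ?'a=complex] by simp
  define w where "w v b = \<alpha> v (inv_into (idx \<phi> v) (e v) b)" for v b
  define A where "A i v a b = of_bool (a = b) * t i powi w v a" for i v and a b :: nat
  define z where "z i = coord (tensor_map (A i) K ?Z)" for i
  have orbit: "z i \<in> coord ` monomial_orbit ?Z" for i
  proof -
    have "monomial_matrix (K v) (A i v)" for v
      by (auto simp: monomial_matrix_def A_def)
    moreover have "invertible_matrix (K v) (A i v)" if v: "v \<in> V" for v
      unfolding invertible_matrix_def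
    proof (intro exI[of _ "\<lambda>a b. of_bool (a = b) * t i powi (- w v a)"] ballI conjI)
      fix a c assume ac: "a \<in> K v" "c \<in> K v"
      have "(\<Sum>b\<in>K v. A i v a b * (of_bool (b = c) * t i powi (- w v b)))
          = (\<Sum>b\<in>K v. if b = a then of_bool (a = c) else 0)"
        by (rule sum.cong) (use t0[of i] in \<open>auto simp: A_def power_int_minus\<close>)
      thus "(\<Sum>b\<in>K v. A i v a b * (of_bool (b = c) * t i powi (- w v b))) = of_bool (a = c)"
        using K[OF v] ac by simp
      have "(\<Sum>b\<in>K v. of_bool (a = b) * t i powi (- w v a) * A i v b c)
          = (\<Sum>b\<in>K v. if b = a then of_bool (a = c) else 0)"
        by (rule sum.cong) (use t0[of i] in \<open>auto simp: A_def power_int_minus\<close>)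
      thus "(\<Sum>b\<in>K v. of_bool (a = b) * t i powi (- w v a) * A i v b c) = of_bool (a = c)"
        using K[OF v] ac by simp
    qed
    ultimately have "tensor_map (A i) (idx ?Z) ?Z \<in> monomial_orbit ?Z"
      unfolding monomial_orbit_def legsZ idxZ by blast
    thus ?thesis by (simp add: z_def idxZ)
  qed
  have lim: "(\<lambda>i. z i y) \<longlonglongrightarrow> coord (zero_pad f K ?U) y" if y: "y \<in> PiE V K" for y
  proof -
    have id: "(\<lambda>v\<in>V. (\<lambda>b\<in>K v. b) (y v)) = y"
      using y by (intro extensionalityI[of _ V]) (auto simp: PiE_def)
    have "z i y = (\<Prod>v\<in>V. A i v (y v) ((\<lambda>b\<in>K v. b) (y v))) * coord ?Z (\<lambda>v\<in>V. (\<lambda>b\<in>K v. b) (y v))" for i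
      unfolding z_def by (rule coord_monomial_map[OF V(1) K legsZ idxZ _ _ y]) (auto simp: A_def)
    also have "\<dots> i = (\<Prod>v\<in>V. t i powi w v (y v)) * of_bool (y \<in> pad V e ` support \<phi>)" for i
      unfolding id pad\<phi>[OF y] using y by (auto simp: A_def PiE_iff intro!: prod.cong)
    finally have zy: "z i y = (\<Prod>v\<in>V. t i powi w v (y v)) * of_bool (y \<in> pad V e ` support \<phi>)" for i .
    have inj: "inj_on (pad V e) (support \<phi>)"
      using inj_on_pad[of V e "idx \<phi>"] e
      by (auto simp: support_def multi_idx_def legs intro: inj_on_subset[of _ "PiE V (idx \<phi>)"])
    show ?thesis
    proof (cases "y \<in> pad V e ` support \<phi>")
      case False
      hence "y \<notin> pad V e ` \<Psi>" using sub by blast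
      thus ?thesis using False by (simp add: zy padU[OF y])
    next
      case True
      then obtain x where x: "x \<in> support \<phi>" "y = pad V e x" by blast
      have "w v (y v) = \<alpha> v (x v)" if "v \<in> V" for v
        using that x x_idx[OF x(1) that] e by (simp add: w_def pad_def)
      hence zx: "z i y = t i powi (\<Sum>v\<in>V. \<alpha> v (x v))" for i
        using True t0 V by (simp add: zy power_int_sum)
      have mem: "y \<in> pad V e ` \<Psi> \<longleftrightarrow> x \<in> \<Psi>"
        using inj x sub by (auto simp: inj_on_def)
      show ?thesis
      proof (cases "x \<in> \<Psi>")
        case True
        thus ?thesis using zero by (simp add: zx padU[OF y] mem)
      next
        case False
        define k where "k = nat (\<Sum>v\<in>V. \<alpha> v (x v))"
        have "(\<Sum>v\<in>V. \<alpha> v (x v)) > 0" using pos x False by blast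
        hence k: "k > 0" "(\<Sum>v\<in>V. \<alpha> v (x v)) = int k" by (simp_all add: k_def)
        have "(\<lambda>i. t i ^ k) \<longlonglongrightarrow> 0 ^ k" by (intro tendsto_power t_lim)
        thus ?thesis using k False by (simp add: zx padU[OF y] mem power_0_left)
      qed
    qed
  qed
  have "coord (zero_pad f K ?U) \<in> zariski_closure (PiE V K) (coord ` monomial_orbit ?Z)"
    unfolding zariski_closure_def
  proof (intro CollectI ballI impI)
    fix p assume p: "p \<in> polynomial_functions (PiE V K)" "\<forall>x\<in>coord ` monomial_orbit ?Z. p x = 0"
    have "(\<lambda>i. p (z i)) \<longlonglongrightarrow> p (coord (zero_pad f K ?U))"
      by (rule polynomial_functions_tendsto[OF p(1) lim])
    moreover have "p (z i) = 0" for i using p(2) orbit by blast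
    ultimately show "p (coord (zero_pad f K ?U)) = 0" by (simp add: LIMSEQ_const_iff)
  qed
  thus ?thesis
    unfolding monomially_degenerates_to_def legs legsU using ext_e ext_f by blast
qed

section \<open>The subexponent of the Dicke tensor\<close>

lemma support_dicke_power:
  assumes k: "k \<ge> 2"
  shows "support (tensor_power (dicke_tensor 2 (k - 2)) m) = edge_words {1..k} m"
    and "coord (tensor_power (dicke_tensor 2 (k - 2)) m) x \<in> {0, 1}"
proof -
  let ?D = "dicke_tensor 2 (k - 2)"
  let ?V = "{1..k}"
  have legs: "{1..2 + (k - 2)} = ?V" using k by simp
  define P where "P x j \<longleftrightarrow> card {v\<in>?V. x v ! j = 1} = 2 \<and> card {v\<in>?V. x v ! j = 2} = k - 2"
    for x :: "nat \<Rightarrow> nat list" and j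
  have coord: "coord (tensor_power ?D m) x = of_bool (\<forall>j\<in>{..<m}. P x j)" for x
  proof -
    have "{v \<in> ?V. (\<lambda>v\<in>?V. x v ! j) v = c} = {v \<in> ?V. x v ! j = c}" for j c by auto
    hence "coord (tensor_power ?D m) x = (\<Prod>j<m. of_bool (P x j))"
      unfolding tensor_power_def dicke_tensor_def P_def legs by simp
    thus ?thesis by (simp only: prod_of_bool[OF finite_lessThan])
  qed
  have "of_bool b \<in> {0, 1 :: complex}" for b by (cases b) auto
  thus "coord (tensor_power ?D m) x \<in> {0, 1}" unfolding coord .
  have idx: "multi_idx (tensor_power ?D m) = PiE ?V (\<lambda>_. words m)"
    unfolding multi_idx_def tensor_power_def dicke_tensor_def words_def legs by simp
  have P: "P x j \<longleftrightarrow> card {v\<in>?V. x v ! j = 1} = 2" if x: "x \<in> PiE ?V (\<lambda>_. words m)" and j: "j < m" for x j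
  proof -
    have "x v ! j = 1 \<or> x v ! j = 2" if "v \<in> ?V" for v
      using x that j by (intro nth_words) auto
    hence "?V = {v\<in>?V. x v ! j = 1} \<union> {v\<in>?V. x v ! j = 2}" by blast
    hence "card ?V = card ({v\<in>?V. x v ! j = 1} \<union> {v\<in>?V. x v ! j = 2})" by (rule arg_cong)
    also have "\<dots> = card {v\<in>?V. x v ! j = 1} + card {v\<in>?V. x v ! j = 2}"
      by (rule card_Un_disjoint) auto
    finally show ?thesis by (auto simp: P_def)
  qed
  show "support (tensor_power ?D m) = edge_words ?V m"
    unfolding support_def idx coord edge_words_def using P by auto
qed

definition diagonal_at :: "'v set \<Rightarrow> nat \<Rightarrow> nat \<Rightarrow> bool" where
  "diagonal_at V m n \<longleftrightarrow> (\<exists>\<Psi>. diagonal_degeneration V (edge_words V m) \<Psi> \<and> card \<Psi> = 2 ^ n)"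

lemma degenerates_iff_diagonal_at:
  assumes k: "k \<ge> 2"
  shows "monomially_degenerates_to (tensor_power (dicke_tensor 2 (k - 2)) m)
           (tensor_power (unit_tensor {1..k} 2) n) \<longleftrightarrow> diagonal_at {1..k} m n"
proof -
  let ?D = "tensor_power (dicke_tensor 2 (k - 2)) m"
  have V: "finite {1..k}" "{1..k} \<noteq> {}" using k by auto
  have legs: "legs ?D = {1..k}" using k by (simp add: tensor_power_def dicke_tensor_def)
  have idx: "finite (idx ?D v)" for v
    using finite_words[of m] by (simp add: tensor_power_def dicke_tensor_def words_def)
  show ?thesis
    using diagonal_of_monomial_degeneration[OF V legs idx support_dicke_power(2)[OF k]]
      monomial_degeneration_of_diagonal[OF V legs idx support_dicke_power(2)[OF k]]
    unfolding support_dicke_power(1)[OF k] diagonal_at_def by metis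
qed

lemma diagonal_at_0: "V \<noteq> {} \<Longrightarrow> diagonal_at V 0 0"
  unfolding diagonal_at_def
proof (intro exI[of _ "{\<lambda>v\<in>V. []}"] conjI)
  have "edge_words V 0 = {\<lambda>v\<in>V. []}"
    by (auto simp: edge_words_def words_def PiE_iff intro!: extensionalityI[of _ V])
  thus "diagonal_degeneration V (edge_words V 0) {\<lambda>v\<in>V. []}"
    by (auto simp: diagonal_degeneration_def intro!: exI[of _ "\<lambda>_ _. 0"])
qed simp

text \<open>
  Concatenating words turns pairs of edge sequences into edge sequences. Both weights add up to
  nonnegative values, so their sum vanishes on the product of the two diagonals only.
\<close>

lemma diagonal_at_add:
  assumes V: "finite V" "V \<noteq> {}" and 1: "diagonal_at V m n" and 2: "diagonal_at V m' n'"
  shows "diagonal_at V (m + m') (n + n')"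
proof -
  obtain \<Psi> \<alpha> where \<Psi>: "\<Psi> \<subseteq> edge_words V m" "\<forall>x\<in>\<Psi>. \<forall>y\<in>\<Psi>. \<forall>v\<in>V. x v = y v \<longrightarrow> x = y"
      "\<forall>x\<in>\<Psi>. (\<Sum>v\<in>V. (\<alpha> :: 'a \<Rightarrow> nat list \<Rightarrow> int) v (x v)) = 0"
      "\<forall>x\<in>edge_words V m - \<Psi>. (\<Sum>v\<in>V. \<alpha> v (x v)) > 0" "card \<Psi> = 2 ^ n"
    using 1 unfolding diagonal_at_def diagonal_degeneration_def by blast
  obtain \<Psi>' \<alpha>' where \<Psi>': "\<Psi>' \<subseteq> edge_words V m'" "\<forall>x\<in>\<Psi>'. \<forall>y\<in>\<Psi>'. \<forall>v\<in>V. x v = y v \<longrightarrow> x = y"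
      "\<forall>x\<in>\<Psi>'. (\<Sum>v\<in>V. (\<alpha>' :: 'a \<Rightarrow> nat list \<Rightarrow> int) v (x v)) = 0"
      "\<forall>x\<in>edge_words V m' - \<Psi>'. (\<Sum>v\<in>V. \<alpha>' v (x v)) > 0" "card \<Psi>' = 2 ^ n'"
    using 2 unfolding diagonal_at_def diagonal_degeneration_def by blast
  define L where "L z = (\<lambda>v\<in>V. take m (z v))" for z :: "'a \<Rightarrow> nat list"
  define R where "R z = (\<lambda>v\<in>V. drop m (z v))" for z :: "'a \<Rightarrow> nat list"
  define \<Theta> where "\<Theta> = {z \<in> edge_words V (m + m'). L z \<in> \<Psi> \<and> R z \<in> \<Psi>'}"
  define J where "J x y = (\<lambda>v\<in>V. x v @ y v)" for x y :: "'a \<Rightarrow> nat list"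
  have L: "L z \<in> edge_words V m" and R: "R z \<in> edge_words V m'" if z: "z \<in> edge_words V (m + m')" for z
  proof -
    have w: "z v \<in> words (m + m')" if "v \<in> V" for v using z that by (auto simp: edge_words_def)
    have c: "card {v\<in>V. z v ! j = 1} = 2" if "j < m + m'" for j using z that by (simp add: edge_words_def)
    have "take m (z v) \<in> words m" "drop m (z v) \<in> words m'" if "v \<in> V" for v
      using w[OF that] by (auto simp: words_def dest: in_set_takeD in_set_dropD)
    moreover have "{v\<in>V. L z v ! j = 1} = {v\<in>V. z v ! j = 1}" if "j < m" for j
      using that by (auto simp: L_def)
    moreover have "{v\<in>V. R z v ! j = 1} = {v\<in>V. z v ! (m + j) = 1}" for j
      using w by (auto simp: R_def words_def)
    ultimately show "L z \<in> edge_words V m" "R z \<in> edge_words V m'"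
      using c by (auto simp: edge_words_def L_def R_def)
  qed
  have J: "J x y \<in> edge_words V (m + m') \<and> L (J x y) = x \<and> R (J x y) = y"
    if x: "x \<in> edge_words V m" and y: "y \<in> edge_words V m'" for x y
  proof -
    have wx: "x v \<in> words m" and wy: "y v \<in> words m'" if "v \<in> V" for v
      using x y that by (auto simp: edge_words_def)
    have ext: "x \<in> extensional V" "y \<in> extensional V" using x y by (auto simp: edge_words_def PiE_def)
    have "card {v\<in>V. J x y v ! j = 1} = 2" if j: "j < m + m'" for j
    proof (cases "j < m")
      case True
      hence "{v\<in>V. J x y v ! j = 1} = {v\<in>V. x v ! j = 1}"
        using wx by (auto simp: J_def nth_append words_def)
      thus ?thesis using x True by (simp add: edge_words_def)
    next
      case False
      hence "{v\<in>V. J x y v ! j = 1} = {v\<in>V. y v ! (j - m) = 1}"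
        using wx by (auto simp: J_def nth_append words_def)
      thus ?thesis using y False j by (simp add: edge_words_def)
    qed
    hence "J x y \<in> edge_words V (m + m')"
      using wx wy by (auto simp: edge_words_def J_def words_def)
    moreover have "L (J x y) = x"
      by (rule extensionalityI[of _ V]) (use ext wx in \<open>auto simp: L_def J_def words_def\<close>)
    moreover have "R (J x y) = y"
      by (rule extensionalityI[of _ V]) (use ext wx in \<open>auto simp: R_def J_def words_def\<close>)
    ultimately show ?thesis by blast
  qed
  have LR: "z = J (L z) (R z)" if "z \<in> edge_words V (m + m')" for z
    by (rule extensionalityI[of _ V]) (use that in \<open>auto simp: J_def L_def R_def edge_words_def PiE_def\<close>)
  have "bij_betw (\<lambda>z. (L z, R z)) \<Theta> (\<Psi> \<times> \<Psi>')"
  proof (rule bij_betw_byWitness[where f'="\<lambda>(x, y). J x y"])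
    show "\<forall>z\<in>\<Theta>. (case (L z, R z) of (x, y) \<Rightarrow> J x y) = z" using LR by (auto simp: \<Theta>_def)
    show "\<forall>p\<in>\<Psi> \<times> \<Psi>'. (L (case p of (x, y) \<Rightarrow> J x y), R (case p of (x, y) \<Rightarrow> J x y)) = p"
      using J \<Psi>(1) \<Psi>'(1) by auto
    show "(\<lambda>z. (L z, R z)) ` \<Theta> \<subseteq> \<Psi> \<times> \<Psi>'" by (auto simp: \<Theta>_def)
    have "J x y \<in> \<Theta>" if xy: "x \<in> \<Psi>" "y \<in> \<Psi>'" for x y
    proof -
      have "J x y \<in> edge_words V (m + m') \<and> L (J x y) = x \<and> R (J x y) = y"
        by (rule J) (use xy \<Psi>(1) \<Psi>'(1) in auto)
      thus ?thesis using xy by (simp add: \<Theta>_def)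
    qed
    thus "(\<lambda>(x, y). J x y) ` (\<Psi> \<times> \<Psi>') \<subseteq> \<Theta>" by auto
  qed
  hence card: "card \<Theta> = 2 ^ (n + n')"
    using bij_betw_same_card[of _ \<Theta> "\<Psi> \<times> \<Psi>'"] \<Psi>(5) \<Psi>'(5) by (simp add: card_cartesian_product power_add)
  have sum: "(\<Sum>v\<in>V. \<alpha> v (take m (z v)) + \<alpha>' v (drop m (z v)))
      = (\<Sum>v\<in>V. \<alpha> v (L z v)) + (\<Sum>v\<in>V. \<alpha>' v (R z v))" for z
    by (simp add: sum.distrib L_def R_def)
  have "diagonal_degeneration V (edge_words V (m + m')) \<Theta>"
    unfolding diagonal_degeneration_def
  proof (intro conjI exI[of _ "\<lambda>v w. \<alpha> v (take m w) + \<alpha>' v (drop m w)"] ballI impI)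
    show "\<Theta> \<subseteq> edge_words V (m + m')" by (auto simp: \<Theta>_def)
  next
    fix x y v assume xy: "x \<in> \<Theta>" "y \<in> \<Theta>" "v \<in> V" "x v = y v"
    have "L x v = L y v" "R x v = R y v" using xy by (simp_all add: L_def R_def)
    hence "L x = L y" "R x = R y" using xy \<Psi>(2) \<Psi>'(2) unfolding \<Theta>_def by blast+
    thus "x = y" using LR[of x] LR[of y] xy by (simp add: \<Theta>_def)
  next
    fix z assume "z \<in> \<Theta>"
    thus "(\<Sum>v\<in>V. \<alpha> v (take m (z v)) + \<alpha>' v (drop m (z v))) = 0"
      unfolding sum using \<Psi>(3) \<Psi>'(3) by (simp add: \<Theta>_def)
  next
    fix z assume z: "z \<in> edge_words V (m + m') - \<Theta>"
    have "(\<Sum>v\<in>V. \<alpha> v (L z v)) \<ge> 0" "L z \<notin> \<Psi> \<Longrightarrow> (\<Sum>v\<in>V. \<alpha> v (L z v)) > 0"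
      using \<Psi>(3,4) L[of z] z by (cases "L z \<in> \<Psi>"; simp add: order.strict_implies_order)+
    moreover have "(\<Sum>v\<in>V. \<alpha>' v (R z v)) \<ge> 0" "R z \<notin> \<Psi>' \<Longrightarrow> (\<Sum>v\<in>V. \<alpha>' v (R z v)) > 0"
      using \<Psi>'(3,4) R[of z] z by (cases "R z \<in> \<Psi>'"; simp add: order.strict_implies_order)+
    moreover have "L z \<notin> \<Psi> \<or> R z \<notin> \<Psi>'" using z by (auto simp: \<Theta>_def)
    ultimately show "(\<Sum>v\<in>V. \<alpha> v (take m (z v)) + \<alpha>' v (drop m (z v))) > 0"
      unfolding sum by force
  qed
  thus ?thesis using card unfolding diagonal_at_def by blast
qed

text \<open>
  A subset of a diagonal is again the limit of a degeneration: on one leg, penalize the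
  basis vectors that the subset does not use.
\<close>

lemma diagonal_degeneration_subset:
  assumes V: "finite V" "V \<noteq> {}" and deg: "diagonal_degeneration V \<Phi> \<Psi>" and sub: "\<Psi>' \<subseteq> \<Psi>"
  shows "diagonal_degeneration V \<Phi> \<Psi>'"
proof -
  obtain v0 where v0: "v0 \<in> V" using V by blast
  obtain \<alpha> where \<Psi>: "\<Psi> \<subseteq> \<Phi>" "\<forall>x\<in>\<Psi>. \<forall>y\<in>\<Psi>. \<forall>v\<in>V. x v = y v \<longrightarrow> x = y"
      "\<forall>x\<in>\<Psi>. (\<Sum>v\<in>V. (\<alpha> :: 'a \<Rightarrow> 'b \<Rightarrow> int) v (x v)) = 0"
      "\<forall>x\<in>\<Phi> - \<Psi>. (\<Sum>v\<in>V. \<alpha> v (x v)) > 0"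
    using deg unfolding diagonal_degeneration_def by blast
  define U where "U = (\<lambda>x. x v0) ` \<Psi>'"
  have sum: "(\<Sum>v\<in>V. \<alpha> v (x v) + of_bool (v = v0 \<and> x v \<notin> U)) = (\<Sum>v\<in>V. \<alpha> v (x v)) + of_bool (x v0 \<notin> U)" for x
  proof -
    have "(\<Sum>v\<in>V. of_bool (v = v0 \<and> x v \<notin> U)) = (\<Sum>v\<in>V. if v = v0 then of_bool (x v0 \<notin> U) else (0::int))"
      by (rule sum.cong) auto
    thus ?thesis using V v0 by (simp add: sum.distrib)
  qed
  show ?thesis
    unfolding diagonal_degeneration_def
  proof (intro conjI exI[of _ "\<lambda>v b. \<alpha> v b + of_bool (v = v0 \<and> b \<notin> U)"] ballI impI)
    show "\<Psi>' \<subseteq> \<Phi>" using sub \<Psi> by blast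
    show "x = y" if "x \<in> \<Psi>'" "y \<in> \<Psi>'" "v \<in> V" "x v = y v" for x y v using that sub \<Psi>(2) by blast
    show "(\<Sum>v\<in>V. \<alpha> v (x v) + of_bool (v = v0 \<and> x v \<notin> U)) = 0" if x: "x \<in> \<Psi>'" for x
    proof -
      have "x v0 \<in> U" using x by (auto simp: U_def)
      moreover have "x \<in> \<Psi>" using x sub by blast
      ultimately show ?thesis unfolding sum using \<Psi>(3) by simp
    qed
    show "(\<Sum>v\<in>V. \<alpha> v (x v) + of_bool (v = v0 \<and> x v \<notin> U)) > 0" if x: "x \<in> \<Phi> - \<Psi>'" for x
    proof (cases "x \<in> \<Psi>")
      case True
      have "x v0 \<notin> U" using True x sub \<Psi>(2) v0 unfolding U_def by blast
      thus ?thesis unfolding sum using \<Psi>(3) True by simp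
    next
      case False
      hence "(\<Sum>v\<in>V. \<alpha> v (x v)) > 0" using \<Psi>(4) x by blast
      thus ?thesis unfolding sum by simp
    qed
  qed
qed

lemma diagonal_at_1:
  assumes V: "finite V" "V \<noteq> {}" and "diagonal_at V m n" "n \<ge> 1"
  shows "diagonal_at V m 1"
proof -
  obtain \<Psi> where \<Psi>: "diagonal_degeneration V (edge_words V m) \<Psi>" "card \<Psi> = 2 ^ n"
    using assms(3) by (auto simp: diagonal_at_def)
  have "(2::nat) ^ 1 \<le> 2 ^ n" using assms(4) by (intro power_increasing) auto
  then obtain \<Psi>' where "\<Psi>' \<subseteq> \<Psi>" "card \<Psi>' = 2 ^ 1"
    using obtain_subset_with_card_n[of "2 ^ 1" \<Psi>] \<Psi>(2) by auto
  thus ?thesis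
    using diagonal_degeneration_subset[OF V \<Psi>(1)] unfolding diagonal_at_def by blast
qed

lemma diagonal_at_le:
  assumes "V \<noteq> {}" "diagonal_at V m n"
  shows "n \<le> m"
proof -
  obtain \<Psi> where "diagonal_degeneration V (edge_words V m) \<Psi>" "card \<Psi> = 2 ^ n"
    using assms by (auto simp: diagonal_at_def)
  with card_diagonal_le(2)[OF assms(1), of m \<Psi>] have "(2::nat) ^ n \<le> 2 ^ m" by simp
  thus ?thesis by simp
qed

text \<open>
  The bound per position of the words: a diagonal of size \<open>2 ^ n\<close> gains \<open>n / m\<close>, and the number of
  edge multisets contributes an error of order \<open>ln m / m\<close>.
\<close>

lemma exponent_bound_diagonal_at:
  assumes V: "finite V" "card V \<ge> 2" and q: "q \<ge> 2" and n: "n \<ge> 1" and d: "diagonal_at V m n"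
  shows "exponent_per_edge V (complete_edges V) * log 2 (real q)
     \<le> log 2 (real q + 2) - real n / real m
        + card (complete_edges V) / ln 2 * (ln 2 / real m + ln (real m) / real m)"
proof -
  have V0: "V \<noteq> {}" using V by auto
  obtain \<Psi> where \<Psi>: "diagonal_degeneration V (edge_words V m) \<Psi>" "card \<Psi> = 2 ^ n"
    using d by (auto simp: diagonal_at_def)
  have m: "m \<ge> 1" using diagonal_at_le[OF V0 d] n by simp
  have "\<Psi> \<noteq> {}" using \<Psi>(2) by auto
  note b = exponent_bound_diagonal[OF V q m \<Psi>(1) this]
  have "ln (real m + 1) \<le> ln (2 * real m)" using m by simp
  also have "\<dots> = ln 2 + ln (real m)" using m by (simp add: ln_mult)
  finally have "log 2 (real m + 1) \<le> (ln 2 + ln (real m)) / ln 2"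
    by (simp add: log_def divide_right_mono)
  hence "card (complete_edges V) * log 2 (real m + 1) \<le> card (complete_edges V) * ((ln 2 + ln (real m)) / ln 2)"
    by (rule mult_left_mono) simp
  hence "exponent_per_edge V (complete_edges V) * (real m * log 2 (real q))
      \<le> real m * log 2 (real q + 2) - real n + card (complete_edges V) * ((ln 2 + ln (real m)) / ln 2)"
    using b \<Psi>(2) by (simp add: log_nat_power)
  hence "exponent_per_edge V (complete_edges V) * (real m * log 2 (real q)) / real m
      \<le> (real m * log 2 (real q + 2) - real n + card (complete_edges V) * ((ln 2 + ln (real m)) / ln 2)) / real m"
    by (rule divide_right_mono) simp
  moreover have "exponent_per_edge V (complete_edges V) * (real m * log 2 (real q)) / real m
      = exponent_per_edge V (complete_edges V) * log 2 (real q)"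
    using m by simp
  moreover have "(real m * x - real n + c * ((ln 2 + ln (real m)) / ln 2)) / real m
      = x - real n / real m + c / ln 2 * (ln 2 / real m + ln (real m) / real m)" for x c
    using m by (simp add: field_simps)
  ultimately show ?thesis by simp
qed

text \<open>
  Since diagonals can be shrunk and multiplied, the minimal powers are infinite for all \<open>n \<ge> 1\<close> or
  finite for all \<open>n\<close>. In the first case the subexponent is \<open>0\<close>. In the second one they are subadditive,
  and their growth rate is at least \<open>1\<close> because a leg has only \<open>2 ^ m\<close> words of length \<open>m\<close>.
\<close>

lemma monomial_subexponent_dicke:
  assumes k: "k \<ge> 2"
  shows "monomial_subexponent (dicke_tensor 2 (k - 2)) = 0 \<or>
    (\<exists>a l. (\<forall>n. diagonal_at {1..k} (a n) n) \<and> l \<ge> 1 \<and> (\<lambda>n. real (a n) / real n) \<longlonglongrightarrow> l \<and>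
       monomial_subexponent (dicke_tensor 2 (k - 2)) = ereal (1 / l))"
proof -
  let ?V = "{1..k}"
  have V: "finite ?V" "?V \<noteq> {}" using k by auto
  define F where "F n = (INF m\<in>{m. diagonal_at ?V m n}. ereal (real m)) / ereal (real n)" for n
  have legs: "legs (dicke_tensor 2 (k - 2)) = ?V" using k by (simp add: dicke_tensor_def)
  have sub: "monomial_subexponent (dicke_tensor 2 (k - 2)) = inverse (lim F)"
    unfolding monomial_subexponent_def legs degenerates_iff_diagonal_at[OF k] F_def ..
  show ?thesis
  proof (cases "\<exists>m. diagonal_at ?V m 1")
    case False
    have "F n = \<infinity>" if n: "n \<ge> 1" for n
    proof -
      have empty: "{m. diagonal_at ?V m n} = {}" using diagonal_at_1[OF V _ n] False by blast
      show ?thesis unfolding F_def empty using n by (simp add: top_ereal_def)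
    qed
    hence "F \<longlonglongrightarrow> \<infinity>"
      by (intro tendsto_eventually eventually_sequentiallyI[of 1])
    hence "lim F = \<infinity>" by (rule limI)
    thus ?thesis by (simp add: sub)
  next
    case True
    then obtain m1 where m1: "diagonal_at ?V m1 1" by blast
    have ex: "\<exists>m. diagonal_at ?V m n" for n
    proof (induction n)
      case 0
      show ?case using diagonal_at_0[OF V(2)] by blast
    next
      case (Suc n)
      then obtain m where "diagonal_at ?V m n" by blast
      from diagonal_at_add[OF V this m1] show ?case by auto
    qed
    define a where "a n = (LEAST m. diagonal_at ?V m n)" for n
    have a: "diagonal_at ?V (a n) n" for n unfolding a_def by (rule LeastI_ex[OF ex])
    have a_le: "a n \<le> m" if "diagonal_at ?V m n" for m n unfolding a_def using that by (rule Least_le)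
    have "a (m + n) \<le> a m + a n" for m n by (intro a_le diagonal_at_add V a)
    then obtain l where l: "(\<lambda>n. real (a n) / real n) \<longlonglongrightarrow> l" by (rule fekete_nat)
    have "l \<ge> 1"
    proof (rule LIMSEQ_le_const[OF l])
      have "1 \<le> real (a n) / real n" if "n \<ge> 1" for n
        using diagonal_at_le[OF V(2) a, of n] that by simp
      thus "\<exists>N. \<forall>n\<ge>N. 1 \<le> real (a n) / real n" by blast
    qed
    have F: "F n = ereal (real (a n) / real n)" if n: "n \<ge> 1" for n
    proof -
      have "(INF m\<in>{m. diagonal_at ?V m n}. ereal (real m)) = ereal (real (a n))"
        by (intro antisym INF_lower2[of "a n"] INF_greatest) (use a a_le in auto)
      thus ?thesis using n by (simp add: F_def)
    qed
    have "(\<lambda>n. ereal (real (a n) / real n)) \<longlonglongrightarrow> ereal l" using l by simp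
    hence "F \<longlonglongrightarrow> ereal l"
      by (rule Lim_transform_eventually) (use F in \<open>auto intro!: eventually_sequentiallyI[of 1]\<close>)
    hence "lim F = ereal l" by (rule limI)
    hence "monomial_subexponent (dicke_tensor 2 (k - 2)) = ereal (1 / l)"
      using \<open>l \<ge> 1\<close> by (simp add: sub inverse_eq_divide)
    thus ?thesis using a l \<open>l \<ge> 1\<close> by blast
  qed
qed

section \<open>The bound on the exponent per edge\<close>

theorem theorem1p2p2:
  fixes k q :: nat
  assumes "k \<ge> 2" and "q \<ge> 2"
  shows "exponent_per_edge {1..k} (complete_edges {1..k})
           \<le> log (real q)
               ((real q + 2) / 2 powr real_of_ereal (monomial_subexponent (dicke_tensor 2 (k - 2))))"
proof -
  let ?V = "{1..k}"
  let ?s = "real_of_ereal (monomial_subexponent (dicke_tensor 2 (k - 2)))"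
  define \<tau> where "\<tau> = exponent_per_edge ?V (complete_edges ?V)"
  define E where "E = real (card (complete_edges ?V))"
  have V: "finite ?V" "card ?V \<ge> 2" using assms by auto
  have lq: "log 2 (real q) > 0" using assms(2) by simp
  have "\<tau> * log 2 (real q) \<le> log 2 (real q + 2) - ?s"
  proof (cases "monomial_subexponent (dicke_tensor 2 (k - 2)) = 0")
    case True
    thus ?thesis using exponent_bound_trivial[OF V assms(2)] by (simp add: \<tau>_def)
  next
    case False
    then obtain a l where a: "\<And>n. diagonal_at ?V (a n) n" and l: "l \<ge> 1"
        "(\<lambda>n. real (a n) / real n) \<longlonglongrightarrow> l"
        "monomial_subexponent (dicke_tensor 2 (k - 2)) = ereal (1 / l)"
      using monomial_subexponent_dicke[OF assms(1)] by blast
    have a_ge: "n \<le> a n" for n using diagonal_at_le[OF _ a] assms(1) by auto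
    have a_top: "filterlim (\<lambda>n. real (a n)) at_top sequentially"
      by (rule filterlim_at_top_mono[OF filterlim_real_sequentially]) (use a_ge in auto)
    have lim1: "(\<lambda>n. ln (real (a n)) / real (a n)) \<longlonglongrightarrow> 0"
      by (rule filterlim_compose[OF ln_x_over_x_tendsto_0 a_top])
    have lim2: "(\<lambda>n. ln 2 / real (a n)) \<longlonglongrightarrow> 0"
      by (rule tendsto_divide_0[OF tendsto_const filterlim_at_top_imp_at_infinity[OF a_top]])
    have lim3: "(\<lambda>n. inverse (real (a n) / real n)) \<longlonglongrightarrow> inverse l"
      by (rule tendsto_inverse[OF l(2)]) (use l(1) in simp)
    have "(\<lambda>n. log 2 (real q + 2) - inverse (real (a n) / real n)
        + E / ln 2 * (ln 2 / real (a n) + ln (real (a n)) / real (a n)))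
        \<longlonglongrightarrow> log 2 (real q + 2) - inverse l + E / ln 2 * (0 + 0)"
      by (intro tendsto_add tendsto_diff tendsto_mult tendsto_const lim1 lim2 lim3)
    hence "\<tau> * log 2 (real q) \<le> log 2 (real q + 2) - inverse l + E / ln 2 * (0 + 0)"
    proof (rule LIMSEQ_le_const)
      have "\<tau> * log 2 (real q) \<le> log 2 (real q + 2) - inverse (real (a n) / real n)
        + E / ln 2 * (ln 2 / real (a n) + ln (real (a n)) / real (a n))" if n: "n \<ge> 1" for n
        using exponent_bound_diagonal_at[OF V assms(2) n a] by (simp add: \<tau>_def E_def)
      thus "\<exists>N. \<forall>n\<ge>N. \<tau> * log 2 (real q) \<le> log 2 (real q + 2) - inverse (real (a n) / real n)
        + E / ln 2 * (ln 2 / real (a n) + ln (real (a n)) / real (a n))" by blast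
    qed
    thus ?thesis using l(3) by (simp add: inverse_eq_divide)
  qed
  hence "\<tau> \<le> (log 2 (real q + 2) - ?s) / log 2 (real q)"
    using lq by (simp add: pos_le_divide_eq)
  also have "log 2 (real q + 2) - ?s = log 2 ((real q + 2) / 2 powr ?s)"
    by (simp add: log_divide)
  also have "log 2 ((real q + 2) / 2 powr ?s) / log 2 (real q) = log (real q) ((real q + 2) / 2 powr ?s)"
    using assms(2) by (simp add: log_def)
  finally show ?thesis unfolding \<tau>_def .
qed

end
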